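(* Let $\{X_i, i\in\mathbb{Z}\}$ be a stationary sequence of standard (mean 0, variance 1) Gaussian random variables (a stationary Gaussian sequence) with covariance function $r_n=E(X_1X_{n+1})$. Suppose that $r_n$ is convex for all $n\ge 0$, $r_n=o(1)$ as $n\to\infty$, and $(r_n\ln n)^{-1}$ is monotone for large $n$ and is $o(1)$ as $n\to\infty$. For $\beta>0$ let $$\Upsilon(X)=\min\{i\in\mathbb{Z}: X_i>-\beta i\},\qquad \tau(X)=\max\{i\ge0: X_i>\beta i\}.$$ Then for any $x,y\in\mathbb{R}$ $$\lim_{\beta\to0}P\left(\Upsilon(X)\geq -u_{\beta}(x),\ \tau(X)\leq u_{\beta}(y)\right)=\Phi(\min\{x,y\}),$$ where $\Phi$ is the standard normal distribution function, $\rho_\beta=r_{[\beta^{-1}]}$, and $$u_{\beta}(x)=\left(\sqrt{1-\rho_\beta}\;a\big(\beta/\sqrt{1-\rho_\beta}\big)+\sqrt{\rho_{\beta}}\,x\right)\beta^{-1},\qquad a(\beta)=\sqrt{2\left(\ln\beta^{-1}-\ln\left(2\ln\beta^{-1}\right)+\ln\left((2\pi)^{-1/2}\right)\right)}.$$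
   Context: $[t]$ denotes the integer part of $t$. In the definitions of $\Upsilon(X)$ and $\tau(X)$ the index $i$ ranges over integers; both are almost surely finite, and if the set defining $\tau(X)$ is empty, $\tau(X)$ is taken to be $0$. The limit $\beta\to0$ is through positive values, and all quantities are considered for $\beta$ small enough that they are well defined. *)

theory Defs
  imports "HOL-Probability.Probability"
begin

text \<open>Point masses count as (degenerate) normal laws.\<close>

definition normal_rv :: "'a measure \<Rightarrow> ('a \<Rightarrow> real) \<Rightarrow> bool" where
  "normal_rv M Y \<longleftrightarrow>
     (\<exists>\<mu> \<sigma>. \<sigma> > 0 \<and> distributed M lborel Y (normal_density \<mu> \<sigma>)) \<or>
     (Y \<in> borel_measurable M \<and> (\<exists>\<mu>. AE \<omega> in M. Y \<omega> = \<mu>))"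

definition gaussian_process :: "'a measure \<Rightarrow> ('i \<Rightarrow> 'a \<Rightarrow> real) \<Rightarrow> bool" where
  "gaussian_process M X \<longleftrightarrow>
     (\<forall>J c. finite J \<longrightarrow> normal_rv M (\<lambda>\<omega>. \<Sum>i\<in>J. c i * X i \<omega>))"

definition stationary :: "'a measure \<Rightarrow> (int \<Rightarrow> 'a \<Rightarrow> real) \<Rightarrow> bool" where
  "stationary M X \<longleftrightarrow>
     (\<forall>i. X i \<in> borel_measurable M) \<and>
     (\<forall>k. distr M (PiM UNIV (\<lambda>_. borel)) (\<lambda>\<omega> i. X (i + k) \<omega>) =
          distr M (PiM UNIV (\<lambda>_. borel)) (\<lambda>\<omega> i. X i \<omega>))"

definition standard_stationary_gaussian :: "'a measure \<Rightarrow> (int \<Rightarrow> 'a \<Rightarrow> real) \<Rightarrow> bool" where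
  "standard_stationary_gaussian M X \<longleftrightarrow>
     gaussian_process M X \<and> stationary M X \<and>
     (\<forall>i. distributed M lborel (X i) std_normal_density)"

definition convex_seq :: "(nat \<Rightarrow> real) \<Rightarrow> bool" where
  "convex_seq r \<longleftrightarrow> (\<forall>n. 2 * r (n + 1) \<le> r n + r (n + 2))"

text \<open>
  The next two functions take a path of the process.  The minimum (resp. the maximum of a
  nonempty set) exists for almost every path; on the remaining null set the values are unspecified.
\<close>

definition Upsilon :: "real \<Rightarrow> (int \<Rightarrow> real) \<Rightarrow> int" where
  "Upsilon \<beta> x = (LEAST i. x i > - \<beta> * of_int i)"

definition tau :: "real \<Rightarrow> (int \<Rightarrow> real) \<Rightarrow> int" where
  "tau \<beta> x = (if \<exists>i\<ge>0. x i > \<beta> * of_int i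
              then GREATEST i. i \<ge> 0 \<and> x i > \<beta> * of_int i else 0)"

definition rho :: "(nat \<Rightarrow> real) \<Rightarrow> real \<Rightarrow> real" where
  "rho r \<beta> = r (nat \<lfloor>1 / \<beta>\<rfloor>)"

definition a_fun :: "real \<Rightarrow> real" where
  "a_fun \<beta> = sqrt (2 * (ln (1 / \<beta>) - ln (2 * ln (1 / \<beta>)) + ln ((2 * pi) powr (- 1 / 2))))"

definition u_fun :: "(nat \<Rightarrow> real) \<Rightarrow> real \<Rightarrow> real \<Rightarrow> real" where
  "u_fun r \<beta> x = (sqrt (1 - rho r \<beta>) * a_fun (\<beta> / sqrt (1 - rho r \<beta>)) + sqrt (rho r \<beta>) * x) / \<beta>"

definition Phi :: "real \<Rightarrow> real" where
  "Phi x = cdf std_normal_distribution x"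

end

theory Submission
  imports Defs "HOL-Real_Asymp.Real_Asymp"
begin

text \<open>
  Only indices of size \<open>1/\<beta>\<close>, up to powers of \<open>ln (1/\<beta>)\<close>, decide the event. As \<open>r\<close> decreases
  while \<open>r n * ln n\<close> eventually increases, \<open>r\<close> is nearly constant on that range, with value \<open>\<rho> = rho r \<beta>\<close>.
  The process therefore behaves like \<open>sqrt (1 - \<rho>) * Y i + sqrt \<rho> * Z\<close> with one standard normal
  \<open>Z\<close> common to both ends of the index axis. The extremes of \<open>Y\<close> above a sloping boundary fluctuate
  on the scale \<open>1 / sqrt (ln (1/\<beta>))\<close>, which is negligible against \<open>sqrt \<rho>\<close> because
  \<open>\<rho> * ln (1/\<beta>)\<close> tends to infinity. So the last exit lies below \<open>u y\<close> if \<open>Z \<le> y\<close>, the first entrance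
  lies above \<open>- u x\<close> if \<open>Z \<le> x\<close>, and both happen together if \<open>Z \<le> min x y\<close>.

  Both parts can be read off the process itself: the mean \<open>S\<close> of \<open>X\<close> over an interval of indices
  represents \<open>sqrt \<rho> * Z\<close>, and the residual \<open>X j - S\<close> represents \<open>sqrt (1 - \<rho>) * Y j\<close>.

  \<^item> Lower bound (\<open>target_ge\<close>). Let \<open>z = min x y\<close>. On \<open>S \<le> sqrt \<rho> * (z - \<epsilon>)\<close>, an exceedance at \<open>j\<close> with
    \<open>u z < \<bar>j\<bar>\<close> forces the residual at \<open>j\<close> to exceed a high level. Summing the
    normal tail over all such \<open>j\<close> gives a null sequence (\<open>prob_near\<close>, \<open>prob_far\<close>); the variance of
    the residual is at most \<open>1 - \<rho>\<close> up to an error too small to matter (\<open>slack_negligible\<close>).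

  \<^item> Upper bound (\<open>window_exceedance_upper\<close>). In a window just beyond \<open>u y\<close>, on
    \<open>S > sqrt \<rho> * (y + \<epsilon>)\<close>, the absence of exceedances keeps all residuals in the window below a level
    at which the expected number of exceedances diverges (\<open>expected_count_at_top\<close>). A second-moment
    argument shows that this is unlikely (\<open>prob_window_below_le\<close>). Its ingredients are a bound for the
    probability that two correlated normal variables lie in a box (\<open>bivariate_normal_box_le\<close>) and the
    smallness of the average dependence (\<open>box_factor_average\<close>): convexity gives \<open>r 1 < 1\<close>, which
    handles short lags, and the monotonicity of \<open>r n * ln n\<close> handles the others. The left end of
    the axis follows by reflection (\<open>reflected\<close>).
\<close>

section \<open>Pairs of jointly normal variables\<close>

lemma prob_space_std_normal: "prob_space std_normal_distribution"
 by (rule prob_space_normal_density) simp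

text \<open>A weight under which the characteristic function of \<open>U\<close> is only multiplied by a constant leaves the
 law of \<open>U\<close> standard normal: this is Levy's uniqueness theorem for the law of \<open>U\<close> under the
 probability with density \<open>W / c\<close>.\<close>

lemma (in prob_space) weighted_law_std_normal:
 fixes U W :: "'a \<Rightarrow> real"
 assumes [measurable]: "U \<in> borel_measurable M" "W \<in> borel_measurable M"
  and W: "\<And>\<omega>. 0 \<le> W \<omega>" "\<And>\<omega>. W \<omega> \<le> B" and c: "c > 0"
  and char: "\<And>a. (CLINT \<omega>|M. iexp (a * U \<omega>) * of_real (W \<omega>)) = of_real (c * exp (- (a\<^sup>2) / 2))"
  and [measurable]: "A \<in> sets borel"
 shows "(LINT \<omega>|M. indicator A (U \<omega>) * W \<omega>) = c * measure std_normal_distribution A"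
proof -
 have intW: "integrable M W"
  using W by (intro integrable_const_bound[where B=B]) auto
 have EW: "(LINT \<omega>|M. W \<omega>) = c"
 proof -
  have "complex_of_real (LINT \<omega>|M. W \<omega>) = of_real c"
   using char[of 0] by (simp add: integral_complex_of_real)
  then show ?thesis by (simp only: of_real_eq_iff)
 qed
 define D where "D = density M (\<lambda>\<omega>. ennreal (W \<omega> / c))"
 have [measurable_cong, simp]: "sets D = sets M" by (simp add: D_def)
 have "emeasure D (space D) = (\<integral>\<^sup>+\<omega>. ennreal (W \<omega> / c) \<partial>M)"
  by (simp add: D_def emeasure_density cong: nn_integral_cong)
 also have "\<dots> = ennreal (LINT \<omega>|M. W \<omega> / c)"
  using W c intW by (intro nn_integral_eq_integral) auto
 also have "\<dots> = 1"
  using EW c by simp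
 finally interpret D: prob_space D
  by (rule prob_spaceI)
 have UD[measurable]: "U \<in> borel_measurable D" by (simp add: D_def)
 have "distr D borel U = std_normal_distribution"
 proof (rule Levy_uniqueness)
  show "real_distribution (distr D borel U)"
   by (intro real_distribution.intro D.prob_space_distr UD) (auto simp: real_distribution_axioms_def)
  show "real_distribution std_normal_distribution" by (rule real_dist_normal_dist)
  show "char (distr D borel U) = char std_normal_distribution"
  proof
   fix a
   have "char (distr D borel U) a = (CLINT \<omega>|D. iexp (a * U \<omega>))"
    unfolding char_def by (subst integral_distr) auto
   also have "\<dots> = (CLINT \<omega>|M. (W \<omega> / c) *\<^sub>R iexp (a * U \<omega>))"
    unfolding D_def using W c by (subst integral_density) auto
   also have "\<dots> = (CLINT \<omega>|M. (iexp (a * U \<omega>) * of_real (W \<omega>)) / of_real c)"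
    by (intro Bochner_Integration.integral_cong) (auto simp: scaleR_conv_of_real)
   also have "\<dots> = of_real (c * exp (- (a\<^sup>2) / 2)) / of_real c"
    by (simp only: integral_divide_zero char)
   also have "\<dots> = char std_normal_distribution a"
    using c by (simp add: char_std_normal_distribution)
   finally show "char (distr D borel U) a = char std_normal_distribution a" .
  qed
 qed
 then have "measure std_normal_distribution A = measure (distr D borel U) A" by simp
 also have "\<dots> = (LINT x|distr D borel U. indicator A x)"
  by simp
 also have "\<dots> = (LINT \<omega>|D. indicator A (U \<omega>))"
  by (subst integral_distr) auto
 also have "\<dots> = (LINT \<omega>|M. (W \<omega> / c) *\<^sub>R indicator A (U \<omega>))"
  unfolding D_def using W c by (subst integral_density) auto
 also have "\<dots> = (LINT \<omega>|M. (indicator A (U \<omega>) * W \<omega>) / c)"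
  by (intro Bochner_Integration.integral_cong) auto
 also have "\<dots> = (LINT \<omega>|M. indicator A (U \<omega>) * W \<omega>) / c"
  by (rule integral_divide_zero)
 finally show ?thesis using c by simp
qed

lemma iexp_times_cos:
 "iexp s * complex_of_real (1 + cos (b * v)) = iexp (s + 0 * v) + (iexp (s + b * v) + iexp (s + - b * v)) / 2"
 unfolding cis_conv_exp[symmetric] by (simp add: complex_eq_iff cos_diff sin_diff cos_add sin_add algebra_simps)

lemma iexp_times_sin:
 "iexp s * complex_of_real (1 + sin (b * v)) = iexp (s + 0 * v) + (- \<i> / 2) * (iexp (s + b * v) - iexp (s + - b * v))"
 unfolding cis_conv_exp[symmetric] by (simp add: complex_eq_iff cos_diff sin_diff cos_add sin_add field_simps)

text \<open>Two applications of the one-dimensional uniqueness theorem replace a uniqueness theorem for pairs.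
 The weights \<open>1 + cos (b V)\<close> and \<open>1 + sin (b V)\<close> give the expectation of
 \<open>indicator A (U) * exp (\<i> b V)\<close> as the standard normal mass of \<open>A\<close> times \<open>exp (- b\<^sup>2 / 2)\<close>; with the
 weight \<open>indicator A (U)\<close> this identifies the law of \<open>V\<close> on the event \<open>U \<in> A\<close>.\<close>

lemma (in prob_space) std_normal_pair_law:
 fixes U V :: "'a \<Rightarrow> real"
 assumes [measurable]: "U \<in> borel_measurable M" "V \<in> borel_measurable M"
  and char: "\<And>a b. (CLINT \<omega>|M. iexp (a * U \<omega> + b * V \<omega>)) = of_real (exp (- (a\<^sup>2 + b\<^sup>2) / 2))"
 shows "distr M (borel \<Otimes>\<^sub>M borel) (\<lambda>\<omega>. (U \<omega>, V \<omega>)) = std_normal_distribution \<Otimes>\<^sub>M std_normal_distribution"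
proof -
 let ?N = std_normal_distribution
 interpret N: prob_space ?N by (rule prob_space_std_normal)
 have intexp: "integrable M (\<lambda>\<omega>. iexp (f \<omega>))" if [measurable]: "f \<in> borel_measurable M" for f :: "'a \<Rightarrow> real"
  by (intro integrable_const_bound[where B=1]) auto
 have ie: "integrable M (\<lambda>\<omega>. iexp (a * U \<omega> + b * V \<omega>))" for a b
  by (rule intexp) measurable
 \<comment> \<open>The characteristic functions of \<open>U\<close> under the weights \<open>1 + cos (b V)\<close> and \<open>1 + sin (b V)\<close>: adding 1 keeps the weights nonnegative.\<close>
 have cosW: "(LINT \<omega>|M. indicator A (U \<omega>) * (1 + cos (b * V \<omega>))) = (1 + exp (- (b\<^sup>2) / 2)) * measure ?N A"
  if [measurable]: "A \<in> sets borel" for A b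
 proof (rule weighted_law_std_normal[where B=2])
  fix a
  have "(CLINT \<omega>|M. iexp (a * U \<omega>) * of_real (1 + cos (b * V \<omega>))) =
   (CLINT \<omega>|M. iexp (a * U \<omega> + 0 * V \<omega>) + (iexp (a * U \<omega> + b * V \<omega>) + iexp (a * U \<omega> + (-b) * V \<omega>)) / 2)"
   by (intro Bochner_Integration.integral_cong refl)
    (rule iexp_times_cos)
  also have "\<dots> = of_real (exp (- (a\<^sup>2 + 0\<^sup>2) / 2)) + (of_real (exp (- (a\<^sup>2 + b\<^sup>2) / 2)) + of_real (exp (- (a\<^sup>2 + (-b)\<^sup>2) / 2))) / 2"
   by (simp only: integral_divide_zero char
    Bochner_Integration.integral_add[OF ie Bochner_Integration.integrable_divide[OF Bochner_Integration.integrable_add[OF ie ie]]]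
    Bochner_Integration.integral_add[OF ie ie])
  also have "\<dots> = of_real ((1 + exp (- (b\<^sup>2) / 2)) * exp (- (a\<^sup>2) / 2))"
  proof -
   have "exp (- (a\<^sup>2 + b\<^sup>2) / 2) = exp (- (b\<^sup>2) / 2) * exp (- (a\<^sup>2) / 2)"
    by (simp add: add_divide_distrib flip: exp_add)
   then show ?thesis by (simp add: distrib_right)
  qed
  finally show "(CLINT \<omega>|M. iexp (a * U \<omega>) * of_real (1 + cos (b * V \<omega>))) = of_real ((1 + exp (- (b\<^sup>2) / 2)) * exp (- (a\<^sup>2) / 2))" .
 next
  show "0 \<le> 1 + cos (b * V \<omega>)" "1 + cos (b * V \<omega>) \<le> 2" for \<omega>
   using cos_ge_minus_one[of "b * V \<omega>"] cos_le_one[of "b * V \<omega>"] by linarith+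
 qed (auto intro: add_pos_pos)
 have sinW: "(LINT \<omega>|M. indicator A (U \<omega>) * (1 + sin (b * V \<omega>))) = 1 * measure ?N A"
  if [measurable]: "A \<in> sets borel" for A b
 proof (rule weighted_law_std_normal[where B=2])
  fix a
  have "(CLINT \<omega>|M. iexp (a * U \<omega>) * of_real (1 + sin (b * V \<omega>))) =
   (CLINT \<omega>|M. iexp (a * U \<omega> + 0 * V \<omega>) + (- \<i> / 2) * (iexp (a * U \<omega> + b * V \<omega>) - iexp (a * U \<omega> + (-b) * V \<omega>)))"
   by (intro Bochner_Integration.integral_cong refl)
    (rule iexp_times_sin)
  also have "\<dots> = of_real (exp (- (a\<^sup>2 + 0\<^sup>2) / 2)) + (- \<i> / 2) * (of_real (exp (- (a\<^sup>2 + b\<^sup>2) / 2)) - of_real (exp (- (a\<^sup>2 + (-b)\<^sup>2) / 2)))"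
   by (simp only: integral_mult_right_zero char
    Bochner_Integration.integral_add[OF ie Bochner_Integration.integrable_mult_right[OF Bochner_Integration.integrable_diff[OF ie ie]]]
    Bochner_Integration.integral_diff[OF ie ie])
  also have "\<dots> = of_real (1 * exp (- (a\<^sup>2) / 2))"
   by simp
  finally show "(CLINT \<omega>|M. iexp (a * U \<omega>) * of_real (1 + sin (b * V \<omega>))) = of_real (1 * exp (- (a\<^sup>2) / 2))" .
 next
  show "0 \<le> 1 + sin (b * V \<omega>)" "1 + sin (b * V \<omega>) \<le> 2" for \<omega>
   using sin_ge_minus_one[of "b * V \<omega>"] sin_le_one[of "b * V \<omega>"] by linarith+
 qed auto
 have intA: "integrable M (\<lambda>\<omega>. indicator A (U \<omega>) * f \<omega>)"
  if [measurable]: "A \<in> sets borel" "f \<in> borel_measurable M" and "\<And>\<omega>. \<bar>f \<omega>\<bar> \<le> 1" for A and f :: "'a \<Rightarrow> real"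
  using that by (intro integrable_const_bound[where B=1]) (auto simp: abs_mult split: split_indicator)
 have massA: "(LINT \<omega>|M. indicator A (U \<omega>)) = measure ?N A" if [measurable]: "A \<in> sets borel" for A
  using sinW[of A 0] by simp
 have cosA: "(LINT \<omega>|M. indicator A (U \<omega>) * cos (b * V \<omega>)) = exp (- (b\<^sup>2) / 2) * measure ?N A"
  if A[measurable]: "A \<in> sets borel" for A b
  using cosW[OF A, of b] intA[OF A, of "\<lambda>_. 1"] intA[OF A, of "\<lambda>\<omega>. cos (b * V \<omega>)"] massA[OF A]
  by (simp add: distrib_left distrib_right)
 have sinA: "(LINT \<omega>|M. indicator A (U \<omega>) * sin (b * V \<omega>)) = 0"
  if A[measurable]: "A \<in> sets borel" for A b
  using sinW[OF A, of b] intA[OF A, of "\<lambda>_. 1"] intA[OF A, of "\<lambda>\<omega>. sin (b * V \<omega>)"] massA[OF A]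
  by (simp add: distrib_left distrib_right)
 have rect: "measure M {\<omega>\<in>space M. U \<omega> \<in> A \<and> V \<omega> \<in> B} = measure ?N A * measure ?N B"
  if A[measurable]: "A \<in> sets borel" and B[measurable]: "B \<in> sets borel" for A B
 proof -
  have ev: "(LINT \<omega>|M. indicator B (V \<omega>) * indicator A (U \<omega>)) = measure M {\<omega>\<in>space M. U \<omega> \<in> A \<and> V \<omega> \<in> B}"
  proof -
   have "(LINT \<omega>|M. indicator B (V \<omega>) * indicator A (U \<omega>)) =
    (LINT \<omega>|M. indicat_real {\<omega>\<in>space M. U \<omega> \<in> A \<and> V \<omega> \<in> B} \<omega>)"
    by (intro Bochner_Integration.integral_cong) (auto split: split_indicator)
   then show ?thesis by simp
  qed
  show ?thesis
  proof (cases "measure ?N A = 0")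
   case True
   have "measure M {\<omega>\<in>space M. U \<omega> \<in> A \<and> V \<omega> \<in> B} \<le> measure M {\<omega>\<in>space M. U \<omega> \<in> A}"
    by (intro finite_measure_mono) auto
   also have "\<dots> = (LINT \<omega>|M. indicat_real {\<omega>\<in>space M. U \<omega> \<in> A} \<omega>)" by simp
   also have "\<dots> = (LINT \<omega>|M. indicator A (U \<omega>))"
    by (intro Bochner_Integration.integral_cong) (auto split: split_indicator)
   also have "\<dots> = 0" using massA[OF A] True by simp
   finally show ?thesis using True by (simp add: measure_le_0_iff)
  next
   case False
   then have pos: "measure ?N A > 0" by (simp add: zero_less_measure_iff)
   have "(LINT \<omega>|M. indicator B (V \<omega>) * indicator A (U \<omega>)) = measure ?N A * measure ?N B"
   proof (rule weighted_law_std_normal[where B=1])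
    fix b
    have "(CLINT \<omega>|M. iexp (b * V \<omega>) * of_real (indicator A (U \<omega>))) =
     (CLINT \<omega>|M. of_real (indicator A (U \<omega>) * cos (b * V \<omega>)) + \<i> * of_real (indicator A (U \<omega>) * sin (b * V \<omega>)))"
     by (intro Bochner_Integration.integral_cong refl) (simp add: Re_exp Im_exp complex_eq_iff split: split_indicator)
    also have "\<dots> = of_real (exp (- (b\<^sup>2) / 2) * measure ?N A) + \<i> * of_real 0"
     by (subst Bochner_Integration.integral_add)
      (auto simp only: integral_mult_right_zero integral_complex_of_real cosA[OF A] sinA[OF A]
       intro!: integrable_of_real integrable_mult_right intA A, auto)
    finally show "(CLINT \<omega>|M. iexp (b * V \<omega>) * of_real (indicator A (U \<omega>))) = of_real (measure ?N A * exp (- (b\<^sup>2) / 2))"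
     by (simp add: mult.commute)
   qed (use pos in auto)
   then show ?thesis using ev by simp
  qed
 qed
 show ?thesis
 proof (rule sym, rule pair_measure_eqI)
  show "sigma_finite_measure ?N" by (rule N.sigma_finite_measure_axioms)
  show "sigma_finite_measure ?N" by (rule N.sigma_finite_measure_axioms)
  show "sets (?N \<Otimes>\<^sub>M ?N) = sets (distr M (borel \<Otimes>\<^sub>M borel) (\<lambda>\<omega>. (U \<omega>, V \<omega>)))"
   by (simp cong: sets_pair_measure_cong)
  fix A B :: "real set" assume "A \<in> sets ?N" "B \<in> sets ?N"
  then have A[measurable]: "A \<in> sets borel" and B[measurable]: "B \<in> sets borel" by auto
  have "emeasure (distr M (borel \<Otimes>\<^sub>M borel) (\<lambda>\<omega>. (U \<omega>, V \<omega>))) (A \<times> B) =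
   emeasure M ((\<lambda>\<omega>. (U \<omega>, V \<omega>)) -` (A \<times> B) \<inter> space M)"
   by (rule emeasure_distr) auto
  also have "(\<lambda>\<omega>. (U \<omega>, V \<omega>)) -` (A \<times> B) \<inter> space M = {\<omega>\<in>space M. U \<omega> \<in> A \<and> V \<omega> \<in> B}"
   by auto
  also have "emeasure M \<dots> = ennreal (measure ?N A * measure ?N B)"
   by (simp add: emeasure_eq_measure rect)
  finally show "emeasure ?N A * emeasure ?N B = emeasure (distr M (borel \<Otimes>\<^sub>M borel) (\<lambda>\<omega>. (U \<omega>, V \<omega>))) (A \<times> B)"
   by (simp add: N.emeasure_eq_measure ennreal_mult)
 qed
qed

text \<open>A bound for the factor, relative to independence, by which a correlation of absolute value at most
 \<open>g\<close> increases the probability that two standard normal variables both lie in \<open>{t<..T}\<close>, where \<open>s = T\<^sup>2\<close>.\<close>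

definition box_factor :: "real \<Rightarrow> real \<Rightarrow> real" where
 "box_factor s g = exp (g / (1 + g) * s) / sqrt (1 - g\<^sup>2)"

lemma box_factor_ge_1:
 assumes "0 \<le> g" "g < 1" "0 \<le> s"
 shows "1 \<le> box_factor s g"
proof -
 have "g\<^sup>2 < 1" using assms by (simp add: power_less_one_iff)
 then have "0 < sqrt (1 - g\<^sup>2)" "sqrt (1 - g\<^sup>2) \<le> 1" by auto
 moreover have "1 \<le> exp (g / (1 + g) * s)" using assms by simp
 ultimately show ?thesis unfolding box_factor_def by (simp only: le_divide_eq_1_pos)
qed

lemma box_factor_mono:
 assumes "0 \<le> g" "g \<le> g'" "g' < 1" "0 \<le> s" "s \<le> s'"
 shows "box_factor s g \<le> box_factor s' g'"
proof -
 have sq: "g\<^sup>2 \<le> g'\<^sup>2" "g'\<^sup>2 < 1" using assms by (auto intro: power_mono simp: power_less_one_iff)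
 have "g / (1 + g) \<le> g' / (1 + g')" using assms by (simp add: field_simps)
 then have "g / (1 + g) * s \<le> g' / (1 + g') * s'" using assms by (intro mult_mono) auto
 then show ?thesis unfolding box_factor_def using sq by (intro frac_le) auto
qed

text \<open>On the left is the density of one variable given the value \<open>u\<close> of the other. Its quotient by the
 standard density is \<open>exp ((2 \<gamma> u w - \<gamma>\<^sup>2 (u\<^sup>2 + w\<^sup>2)) / (2 (1 - \<gamma>\<^sup>2))) / sqrt (1 - \<gamma>\<^sup>2)\<close>, and
 \<open>2 u w \<le> u\<^sup>2 + w\<^sup>2\<close> reduces the exponent to at most \<open>\<gamma> u w / (1 + \<gamma>)\<close> if \<open>\<gamma> \<ge> 0\<close>.\<close>

lemma normal_density_shift_le:
 fixes \<gamma> g :: real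
 assumes g: "\<bar>\<gamma>\<bar> \<le> g" "g < 1" and uw: "0 \<le> u" "u \<le> T" "0 \<le> w" "w \<le> T"
 shows "normal_density (\<gamma> * u) (sqrt (1 - \<gamma>\<^sup>2)) w
  \<le> box_factor (T\<^sup>2) g * std_normal_density w"
proof -
 have g0: "0 \<le> g" using g by linarith
 have g2: "\<gamma>\<^sup>2 \<le> g\<^sup>2" using g g0 by (metis abs_le_square_iff abs_of_nonneg)
 have g21: "g\<^sup>2 < 1" using g g0 by (simp add: power_less_one_iff abs_square_less_1)
 have pos: "1 - \<gamma>\<^sup>2 > 0" using g2 g21 by linarith
 have key: "- (w - \<gamma> * u)\<^sup>2 / (2 * (1 - \<gamma>\<^sup>2)) \<le> g / (1 + g) * T\<^sup>2 - w\<^sup>2 / 2"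
 proof -
  have id: "- (w - \<gamma> * u)\<^sup>2 / (2 * (1 - \<gamma>\<^sup>2)) + w\<^sup>2 / 2 = (2 * \<gamma> * (u * w) - \<gamma>\<^sup>2 * (u\<^sup>2 + w\<^sup>2)) / (2 * (1 - \<gamma>\<^sup>2))"
   using pos by (simp add: field_simps power2_eq_square)
  have uw2: "2 * (u * w) \<le> u\<^sup>2 + w\<^sup>2" using sum_squares_bound[of u w] by simp
  have uwT: "u * w \<le> T\<^sup>2" using uw by (simp add: power2_eq_square mult_mono)
  have gT: "0 \<le> g / (1 + g) * T\<^sup>2" using g0 by simp
  have "(2 * \<gamma> * (u * w) - \<gamma>\<^sup>2 * (u\<^sup>2 + w\<^sup>2)) / (2 * (1 - \<gamma>\<^sup>2)) \<le> g / (1 + g) * T\<^sup>2"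
  proof (cases "\<gamma> \<ge> 0")
   case True
   have "2 * \<gamma> * (u * w) - \<gamma>\<^sup>2 * (u\<^sup>2 + w\<^sup>2) \<le> 2 * \<gamma> * (u * w) - \<gamma>\<^sup>2 * (2 * (u * w))"
    using uw2 by (intro diff_left_mono mult_left_mono) auto
   also have "\<dots> = \<gamma> / (1 + \<gamma>) * (u * w) * (2 * (1 - \<gamma>\<^sup>2))"
    using True by (simp add: field_simps power2_eq_square)
   finally have "(2 * \<gamma> * (u * w) - \<gamma>\<^sup>2 * (u\<^sup>2 + w\<^sup>2)) / (2 * (1 - \<gamma>\<^sup>2)) \<le> \<gamma> / (1 + \<gamma>) * (u * w)"
    using pos by (simp add: divide_le_eq)
   also have "\<dots> \<le> g / (1 + g) * T\<^sup>2"
   proof (rule mult_mono)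
    show "\<gamma> / (1 + \<gamma>) \<le> g / (1 + g)" using True g by (simp add: field_simps)
   qed (use uwT uw g0 in auto)
   finally show ?thesis .
  next
   case False
   have "2 * \<gamma> * (u * w) \<le> 0" by (rule mult_nonpos_nonneg) (use False uw in auto)
   moreover have "0 \<le> \<gamma>\<^sup>2 * (u\<^sup>2 + w\<^sup>2)" by simp
   ultimately have "2 * \<gamma> * (u * w) - \<gamma>\<^sup>2 * (u\<^sup>2 + w\<^sup>2) \<le> 0" by linarith
   then have "(2 * \<gamma> * (u * w) - \<gamma>\<^sup>2 * (u\<^sup>2 + w\<^sup>2)) / (2 * (1 - \<gamma>\<^sup>2)) \<le> 0"
    using pos by (intro divide_nonpos_pos) auto
   then show ?thesis using gT by linarith
  qed
  then show ?thesis using id by linarith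
 qed
 have "normal_density (\<gamma> * u) (sqrt (1 - \<gamma>\<^sup>2)) w = 1 / sqrt (2 * pi * (1 - \<gamma>\<^sup>2)) * exp (- (w - \<gamma> * u)\<^sup>2 / (2 * (1 - \<gamma>\<^sup>2)))"
  using pos by (simp add: normal_density_def)
 also have "\<dots> \<le> 1 / sqrt (2 * pi * (1 - g\<^sup>2)) * exp (g / (1 + g) * T\<^sup>2 - w\<^sup>2 / 2)"
  using key g2 g21 pos by (intro mult_mono divide_left_mono) (auto simp: mult_pos_pos)
 also have "\<dots> = exp (g / (1 + g) * T\<^sup>2) / sqrt (1 - g\<^sup>2) * std_normal_density w"
 proof -
  have "exp (g / (1 + g) * T\<^sup>2 - w\<^sup>2 / 2) = exp (g / (1 + g) * T\<^sup>2) * exp (- w\<^sup>2 / 2)"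
   by (simp flip: exp_add)
  then show ?thesis by (simp only: std_normal_density_def real_sqrt_mult[of "2 * pi"]) simp
 qed
 finally show ?thesis by (simp only: box_factor_def)
qed

text \<open>On a bounded box the quotient of the joint density by the product density is bounded pointwise, so the bound
 approaches the independent case as the correlation vanishes. Estimating the sum of the two variables instead would
 lose a factor of order \<open>t\<close>, too much for the second-moment argument.\<close>

lemma (in prob_space) bivariate_normal_box_le:
 fixes U Y :: "'a \<Rightarrow> real"
 assumes [measurable]: "U \<in> borel_measurable M" "Y \<in> borel_measurable M"
  and char: "\<And>a b. (CLINT \<omega>|M. iexp (a * U \<omega> + b * Y \<omega>)) = of_real (exp (- (a\<^sup>2 + 2 * \<gamma> * a * b + b\<^sup>2) / 2))"
  and g: "\<bar>\<gamma>\<bar> \<le> g" "g < 1" and t: "0 \<le> t"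
 shows "measure M {\<omega>\<in>space M. U \<omega> \<in> {t<..T} \<and> Y \<omega> \<in> {t<..T}}
  \<le> (measure std_normal_distribution {t<..T})\<^sup>2 * box_factor (T\<^sup>2) g"
proof -
 let ?N = std_normal_distribution
 interpret N: prob_space ?N by (rule prob_space_std_normal)
 define s where "s = sqrt (1 - \<gamma>\<^sup>2)"
 have g0: "0 \<le> g" using g by linarith
 have g2: "\<gamma>\<^sup>2 \<le> g\<^sup>2" using g g0 by (metis abs_le_square_iff abs_of_nonneg)
 have g21: "g\<^sup>2 < 1" using g g0 by (simp add: power_less_one_iff abs_square_less_1)
 have s0: "s > 0" and s2: "s\<^sup>2 = 1 - \<gamma>\<^sup>2" unfolding s_def using g2 g21 by auto
 define Q where "Q = box_factor (T\<^sup>2) g"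
 have Q0: "Q \<ge> 0" unfolding Q_def box_factor_def using g21 by simp
 define I where "I = {t<..T}"
 have I[measurable]: "I \<in> sets borel" by (simp add: I_def)
 define V where "V \<omega> = (Y \<omega> - \<gamma> * U \<omega>) / s" for \<omega>
 have V[measurable]: "V \<in> borel_measurable M" unfolding V_def by measurable
 have Y: "Y \<omega> = \<gamma> * U \<omega> + s * V \<omega>" for \<omega> using s0 by (simp add: V_def)
 have alg: "(a - \<gamma> * c)\<^sup>2 + 2 * \<gamma> * (a - \<gamma> * c) * c + c\<^sup>2 = a\<^sup>2 + c\<^sup>2 * (1 - \<gamma>\<^sup>2)" for a c
  by (simp add: power2_eq_square algebra_simps)
 have law: "distr M (borel \<Otimes>\<^sub>M borel) (\<lambda>\<omega>. (U \<omega>, V \<omega>)) = ?N \<Otimes>\<^sub>M ?N"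
 proof (rule std_normal_pair_law)
  fix a b
  have "(CLINT \<omega>|M. iexp (a * U \<omega> + b * V \<omega>)) = (CLINT \<omega>|M. iexp ((a - \<gamma> * (b / s)) * U \<omega> + (b / s) * Y \<omega>))"
   by (intro Bochner_Integration.integral_cong refl arg_cong[where f=iexp]) (simp add: V_def algebra_simps diff_divide_distrib)
  also have "\<dots> = of_real (exp (- ((a - \<gamma> * (b / s))\<^sup>2 + 2 * \<gamma> * (a - \<gamma> * (b / s)) * (b / s) + (b / s)\<^sup>2) / 2))"
   by (rule char)
  also have "(a - \<gamma> * (b / s))\<^sup>2 + 2 * \<gamma> * (a - \<gamma> * (b / s)) * (b / s) + (b / s)\<^sup>2 = a\<^sup>2 + (b / s)\<^sup>2 * (1 - \<gamma>\<^sup>2)"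
   using alg[of a "b / s"] by simp
  also have "(b / s)\<^sup>2 * (1 - \<gamma>\<^sup>2) = b\<^sup>2" using s0 s2 by (simp add: power_divide flip: s2)
  finally show "(CLINT \<omega>|M. iexp (a * U \<omega> + b * V \<omega>)) = of_real (exp (- (a\<^sup>2 + b\<^sup>2) / 2))" .
 qed measurable
 define S where "S = {(u, v). u \<in> I \<and> \<gamma> * u + s * v \<in> I}"
 have S: "S \<in> sets (borel \<Otimes>\<^sub>M borel)"
 proof -
  have "{x \<in> space (borel \<Otimes>\<^sub>M borel). fst x \<in> I \<and> \<gamma> * fst x + s * snd x \<in> I} \<in> sets (borel \<Otimes>\<^sub>M borel :: (real \<times> real) measure)"
   by measurable
  then show ?thesis by (simp add: S_def case_prod_unfold space_pair_measure)
 qed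
 have slice: "emeasure ?N {v. \<gamma> * u + s * v \<in> I} \<le> ennreal Q * emeasure ?N I" if u: "u \<in> I" for u
 proof -
  have d0: "distributed ?N lborel (\<lambda>v. v) std_normal_density"
   by (auto simp: distributed_def distr_id2)
  have d: "distributed ?N lborel (\<lambda>v. \<gamma> * u + s * v) (normal_density (\<gamma> * u + s * 0) (\<bar>s\<bar> * 1))"
   by (rule N.normal_density_affine[OF d0]) (use s0 in auto)
  have "emeasure ?N {v. \<gamma> * u + s * v \<in> I} = emeasure ?N ((\<lambda>v. \<gamma> * u + s * v) -` I \<inter> space ?N)"
   by (intro arg_cong2[where f=emeasure]) auto
  also have "\<dots> = (\<integral>\<^sup>+w. ennreal (normal_density (\<gamma> * u) s w) * indicator I w \<partial>lborel)"
   using distributed_emeasure[OF d, of I] s0 by simp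
  also have "\<dots> \<le> (\<integral>\<^sup>+w. ennreal Q * (ennreal (std_normal_density w) * indicator I w) \<partial>lborel)"
  proof (rule nn_integral_mono)
   fix w
   show "ennreal (normal_density (\<gamma> * u) s w) * indicator I w \<le> ennreal Q * (ennreal (std_normal_density w) * indicator I w)"
   proof (cases "w \<in> I")
    case True
    have "normal_density (\<gamma> * u) s w \<le> Q * std_normal_density w"
     unfolding s_def Q_def using True u t by (intro normal_density_shift_le g) (auto simp: I_def)
    then show ?thesis using True Q0 by (simp add: ennreal_mult'[symmetric])
   qed auto
  qed
  also have "\<dots> = ennreal Q * emeasure ?N I"
   by (subst nn_integral_cmult) (auto simp: emeasure_density)
  finally show ?thesis .
 qed
 have "emeasure M {\<omega>\<in>space M. U \<omega> \<in> I \<and> Y \<omega> \<in> I} = emeasure M ((\<lambda>\<omega>. (U \<omega>, V \<omega>)) -` S \<inter> space M)"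
  by (intro arg_cong2[where f=emeasure]) (auto simp: S_def Y)
 also have "\<dots> = emeasure (distr M (borel \<Otimes>\<^sub>M borel) (\<lambda>\<omega>. (U \<omega>, V \<omega>))) S"
  using S by (intro emeasure_distr[symmetric]) auto
 also have "\<dots> = (\<integral>\<^sup>+u. emeasure ?N (Pair u -` S) \<partial>?N)"
  unfolding law using S by (intro N.emeasure_pair_measure_alt) (simp cong: sets_pair_measure_cong)
 also have "\<dots> \<le> (\<integral>\<^sup>+u. ennreal Q * emeasure ?N I * indicator I u \<partial>?N)"
 proof (rule nn_integral_mono)
  fix u
  show "emeasure ?N (Pair u -` S) \<le> ennreal Q * emeasure ?N I * indicator I u"
   using slice[of u] by (cases "u \<in> I") (auto simp: S_def vimage_def)
 qed
 also have "\<dots> = ennreal Q * emeasure ?N I * emeasure ?N I"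
  by (subst nn_integral_cmult_indicator) auto
 also have "\<dots> = ennreal ((measure ?N I)\<^sup>2 * Q)"
  using Q0 by (simp add: N.emeasure_eq_measure ennreal_mult'[symmetric] power2_eq_square mult_ac)
 finally show ?thesis
  unfolding I_def Q_def[symmetric] using Q0 by (simp add: emeasure_eq_measure)
qed

section \<open>Normal tails and bounds for unions and counts of events\<close>

lemma std_normal_upper_tail_le:
 assumes "x > 0"
 shows "measure std_normal_distribution {x<..} \<le> exp (- (x\<^sup>2) / 2) / x"
proof -
 interpret N: prob_space std_normal_distribution by (rule prob_space_std_normal)
 have "emeasure std_normal_distribution {x<..} = (\<integral>\<^sup>+s. ennreal (std_normal_density s) * indicator {x<..} s \<partial>lborel)"
  by (simp add: emeasure_density)
 also have "\<dots> \<le> (\<integral>\<^sup>+s. ennreal (s * exp (- (s\<^sup>2) / 2) / x) * indicator {x..} s \<partial>lborel)"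
 proof (rule nn_integral_mono)
  fix s
  show "ennreal (std_normal_density s) * indicator {x<..} s \<le> ennreal (s * exp (- (s\<^sup>2) / 2) / x) * indicator {x..} s"
  proof (cases "x < s")
   case True
   have "sqrt (2 * pi) \<ge> 1" using pi_ge_two by simp
   then have "std_normal_density s \<le> 1 * exp (- (s\<^sup>2) / 2)"
    unfolding std_normal_density_def by (intro mult_right_mono) auto
   also have "\<dots> \<le> s / x * exp (- (s\<^sup>2) / 2)"
    using True assms by (intro mult_right_mono) auto
   finally show ?thesis using True by (simp add: ennreal_leI)
  qed simp
 qed
 also have "\<dots> = ennreal (0 - (- exp (- (x\<^sup>2) / 2) / x))"
 proof (rule nn_integral_FTC_atLeast[where F="\<lambda>a. - exp (- (a\<^sup>2) / 2) / x"])
  show "((\<lambda>a. - exp (- (a\<^sup>2) / 2) / x) \<longlongrightarrow> 0) at_top"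
   using assms by real_asymp
  show "DERIV (\<lambda>a. - exp (- (a\<^sup>2) / 2) / x) s :> s * exp (- (s\<^sup>2) / 2) / x" if "x \<le> s" for s
   using assms by (auto intro!: derivative_eq_intros)
 qed (use assms in auto)
 finally show ?thesis using assms by (simp add: N.emeasure_eq_measure)
qed

text \<open>The subinterval of length \<open>1 / t\<close> at the left end carries enough mass: the density falls only by a
 constant factor along it.\<close>

lemma std_normal_interval_ge:
 assumes "1 \<le> t"
 shows "measure std_normal_distribution {t<..t + 1} \<ge> exp (- (t\<^sup>2) / 2) * exp (- 3 / 2) / (sqrt (2 * pi) * t)"
proof -
 interpret N: prob_space std_normal_distribution by (rule prob_space_std_normal)
 define c where "c = exp (- (t\<^sup>2) / 2) * exp (- 3 / 2) / sqrt (2 * pi)"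
 have c: "c \<ge> 0" by (simp add: c_def)
 have "ennreal (c * (1 / t)) = (\<integral>\<^sup>+s. ennreal c * indicator {t<..t + 1 / t} s \<partial>lborel)"
  using assms c by (subst nn_integral_cmult_indicator) (auto simp: ennreal_mult'[symmetric])
 also have "\<dots> \<le> (\<integral>\<^sup>+s. ennreal (std_normal_density s) * indicator {t<..t + 1} s \<partial>lborel)"
 proof (rule nn_integral_mono)
  fix s
  have t1: "1 / t \<le> 1" using assms by simp
  show "ennreal c * indicator {t<..t + 1 / t} s \<le> ennreal (std_normal_density s) * indicator {t<..t + 1} s"
  proof (cases "s \<in> {t<..t + 1 / t}")
   case True
   have "s\<^sup>2 \<le> (t + 1 / t)\<^sup>2" using True assms by (intro power_mono) auto
   also have "\<dots> = t\<^sup>2 + 2 + (1 / t)\<^sup>2" using assms by (simp add: power2_eq_square field_simps)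
   also have "\<dots> \<le> t\<^sup>2 + 2 + 1" using t1 assms by (intro add_left_mono) (simp add: power_le_one)
   finally have "- (t\<^sup>2) / 2 + (- 3 / 2) \<le> - (s\<^sup>2) / 2" by simp
   then have "exp (- (t\<^sup>2) / 2) * exp (- 3 / 2) \<le> exp (- (s\<^sup>2) / 2)"
    by (simp only: exp_add[symmetric] exp_le_cancel_iff)
   then have "c \<le> std_normal_density s"
    unfolding c_def std_normal_density_def by (simp add: divide_right_mono)
   then show ?thesis using True t1 by (auto simp: ennreal_leI)
  qed simp
 qed
 also have "\<dots> = emeasure std_normal_distribution {t<..t + 1}"
  by (simp add: emeasure_density)
 finally have "c * (1 / t) \<le> measure std_normal_distribution {t<..t + 1}"
  by (simp add: N.emeasure_eq_measure)
 then show ?thesis by (simp add: c_def)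
qed

lemma isCont_Phi: "isCont Phi x"
proof -
 interpret real_distribution std_normal_distribution by (rule real_dist_normal_dist)
 have "isCont (cdf std_normal_distribution) x"
  by (subst isCont_cdf) (simp add: measure_def emeasure_density nn_integral_0_iff_AE)
 then show ?thesis by (simp add: Phi_def[abs_def])
qed

lemma (in prob_space) prob_union_geometric:
 fixes A :: "nat \<Rightarrow> 'a set"
 assumes A: "\<And>i. A i \<in> events" and le: "\<And>i. prob (A i) \<le> C * exp (- x * real i)"
  and x: "x > 0" and C: "C \<ge> 0"
 shows "prob (\<Union>i. A i) \<le> C * (1 + 1 / x)"
proof -
 have geo: "(\<lambda>i. C * exp (- x * real i)) sums (C * (1 / (1 - exp (- x))))"
 proof -
  have "(\<lambda>i. exp (- x) ^ i) sums (1 / (1 - exp (- x)))"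
   using x by (intro geometric_sums) simp
  then have "(\<lambda>i. C * exp (- x) ^ i) sums (C * (1 / (1 - exp (- x))))"
   by (rule sums_mult)
  then show ?thesis by (simp add: exp_of_nat_mult[symmetric] mult.commute)
 qed
 have sum: "summable (\<lambda>i. prob (A i))"
  using le by (intro summable_comparison_test'[OF sums_summable[OF geo]]) auto
 have "prob (\<Union>i. A i) \<le> (\<Sum>i. prob (A i))"
  using A by (intro finite_measure_subadditive_countably sum) auto
 also have "\<dots> \<le> (\<Sum>i. C * exp (- x * real i))"
  by (intro suminf_le le sum sums_summable[OF geo])
 also have "\<dots> = C * (1 / (1 - exp (- x)))" by (rule sums_unique[OF geo, symmetric])
 also have "\<dots> \<le> C * (1 + 1 / x)"
 proof (rule mult_left_mono[OF _ C])
  have "1 + x \<le> exp x" by (rule exp_ge_add_one_self)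
  then have "exp (- x) \<le> 1 / (1 + x)" using x by (simp add: exp_minus inverse_eq_divide divide_left_mono)
  then have "x / (1 + x) \<le> 1 - exp (- x)" using x by (simp add: field_simps)
  then have "1 / (1 - exp (- x)) \<le> 1 / (x / (1 + x))"
   using x by (intro divide_left_mono) (auto intro!: mult_pos_pos)
  also have "\<dots> = 1 + 1 / x" using x by (simp add: field_simps)
  finally show "1 / (1 - exp (- x)) \<le> 1 + 1 / x" .
 qed
 finally show ?thesis .
qed

lemma (in prob_space) prob_two_sided_union_le:
 fixes B :: "int \<Rightarrow> 'a set"
 assumes B: "\<And>j. B j \<in> events"
  and le: "\<And>j i. \<bar>j\<bar> = p + int i \<Longrightarrow> prob (B j) \<le> C * exp (- x * real i)"
  and p: "p \<ge> 0" and x: "x > 0" and C: "C \<ge> 0"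
 shows "prob (\<Union>j\<in>{j. p \<le> \<bar>j\<bar>}. B j) \<le> 2 * C * (1 + 1 / x)"
proof -
 define A where "A i = B (p + int i) \<union> B (- (p + int i))" for i
 have "(\<Union>j\<in>{j. p \<le> \<bar>j\<bar>}. B j) \<subseteq> (\<Union>i. A i)"
 proof
  fix \<omega> assume "\<omega> \<in> (\<Union>j\<in>{j. p \<le> \<bar>j\<bar>}. B j)"
  then obtain j where j: "p \<le> \<bar>j\<bar>" "\<omega> \<in> B j" by blast
  then have "j = p + int (nat (\<bar>j\<bar> - p)) \<or> j = - (p + int (nat (\<bar>j\<bar> - p)))" by linarith
  then have "\<omega> \<in> A (nat (\<bar>j\<bar> - p))" unfolding A_def using j(2) by (metis UnI1 UnI2)
  then show "\<omega> \<in> (\<Union>i. A i)" by blast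
 qed
 then have "prob (\<Union>j\<in>{j. p \<le> \<bar>j\<bar>}. B j) \<le> prob (\<Union>i. A i)"
  using B by (intro finite_measure_mono) (auto simp: A_def)
 also have "\<dots> \<le> (2 * C) * (1 + 1 / x)"
 proof (rule prob_union_geometric)
  fix i
  have "prob (A i) \<le> prob (B (p + int i)) + prob (B (- (p + int i)))"
   unfolding A_def by (intro measure_Un_le B)
  also have "\<dots> \<le> C * exp (- x * real i) + C * exp (- x * real i)"
   using p by (intro add_mono le) auto
  finally show "prob (A i) \<le> 2 * C * exp (- x * real i)" by simp
  show "A i \<in> events" using B by (simp add: A_def)
 qed (use x C in auto)
 finally show ?thesis .
qed

text \<open>Chebyshev's inequality for the number of events that occur. The second summand is the average
 dependence of pairs; it must vanish together with the inverse of the expected number.\<close>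

lemma (in prob_space) prob_no_event_le:
 fixes A :: "'i \<Rightarrow> 'a set"
 assumes J: "finite J" "J \<noteq> {}" and A: "\<And>j. j \<in> J \<Longrightarrow> A j \<in> events"
  and P: "P > 0" "\<And>j. j \<in> J \<Longrightarrow> prob (A j) = P"
  and q: "\<And>i j. i \<in> J \<Longrightarrow> j \<in> J \<Longrightarrow> i \<noteq> j \<Longrightarrow> prob (A i \<inter> A j) \<le> P\<^sup>2 * q i j"
 shows "prob {\<omega>\<in>space M. \<forall>j\<in>J. \<omega> \<notin> A j} \<le>
  1 / (real (card J) * P) + (\<Sum>i\<in>J. \<Sum>j\<in>J - {i}. q i j - 1) / (real (card J))\<^sup>2"
proof -
 define n where "n = real (card J)"
 have n: "n \<ge> 1" using J by (simp add: n_def Suc_leI card_gt_0_iff)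
 define N where "N \<omega> = (\<Sum>j\<in>J. indicat_real (A j) \<omega>)" for \<omega>
 have N_meas: "N \<in> borel_measurable M" unfolding N_def using A by measurable
 have int1: "integrable M (indicat_real (A j))" if "j \<in> J" for j
  using A[OF that] by (simp add: emeasure_eq_measure)
 have int2: "integrable M (\<lambda>\<omega>. indicat_real (A i) \<omega> * indicat_real (A j) \<omega>)" if "i \<in> J" "j \<in> J" for i j
  using A that by (simp add: indicator_inter_arith[symmetric] emeasure_eq_measure)
 have sq: "(N \<omega>)\<^sup>2 = (\<Sum>i\<in>J. \<Sum>j\<in>J. indicat_real (A i) \<omega> * indicat_real (A j) \<omega>)" for \<omega>
  by (simp add: N_def power2_eq_square sum_product)
 have Nsq_int: "integrable M (\<lambda>\<omega>. (N \<omega>)\<^sup>2)"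
  unfolding sq by (intro Bochner_Integration.integrable_sum int2)
 have EN: "expectation N = n * P"
  unfolding N_def using int1 A P by (subst Bochner_Integration.integral_sum) (auto simp: n_def)
 have "expectation (\<lambda>\<omega>. (N \<omega>)\<^sup>2) = (\<Sum>i\<in>J. \<Sum>j\<in>J. prob (A i \<inter> A j))"
  unfolding sq using int2 A
  by (subst Bochner_Integration.integral_sum, force intro!: Bochner_Integration.integrable_sum)
   (intro sum.cong refl, subst Bochner_Integration.integral_sum, auto simp: indicator_inter_arith[symmetric])
 also have "\<dots> \<le> (\<Sum>i\<in>J. P + P\<^sup>2 * (\<Sum>j\<in>J - {i}. q i j))"
 proof (rule sum_mono)
  fix i assume i: "i \<in> J"
  have "(\<Sum>j\<in>J. prob (A i \<inter> A j)) = prob (A i) + (\<Sum>j\<in>J - {i}. prob (A i \<inter> A j))"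
   using J i by (subst sum.remove[of _ i]) auto
  also have "\<dots> \<le> P + (\<Sum>j\<in>J - {i}. P\<^sup>2 * q i j)"
   using P q i by (intro add_mono sum_mono) auto
  finally show "(\<Sum>j\<in>J. prob (A i \<inter> A j)) \<le> P + P\<^sup>2 * (\<Sum>j\<in>J - {i}. q i j)"
   by (simp add: sum_distrib_left)
 qed
 also have "\<dots> = n * P + P\<^sup>2 * (\<Sum>i\<in>J. \<Sum>j\<in>J - {i}. q i j)"
  by (simp add: sum.distrib sum_distrib_left n_def)
 also have "(\<Sum>i\<in>J. \<Sum>j\<in>J - {i}. q i j) = (\<Sum>i\<in>J. \<Sum>j\<in>J - {i}. q i j - 1) + n * (n - 1)"
 proof -
  have "(\<Sum>j\<in>J - {i}. q i j - 1) = (\<Sum>j\<in>J - {i}. q i j) - (n - 1)" if "i \<in> J" for i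
   using that J n by (simp add: sum_subtractf n_def of_nat_diff)
  then have "(\<Sum>i\<in>J. \<Sum>j\<in>J - {i}. q i j - 1) = (\<Sum>i\<in>J. (\<Sum>j\<in>J - {i}. q i j) - (n - 1))"
   by (intro sum.cong refl)
  moreover have "(\<Sum>i\<in>J. (\<Sum>j\<in>J - {i}. q i j) - (n - 1)) = (\<Sum>i\<in>J. \<Sum>j\<in>J - {i}. q i j) - n * (n - 1)"
   unfolding sum_subtractf by (simp add: n_def algebra_simps)
  ultimately show ?thesis by simp
 qed
 finally have EN2: "expectation (\<lambda>\<omega>. (N \<omega>)\<^sup>2) \<le> n * P + P\<^sup>2 * ((\<Sum>i\<in>J. \<Sum>j\<in>J - {i}. q i j - 1) + n * (n - 1))" .
 have nP: "n * P > 0" using n P by simp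
 \<comment> \<open>\<open>N = 0\<close> means a deviation from the mean \<open>n P\<close> by at least \<open>n P\<close>.\<close>
 have var: "variance N = expectation (\<lambda>\<omega>. (N \<omega>)\<^sup>2) - (n * P)\<^sup>2"
  using Nsq_int EN square_integrable_imp_integrable[OF N_meas Nsq_int] by (subst variance_eq) auto
 have "prob {\<omega>\<in>space M. \<forall>j\<in>J. \<omega> \<notin> A j} \<le> prob {\<omega>\<in>space M. n * P \<le> \<bar>N \<omega> - expectation N\<bar>}"
 proof (rule finite_measure_mono)
  show "{\<omega>\<in>space M. n * P \<le> \<bar>N \<omega> - expectation N\<bar>} \<in> events" using N_meas by measurable
  show "{\<omega>\<in>space M. \<forall>j\<in>J. \<omega> \<notin> A j} \<subseteq> {\<omega>\<in>space M. n * P \<le> \<bar>N \<omega> - expectation N\<bar>}"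
   using nP by (auto simp: EN N_def)
 qed
 also have "\<dots> \<le> variance N / (n * P)\<^sup>2"
  by (rule Chebyshev_inequality) (use N_meas Nsq_int nP in auto)
 also have "\<dots> \<le> (n * P + P\<^sup>2 * (\<Sum>i\<in>J. \<Sum>j\<in>J - {i}. q i j - 1)) / (n * P)\<^sup>2"
 proof (rule divide_right_mono)
  have "n * P\<^sup>2 \<ge> 0" using n by simp
  then show "variance N \<le> n * P + P\<^sup>2 * (\<Sum>i\<in>J. \<Sum>j\<in>J - {i}. q i j - 1)"
   using EN2 unfolding var by (simp add: algebra_simps power2_eq_square)
 qed simp
 also have "\<dots> = 1 / (n * P) + (\<Sum>i\<in>J. \<Sum>j\<in>J - {i}. q i j - 1) / n\<^sup>2"
  using n P by (simp add: add_divide_distrib power2_eq_square)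
 finally show ?thesis by (simp add: n_def)
qed

section \<open>Convex null sequences and elementary estimates\<close>

lemma convex_seq_diff_decseq:
 assumes "convex_seq r"
 shows "decseq (\<lambda>n. r n - r (Suc n))"
proof (rule decseq_SucI)
 fix n
 show "r (Suc n) - r (Suc (Suc n)) \<le> r n - r (Suc n)"
  using assms[unfolded convex_seq_def, rule_format, of n] by simp
qed

lemma convex_null_seq_diff_nonneg:
 assumes "convex_seq r" "r \<longlonglongrightarrow> 0"
 shows "r n - r (Suc n) \<ge> 0"
proof -
 have "(\<lambda>n. r n - r (Suc n)) \<longlonglongrightarrow> 0 - 0"
  by (intro tendsto_diff assms LIMSEQ_Suc)
 then show ?thesis
  using decseq_ge[OF convex_seq_diff_decseq[OF assms(1)], of 0 n] by simp
qed

lemma convex_null_seq_decseq: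
 assumes "convex_seq r" "r \<longlonglongrightarrow> 0"
 shows "decseq r"
 using convex_null_seq_diff_nonneg[OF assms] by (intro decseq_SucI) (simp add: algebra_simps)

lemma convex_null_seq_pos:
 assumes "convex_seq r" "r \<longlonglongrightarrow> 0" "eventually (\<lambda>n. r n \<noteq> 0) sequentially"
 shows "r n > 0"
proof -
 have nonneg: "r m \<ge> 0" for m
  using decseq_ge[OF convex_null_seq_decseq[OF assms(1,2)] assms(2)] by simp
 obtain m where m: "m \<ge> n" "r m \<noteq> 0"
  using assms(3) unfolding eventually_sequentially by (metis nat_le_linear)
 then show ?thesis
  using nonneg[of m] decseqD[OF convex_null_seq_decseq[OF assms(1,2)], of n m] by linarith
qed

text \<open>The differences of a convex null sequence decrease and are nonnegative. If the first one vanished, the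
 sequence would be constant.\<close>

lemma convex_null_seq_first_drop:
 assumes "convex_seq r" "r \<longlonglongrightarrow> 0" "r 0 > 0"
 shows "r 1 < r 0"
proof (rule ccontr)
 assume "\<not> r 1 < r 0"
 then have d: "r n - r (Suc n) = 0" for n
  using decseqD[OF convex_seq_diff_decseq[OF assms(1)], of 0 n] convex_null_seq_diff_nonneg[OF assms(1,2), of n]
  by simp
 have "r n = r 0" for n by (induction n) (use d in \<open>auto simp: algebra_simps\<close>)
 then have "r = (\<lambda>_. r 0)" by auto
 then have "r \<longlonglongrightarrow> r 0" by (metis tendsto_const)
 then show False using assms(2,3) LIMSEQ_unique[of r "r 0" 0] by simp
qed

lemma sum_sqrt_quotient_le: "(\<Sum>k=1..<w. sqrt (real w / real k)) \<le> 2 * real w"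
proof -
 have *: "(\<Sum>k=1..n. 1 / sqrt (real k)) \<le> 2 * sqrt (real n)" for n
 proof (induction n)
  case (Suc n)
  define a b where "a = sqrt (real n)" and "b = sqrt (real (Suc n))"
  have ab: "0 \<le> a" "a \<le> b" "0 < b" "b * b - a * a = 1"
   by (auto simp: a_def b_def)
  have "2 * (b - a) * b - 1 = (b - a) * (b - a)"
   using ab(4) by (simp add: algebra_simps)
  then have "1 \<le> 2 * (b - a) * b"
   by (metis diff_ge_0_iff_ge zero_le_square)
  then have "1 / b \<le> 2 * (b - a)"
   using ab by (simp add: divide_le_eq)
  then show ?case using Suc by (simp add: a_def b_def)
 qed simp
 have "(\<Sum>k=1..<w. 1 / sqrt (real k)) \<le> (\<Sum>k=1..w. 1 / sqrt (real k))"
  by (rule sum_mono2) auto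
 then have "(\<Sum>k=1..<w. 1 / sqrt (real k)) \<le> 2 * sqrt (real w)"
  using *[of w] by linarith
 then have "sqrt (real w) * (\<Sum>k=1..<w. 1 / sqrt (real k)) \<le> sqrt (real w) * (2 * sqrt (real w))"
  by (intro mult_left_mono) auto
 moreover have "sqrt (real w) * (2 * sqrt (real w)) = 2 * real w" by simp
 ultimately show ?thesis by (simp add: sum_distrib_left real_sqrt_divide)
qed

lemma ln_le_two_sqrt: "x > 0 \<Longrightarrow> ln x \<le> 2 * sqrt x" for x :: real
 using ln_le_minus_one[of "sqrt x"] by (simp add: ln_sqrt)

text \<open>Convexity of \<open>exp\<close> between \<open>0\<close> and \<open>ln x / 2\<close>. It bounds a small power of \<open>x\<close> so
 that \<open>sum_sqrt_quotient_le\<close> applies and the excess over 1 carries the small factor \<open>h\<close>.\<close>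

lemma exp_mult_le_interpolate:
 fixes x h :: real
 assumes "0 \<le> h" "h \<le> 1 / 2" "0 < x"
 shows "exp (h * ln x) \<le> 1 + 2 * h * sqrt x"
proof -
 have "exp ((1 - 2 * h) * 0 + (2 * h) * (ln x / 2)) \<le> (1 - 2 * h) * exp 0 + (2 * h) * exp (ln x / 2)"
  using convex_onD[OF exp_convex, of "2 * h" 0 "ln x / 2"] assms by simp
 also have "exp (ln x / 2) = sqrt x"
  using assms by (simp add: ln_sqrt[symmetric])
 finally have "exp (h * ln x) \<le> 1 - 2 * h + 2 * h * sqrt x" by simp
 then show ?thesis using assms by linarith
qed

text \<open>Every lag occurs at most twice, once on either side of \<open>i\<close>.\<close>

lemma sum_window_le:
 fixes f :: "nat \<Rightarrow> real"
 assumes i: "i \<in> {p..<p + int w}" and f: "\<And>k. k \<in> {1..<w} \<Longrightarrow> f k \<ge> 0"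
 shows "(\<Sum>j\<in>{p..<p + int w} - {i}. f (nat \<bar>i - j\<bar>)) \<le> 2 * (\<Sum>k=1..<w. f k)"
proof -
 have split: "{p..<p + int w} - {i} = {p..<i} \<union> {i<..<p + int w}" using i by auto
 have "(\<Sum>j\<in>{p..<p + int w} - {i}. f (nat \<bar>i - j\<bar>)) =
  (\<Sum>j\<in>{p..<i}. f (nat \<bar>i - j\<bar>)) + (\<Sum>j\<in>{i<..<p + int w}. f (nat \<bar>i - j\<bar>))"
  unfolding split by (rule sum.union_disjoint) auto
 moreover have "(\<Sum>j\<in>{p..<i}. f (nat \<bar>i - j\<bar>)) \<le> (\<Sum>k=1..<w. f k)"
 proof -
  have "inj_on (\<lambda>j. nat \<bar>i - j\<bar>) {p..<i}" by (auto simp: inj_on_def)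
  then have "(\<Sum>j\<in>{p..<i}. f (nat \<bar>i - j\<bar>)) = sum f ((\<lambda>j. nat \<bar>i - j\<bar>) ` {p..<i})"
   by (simp only: sum.reindex comp_def)
  also have "\<dots> \<le> (\<Sum>k=1..<w. f k)"
   using i f by (intro sum_mono2) auto
  finally show ?thesis .
 qed
 moreover have "(\<Sum>j\<in>{i<..<p + int w}. f (nat \<bar>i - j\<bar>)) \<le> (\<Sum>k=1..<w. f k)"
 proof -
  have "inj_on (\<lambda>j. nat \<bar>i - j\<bar>) {i<..<p + int w}" by (auto simp: inj_on_def)
  then have "(\<Sum>j\<in>{i<..<p + int w}. f (nat \<bar>i - j\<bar>)) = sum f ((\<lambda>j. nat \<bar>i - j\<bar>) ` {i<..<p + int w})"
   by (simp only: sum.reindex comp_def)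
  also have "\<dots> \<le> (\<Sum>k=1..<w. f k)"
   using i f by (intro sum_mono2) auto
  finally show ?thesis .
 qed
 ultimately show ?thesis by linarith
qed

lemma average_window:
 assumes "0 < w" "\<And>i. i \<in> {p..<p + int w} \<Longrightarrow> a \<le> f i" "\<And>i. i \<in> {p..<p + int w} \<Longrightarrow> f i \<le> b"
 shows "a \<le> (\<Sum>i\<in>{p..<p + int w}. f i) / real w" "(\<Sum>i\<in>{p..<p + int w}. f i) / real w \<le> b"
proof -
 show "a \<le> (\<Sum>i\<in>{p..<p + int w}. f i) / real w"
  using sum_bounded_below[of "{p..<p + int w}" a f] assms by (simp add: le_divide_eq mult.commute)
 show "(\<Sum>i\<in>{p..<p + int w}. f i) / real w \<le> b"
  using sum_bounded_above[of "{p..<p + int w}" f b] assms by (simp add: divide_le_eq mult.commute)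
qed

section \<open>Covariances decaying more slowly than the inverse logarithm\<close>

text \<open>\<open>N0 \<ge> 3\<close> keeps the logarithms positive wherever \<open>r_ln_mono\<close> is used.\<close>

locale slow_cov =
 fixes r :: "nat \<Rightarrow> real" and N0 :: nat
 assumes r0: "r 0 = 1" and r1: "r 1 < 1" and r_pos: "\<And>n. r n > 0"
  and r_dec: "\<And>m n. m \<le> n \<Longrightarrow> r n \<le> r m"
  and r_lim: "r \<longlonglongrightarrow> 0" and N0: "N0 \<ge> 3"
  and r_ln_mono: "\<And>m n. N0 \<le> m \<Longrightarrow> m \<le> n \<Longrightarrow> r m * ln (real m) \<le> r n * ln (real n)"
  and r_ln_lim: "filterlim (\<lambda>n. r n * ln (real n)) at_top sequentially"

text \<open>The positive null sequence \<open>1 / (r n * ln n)\<close> cannot increase, so its monotonicity means that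
 \<open>r n * ln n\<close> is eventually nondecreasing.\<close>

lemma slow_cov_intro:
 assumes r0: "r 0 = 1" and cvx: "convex_seq r" and lim: "r \<longlonglongrightarrow> 0"
  and nz: "eventually (\<lambda>n. r n \<noteq> 0) sequentially"
  and mono: "\<exists>N. monoseq (\<lambda>n. inverse (r (n + N) * ln (real (n + N))))"
  and inv: "(\<lambda>n. inverse (r n * ln (real n))) \<longlonglongrightarrow> 0"
 shows "\<exists>N0. slow_cov r N0"
proof -
 obtain N where N: "monoseq (\<lambda>n. inverse (r (n + N) * ln (real (n + N))))" using mono by blast
 define f where "f n = r n * ln (real n)" for n
 have rpos: "r n > 0" for n by (rule convex_null_seq_pos[OF cvx lim nz])
 have fpos: "f n > 0" if "n \<ge> 3" for n using rpos[of n] that by (simp add: f_def)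
 have inv': "(\<lambda>n. inverse (f n)) \<longlonglongrightarrow> 0" using inv by (simp add: f_def)
 have dec: "inverse (f (n + N)) \<le> inverse (f (m + N))" if mn: "3 \<le> m" "m \<le> n" for m n
 proof -
  have "(\<forall>m. \<forall>n\<ge>m. inverse (f (m + N)) \<le> inverse (f (n + N))) \<or> (\<forall>m. \<forall>n\<ge>m. inverse (f (n + N)) \<le> inverse (f (m + N)))"
   using N unfolding monoseq_def f_def .
  then show ?thesis
  proof
   assume inc: "\<forall>m. \<forall>n\<ge>m. inverse (f (m + N)) \<le> inverse (f (n + N))"
   have "inverse (f (3 + N)) \<le> 0"
   proof (rule LIMSEQ_le_const)
    show "(\<lambda>n. inverse (f (n + N))) \<longlonglongrightarrow> 0" using LIMSEQ_ignore_initial_segment[OF inv'] .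
    show "\<exists>n0. \<forall>n\<ge>n0. inverse (f (3 + N)) \<le> inverse (f (n + N))" using inc by blast
   qed
   then show ?thesis using fpos[of "3 + N"] by simp
  qed (use mn in blast)
 qed
 have "slow_cov r (N + 3)"
 proof
  show "r 0 = 1" by (rule r0)
  show "r 1 < 1" using convex_null_seq_first_drop[OF cvx lim] r0 by simp
  show "r n > 0" for n by (rule rpos)
  show "r n \<le> r m" if "m \<le> n" for m n using decseqD[OF convex_null_seq_decseq[OF cvx lim] that] .
  show "r \<longlonglongrightarrow> 0" by (rule lim)
  show "N + 3 \<ge> 3" by simp
  fix m n :: nat assume mn: "N + 3 \<le> m" "m \<le> n"
  have "inverse (f ((n - N) + N)) \<le> inverse (f ((m - N) + N))" using mn by (intro dec) auto
  then have "inverse (f n) \<le> inverse (f m)" using mn by simp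
  then have "f m \<le> f n" using fpos[of m] fpos[of n] mn by (auto intro: inverse_le_imp_le)
  then show "r m * ln (real m) \<le> r n * ln (real n)" by (simp add: f_def)
 next
  have "\<forall>\<^sub>F n in sequentially. 0 < inverse (f n)"
   using eventually_ge_at_top[of 3] by eventually_elim (use fpos in simp)
  then have "filterlim (\<lambda>n. inverse (inverse (f n))) at_top sequentially"
   by (rule filterlim_inverse_at_top[OF inv'])
  then show "filterlim (\<lambda>n. r n * ln (real n)) at_top sequentially" by (simp add: f_def)
 qed
 then show ?thesis ..
qed

context slow_cov
begin

lemma r_le_1: "r n \<le> 1"
 using r_dec[of 0 n] r0 by simp

text \<open>The relative oscillation of \<open>r\<close> is at most that of \<open>ln\<close>; this is the form in which \<open>r_ln_mono\<close> enters all
 later estimates.\<close>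

lemma r_diff_le:
 assumes "N0 \<le> m" "m \<le> n"
 shows "r m - r n \<le> r n * ((ln (real n) - ln (real m)) / ln (real m))"
proof -
 have "ln (real m) > 0" using assms N0 by simp
 then show ?thesis
  using r_ln_mono[OF assms] by (simp add: field_simps)
qed

text \<open>A bound for the amount by which the covariance of an element of a window of length \<open>w\<close> with the mean
 of the window exceeds the lower bound \<open>r w\<close>.\<close>

definition excess :: "nat \<Rightarrow> real" where
 "excess w = 2 / real w * (\<Sum>k<w. r k - r w)"

lemma excess_nonneg: "excess w \<ge> 0"
 unfolding excess_def using r_dec by (intro mult_nonneg_nonneg sum_nonneg) auto

text \<open>Lags with \<open>k\<^sup>2 < w\<close> are covered by \<open>r k \<le> 1\<close>, the others by \<open>r_diff_le\<close> and \<open>ln x \<le> 2 * sqrt x\<close>. Both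
 cases fit under one multiple of \<open>sqrt (w / k)\<close>, which can be summed.\<close>

lemma eventually_r_diff_le_sqrt:
 "\<forall>\<^sub>F w in sequentially. \<forall>k\<in>{1..<w}.
   r k - r w \<le> sqrt (real w / real k) * (real w powr (-1/4) + 4 * r w / ln (real w))"
 using eventually_ge_at_top[of "N0^2"] eventually_ge_at_top[of 3]
proof eventually_elim
 case (elim w)
 have lw: "ln (real w) > 0" using elim by simp
 show ?case
 proof
  fix k assume k: "k \<in> {1..<w}"
  show "r k - r w \<le> sqrt (real w / real k) * (real w powr (-1/4) + 4 * r w / ln (real w))"
  proof (cases "k^2 < w")
   case True
   have k2: "real k ^ 2 < real w"
    using True by (metis of_nat_less_iff of_nat_power)
   have "real k < sqrt (real w)"
    by (rule real_less_rsqrt) (use k2 in simp)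
   have "sqrt (real w) \<le> real w / real k"
    using \<open>real k < sqrt (real w)\<close> k
    by (simp add: le_divide_eq) (metis mult_left_mono real_sqrt_ge_zero of_nat_0_le_iff less_imp_le real_sqrt_mult_self abs_of_nonneg)
   then have "sqrt (sqrt (real w)) \<le> sqrt (real w / real k)" by (rule real_sqrt_le_mono)
   moreover have "sqrt (sqrt (real w)) = real w powr (1/4)"
    by (simp add: powr_half_sqrt[symmetric] powr_powr)
   ultimately have "1 \<le> sqrt (real w / real k) * real w powr (-1/4)"
    using elim by (simp add: powr_minus field_simps)
   moreover have "0 \<le> sqrt (real w / real k) * (4 * r w / ln (real w))"
    using lw r_pos[of w] by simp
   moreover have "r k - r w \<le> 1" using r_le_1[of k] r_pos[of w] by linarith
   ultimately show ?thesis by (simp only: distrib_left)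
  next
   case False
   then have k2: "w \<le> k^2" by simp
   then have "N0 ^ 2 \<le> k ^ 2" using elim by linarith
   then have kN: "N0 \<le> k" by (simp add: power2_nat_le_eq_le)
   have "ln (real w) \<le> ln (real k ^ 2)"
    using k2 elim by (intro ln_mono) (auto simp flip: of_nat_power)
   also have "\<dots> = 2 * ln (real k)" using k by (simp add: ln_realpow)
   finally have lk: "ln (real w) / 2 \<le> ln (real k)" by simp
   have q: "real w / real k \<ge> 1" using k by simp
   have "r k - r w \<le> r w * ((ln (real w) - ln (real k)) / ln (real k))"
    using kN k by (intro r_diff_le) auto
   also have "ln (real w) - ln (real k) = ln (real w / real k)"
    using k by (simp add: ln_div)
   also have "r w * (ln (real w / real k) / ln (real k)) \<le> r w * ((2 * sqrt (real w / real k)) / (ln (real w) / 2))"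
    using lk lw q r_pos[of w] ln_le_two_sqrt[of "real w / real k"]
    by (intro mult_left_mono frac_le) auto
   also have "\<dots> = sqrt (real w / real k) * (4 * r w / ln (real w))" by simp
   also have "\<dots> \<le> sqrt (real w / real k) * (real w powr (-1/4) + 4 * r w / ln (real w))"
    using q by (intro mult_left_mono) auto
   finally show ?thesis .
  qed
 qed
qed

text \<open>Correlations matter for the maximum of \<open>w\<close> normal variables on the scale \<open>1 / ln w\<close>. The error made by
 centring at a window mean is of smaller order.\<close>

lemma excess_ln_tendsto_0: "(\<lambda>w. excess w * ln (real w)) \<longlonglongrightarrow> 0"
proof (rule tendsto_sandwich)
 show "\<forall>\<^sub>F w in sequentially. 0 \<le> excess w * ln (real w)"
  using eventually_ge_at_top[of 1] by eventually_elim (use excess_nonneg in auto)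
 show "\<forall>\<^sub>F w in sequentially. excess w * ln (real w) \<le>
   (2 * ln (real w) / real w + 4 * (real w powr (-1/4) * ln (real w))) + 16 * r w"
  using eventually_r_diff_le_sqrt eventually_ge_at_top[of 3]
 proof eventually_elim
  case (elim w)
  define c where "c = real w powr (-1/4) + 4 * r w / ln (real w)"
  have c: "c \<ge> 0" unfolding c_def using r_pos[of w] elim by (intro add_nonneg_nonneg) auto
  have "{..<w} = insert 0 {1..<w}" using elim by auto
  then have "(\<Sum>k<w. r k - r w) = (r 0 - r w) + (\<Sum>k=1..<w. r k - r w)" by simp
  also have "\<dots> \<le> 1 + (\<Sum>k=1..<w. sqrt (real w / real k) * c)"
   using elim r0 r_pos[of w] unfolding c_def by (intro add_mono sum_mono) auto
  also have "\<dots> \<le> 1 + 2 * real w * c"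
   unfolding sum_distrib_right[symmetric]
   using sum_sqrt_quotient_le[of w] c by (intro add_left_mono mult_right_mono) auto
  finally have "excess w \<le> 2 / real w * (1 + 2 * real w * c)"
   unfolding excess_def by (intro mult_left_mono) auto
  also have "\<dots> = 2 / real w + 4 * c" using elim by (simp add: field_simps)
  finally have "excess w * ln (real w) \<le> (2 / real w + 4 * c) * ln (real w)"
   using elim by (intro mult_right_mono) auto
  also have "\<dots> = (2 * ln (real w) / real w + 4 * (real w powr (-1/4) * ln (real w))) + 16 * r w"
   using elim by (simp add: c_def field_simps)
  finally show ?case .
 qed
 have "(\<lambda>w. 2 * ln (real w) / real w + 4 * (real w powr (-1/4) * ln (real w))) \<longlonglongrightarrow> 0"
  by real_asymp
 then show "(\<lambda>w. (2 * ln (real w) / real w + 4 * (real w powr (-1/4) * ln (real w))) + 16 * r w) \<longlonglongrightarrow> 0"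
  using tendsto_mult_right_zero[OF r_lim, of 16] tendsto_add by fastforce
qed auto

lemma excess_tendsto_0: "excess \<longlonglongrightarrow> 0"
proof (rule Lim_null_comparison[OF _ excess_ln_tendsto_0])
 have "\<forall>\<^sub>F w in sequentially. ln (real w) \<ge> 1" by real_asymp
 then show "\<forall>\<^sub>F w in sequentially. norm (excess w) \<le> excess w * ln (real w)"
  by eventually_elim (use excess_nonneg mult_left_mono[of 1] in \<open>fastforce simp: abs_of_nonneg\<close>)
qed

text \<open>A lower bound for the variance of an element of a window of length \<open>w\<close> minus the mean of the window.\<close>

definition resid_var :: "nat \<Rightarrow> real" where
 "resid_var w = 1 - r w - 2 * excess w"

text \<open>An upper bound for the absolute correlation of two such differences at lag \<open>k\<close>.\<close>

definition resid_corr :: "nat \<Rightarrow> nat \<Rightarrow> real" where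
 "resid_corr w k = (r k - r w + 2 * excess w) / resid_var w"

lemma resid_var_tendsto: "resid_var \<longlonglongrightarrow> 1"
 unfolding resid_var_def using tendsto_diff[OF tendsto_diff[OF tendsto_const r_lim] tendsto_mult_left[OF excess_tendsto_0, of 2], of 1]
 by simp

lemma resid_corr_range:
 assumes "0 < resid_var w" "k \<in> {1..<w}"
 shows "0 \<le> resid_corr w k" "resid_corr w k \<le> resid_corr w 1"
proof -
 show "0 \<le> resid_corr w k"
  using assms r_dec[of k w] excess_nonneg[of w] by (auto simp: resid_corr_def)
 show "resid_corr w k \<le> resid_corr w 1"
  using assms r_dec[of 1 k] by (auto simp: resid_corr_def divide_right_mono)
qed

lemma resid_corr_1_tendsto: "(\<lambda>w. resid_corr w 1) \<longlonglongrightarrow> r 1"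
proof -
 have "(\<lambda>w. resid_corr w 1) \<longlonglongrightarrow> (r 1 - 0 + 2 * 0) / 1"
  unfolding resid_corr_def by (intro tendsto_intros r_lim excess_tendsto_0 resid_var_tendsto) auto
 then show ?thesis by simp
qed

text \<open>There are at most \<open>w\<^sup>\<eta>\<close> lags \<open>k \<le> w\<^sup>\<eta>\<close>. Their correlations stay below a constant \<open>G < 1\<close>, so each
 factor is \<open>O(w\<^sup>1\<^sup>-\<^sup>3\<^sup>\<eta>)\<close> and their contribution to the average is \<open>O(w\<^sup>-\<^sup>2\<^sup>\<eta>)\<close>. At the other lags
 the correlation is \<open>O(r w * ln (w / k) / ln w)\<close> and the factor is close to a power \<open>(w / k)\<^sup>h\<close>, where \<open>h\<close>
 is a multiple of \<open>r w\<close> and tends to 0; its average excess over 1 is \<open>O(h)\<close>. A squared level of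
 \<open>(2 + \<zeta>) * ln w\<close> with positive \<open>\<zeta>\<close> leaves room for the actual level.\<close>

lemma box_factor_average:
 shows "\<exists>\<zeta>>0. (\<lambda>w. (\<Sum>k=1..<w. box_factor ((2 + \<zeta>) * ln (real w)) (resid_corr w k) - 1) / real w) \<longlonglongrightarrow> 0"
proof -
 define G where "G = (1 + r 1) / 2"
 have G: "0 < G" "G < 1" "r 1 < G" using r1 r_pos[of 1] by (auto simp: G_def)
 have G2: "G\<^sup>2 < 1" using G by (simp add: power_less_one_iff)
 \<comment> \<open>\<open>\<theta> < 1/2\<close> bounds the exponent at any lag; \<open>\<eta>\<close> and \<open>\<zeta>\<close> divide up the gap between \<open>2 \<theta>\<close> and 1.\<close>
 define \<theta> where "\<theta> = G / (1 + G)"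
 have \<theta>: "0 < \<theta>" "\<theta> < 1 / 2" using G by (auto simp: \<theta>_def field_simps)
 define \<eta> where "\<eta> = (1 - 2 * \<theta>) / 4"
 have \<eta>: "0 < \<eta>" "\<eta> \<le> 1/4" using \<theta> by (auto simp: \<eta>_def)
 define \<zeta> where "\<zeta> = 2 * \<eta>"
 have \<zeta>: "0 < \<zeta>" "\<zeta> \<le> 1" using \<eta> by (auto simp: \<zeta>_def)
 have \<theta>\<zeta>: "\<theta> * (2 + \<zeta>) \<le> 1 - 3 * \<eta>"
 proof -
  have "\<theta> * \<zeta> \<le> (1/2) * \<zeta>" using \<theta> \<zeta> by (intro mult_right_mono) auto
  moreover have "2 * \<theta> = 1 - 4 * \<eta>" by (simp add: \<eta>_def field_simps)
  ultimately show ?thesis by (simp add: distrib_left \<zeta>_def)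
 qed
 define C where "C = 1 / sqrt (1 - G\<^sup>2)"
 have C: "C \<ge> 0" using G2 by (simp add: C_def)
 define gb where "gb w = 2 * (r w / \<eta> + 2 * excess w)" for w
 define h where "h w = 6 * r w / \<eta>" for w
 define A where "A w = exp (12 * (excess w * ln (real w))) / sqrt (1 - (gb w)\<^sup>2)" for w
 have gb0: "gb \<longlonglongrightarrow> 0" unfolding gb_def
  using tendsto_mult_right_zero[OF tendsto_add_zero[OF tendsto_divide_zero[OF r_lim] tendsto_mult_right_zero[OF excess_tendsto_0]]] .
 have h0: "h \<longlonglongrightarrow> 0" unfolding h_def
  by (intro tendsto_divide_zero tendsto_mult_right_zero r_lim)
 have A1: "A \<longlonglongrightarrow> 1"
 proof -
  have "A \<longlonglongrightarrow> exp (12 * 0) / sqrt (1 - 0\<^sup>2)"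
   unfolding A_def by (intro tendsto_intros excess_ln_tendsto_0 gb0) auto
  then show ?thesis by simp
 qed
 have ev: "\<forall>\<^sub>F w in sequentially. resid_corr w 1 < G \<and> resid_var w > 1 / 2 \<and> gb w < 1 \<and> h w < 1/2 \<and> real w powr \<eta> \<ge> real N0 \<and> w \<ge> 3"
 proof (intro eventually_conj)
  show "\<forall>\<^sub>F w in sequentially. real w powr \<eta> \<ge> real N0"
  proof -
   have "filterlim (\<lambda>w. real w powr \<eta>) at_top sequentially" using \<eta>(1) by real_asymp
   then show ?thesis by (simp add: filterlim_at_top)
  qed
  show "\<forall>\<^sub>F w in sequentially. resid_corr w 1 < G"
   by (rule order_tendstoD(2)[OF resid_corr_1_tendsto G(3)])
  show "\<forall>\<^sub>F w in sequentially. 1 / 2 < resid_var w"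
   by (rule order_tendstoD(1)[OF resid_var_tendsto]) simp
  show "\<forall>\<^sub>F w in sequentially. gb w < 1" "\<forall>\<^sub>F w in sequentially. h w < 1 / 2"
   by (rule order_tendstoD(2)[OF gb0] order_tendstoD(2)[OF h0]; simp)+
 qed (rule eventually_ge_at_top)
 have "(\<lambda>w. (\<Sum>k=1..<w. box_factor ((2 + \<zeta>) * ln (real w)) (resid_corr w k) - 1) / real w) \<longlonglongrightarrow> 0"
 proof (rule tendsto_sandwich)
  show "\<forall>\<^sub>F w in sequentially. 0 \<le> (\<Sum>k=1..<w. box_factor ((2 + \<zeta>) * ln (real w)) (resid_corr w k) - 1) / real w"
   using ev
  proof eventually_elim
   case (elim w)
   have "0 \<le> resid_corr w k" "resid_corr w k < 1" if "k \<in> {1..<w}" for k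
    using resid_corr_range[OF _ that] elim G by force+
   then show ?case
    using elim \<zeta> by (intro divide_nonneg_nonneg sum_nonneg) (auto intro!: box_factor_ge_1)
  qed
  show "\<forall>\<^sub>F w in sequentially. (\<Sum>k=1..<w. box_factor ((2 + \<zeta>) * ln (real w)) (resid_corr w k) - 1) / real w
   \<le> C * real w powr (- 2 * \<eta>) + (A w - 1) + 4 * A w * h w"
   using ev
  proof eventually_elim
   case (elim w)
   have lw: "ln (real w) > 0" and w0: "real w > 0" using elim by auto
   have h: "0 \<le> h w" "h w \<le> 1/2" using elim r_pos[of w] \<eta> by (auto simp: h_def)
   have gb: "0 \<le> gb w" "gb w < 1" using elim r_pos[of w] excess_nonneg[of w] \<eta> by (auto simp: gb_def)
   have gb2: "(gb w)\<^sup>2 < 1" using gb by (simp add: power_less_one_iff)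
   have A: "1 \<le> A w"
   proof -
    have "0 < sqrt (1 - (gb w)\<^sup>2)" "sqrt (1 - (gb w)\<^sup>2) \<le> 1" using gb2 by auto
    moreover have "1 \<le> exp (12 * (excess w * ln (real w)))" using lw excess_nonneg[of w] by simp
    ultimately show ?thesis unfolding A_def by (simp only: le_divide_eq_1_pos)
   qed
   \<comment> \<open>At most \<open>w\<^sup>\<eta>\<close> lags are small; there only \<open>resid_corr w k \<le> G\<close> is available.\<close>
   define small where "small = {k\<in>{1..<w}. real k \<le> real w powr \<eta>}"
   have card_small: "real (card small) \<le> real w powr \<eta>"
   proof -
    have "small \<subseteq> {1..nat \<lfloor>real w powr \<eta>\<rfloor>}" unfolding small_def by (auto simp: le_nat_floor)
    then have "card small \<le> nat \<lfloor>real w powr \<eta>\<rfloor>" using card_mono[of "{1..nat \<lfloor>real w powr \<eta>\<rfloor>}" small] by simp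
    then have "real (card small) \<le> real (nat \<lfloor>real w powr \<eta>\<rfloor>)" by (rule of_nat_mono)
    then show ?thesis using of_nat_floor[of "real w powr \<eta>"] powr_ge_zero[of "real w" \<eta>] by linarith
   qed
   have corr: "0 \<le> resid_corr w k" "resid_corr w k \<le> G" if "k \<in> {1..<w}" for k
    using resid_corr_range[OF _ that] elim by force+
   have termwise: "box_factor ((2 + \<zeta>) * ln (real w)) (resid_corr w k) - 1 \<le>
     (if k \<in> small then C * real w powr (1 - 3 * \<eta>) else 0) + ((A w - 1) + A w * (2 * h w) * sqrt (real w / real k))"
    if k: "k \<in> {1..<w}" for k
   proof (cases "k \<in> small")
    case True
    have "box_factor ((2 + \<zeta>) * ln (real w)) (resid_corr w k) \<le> box_factor ((2 + \<zeta>) * ln (real w)) G"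
     using corr[OF k] G \<zeta> lw by (intro box_factor_mono) auto
    also have "\<dots> = C * exp (\<theta> * (2 + \<zeta>) * ln (real w))"
     by (simp add: box_factor_def C_def \<theta>_def mult.assoc)
    also have "\<dots> \<le> C * exp ((1 - 3 * \<eta>) * ln (real w))"
     using \<theta>\<zeta> lw C by (intro mult_left_mono) auto
    also have "\<dots> = C * real w powr (1 - 3 * \<eta>)" using w0 by (simp add: powr_def)
    finally have "box_factor ((2 + \<zeta>) * ln (real w)) (resid_corr w k) \<le> C * real w powr (1 - 3 * \<eta>)" .
    moreover have "0 \<le> A w * (2 * h w) * sqrt (real w / real k)" using A h by simp
    ultimately show ?thesis using True A by simp
   next
    \<comment> \<open>At a large lag the correlation is \<open>O(r w * ln (w / k) / ln w)\<close>, and the exponent is \<open>h w * ln (w / k)\<close> up to a null sequence.\<close>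
    case False
    then have kw: "real k > real w powr \<eta>" using k by (auto simp: small_def)
    then have kN: "N0 \<le> k" using elim by linarith
    have lk: "\<eta> * ln (real w) \<le> ln (real k)"
    proof -
     have "ln (real w powr \<eta>) \<le> ln (real k)" using kw w0 k by (intro ln_mono) auto
     then show ?thesis using w0 by (simp add: ln_powr)
    qed
    define l where "l = ln (real w / real k)"
    have l0: "0 \<le> l" using k by (simp add: l_def)
    have l1: "l \<le> ln (real w)" using k by (auto simp: l_def ln_div)
    have rk: "r k - r w \<le> r w * l / (\<eta> * ln (real w))"
    proof -
     have "r k - r w \<le> r w * (l / ln (real k))"
      using r_diff_le[of k w] kN k by (simp add: l_def ln_div)
     also have "\<dots> \<le> r w * (l / (\<eta> * ln (real w)))"
      using lk l0 lw \<eta> r_pos[of w] by (intro mult_left_mono divide_left_mono) (auto intro!: mult_pos_pos less_le_trans[OF _ lk])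
     finally show ?thesis by simp
    qed
    have rk': "r k - r w \<le> r w / \<eta>"
    proof -
     have "r w * l / (\<eta> * ln (real w)) \<le> r w * ln (real w) / (\<eta> * ln (real w))"
      using l1 r_pos[of w] \<eta> lw by (intro divide_right_mono mult_left_mono) auto
     then show ?thesis using rk lw by simp
    qed
    have corr2: "resid_corr w k \<le> 2 * (r k - r w + 2 * excess w)"
    proof -
     have "(r k - r w + 2 * excess w) / resid_var w \<le> (r k - r w + 2 * excess w) / (1 / 2)"
      using elim r_dec[of k w] k excess_nonneg[of w] by (intro divide_left_mono) auto
     then show ?thesis by (simp add: resid_corr_def)
    qed
    have cgb: "resid_corr w k \<le> gb w" using corr2 rk' by (simp add: gb_def)
    have expo: "resid_corr w k / (1 + resid_corr w k) * ((2 + \<zeta>) * ln (real w)) \<le> 12 * (excess w * ln (real w)) + h w * l"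
    proof -
     have "resid_corr w k / (1 + resid_corr w k) * ((2 + \<zeta>) * ln (real w)) \<le> resid_corr w k * (3 * ln (real w))"
      using corr[OF k] \<zeta> lw by (intro mult_mono) (auto simp: divide_le_eq distrib_left)
     also have "\<dots> \<le> (2 * (r w * l / (\<eta> * ln (real w)) + 2 * excess w)) * (3 * ln (real w))"
      using corr2 rk lw by (intro mult_right_mono) auto
     also have "\<dots> = 12 * (excess w * ln (real w)) + h w * l"
      using lw \<eta> by (simp add: h_def field_simps)
     finally show ?thesis .
    qed
    have "box_factor ((2 + \<zeta>) * ln (real w)) (resid_corr w k) \<le> exp (12 * (excess w * ln (real w)) + h w * l) / sqrt (1 - (gb w)\<^sup>2)"
     unfolding box_factor_def
    proof (rule frac_le)
     show "exp (resid_corr w k / (1 + resid_corr w k) * ((2 + \<zeta>) * ln (real w))) \<le> exp (12 * (excess w * ln (real w)) + h w * l)"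
      using expo by simp
     show "sqrt (1 - (gb w)\<^sup>2) \<le> sqrt (1 - (resid_corr w k)\<^sup>2)"
      using cgb corr[OF k] by (simp add: power_mono)
    qed (use gb2 in auto)
    also have "\<dots> = A w * exp (h w * l)" by (simp add: A_def exp_add)
    also have "\<dots> \<le> A w * (1 + 2 * h w * sqrt (real w / real k))"
     using h A k unfolding l_def by (intro mult_left_mono exp_mult_le_interpolate) auto
    finally show ?thesis using False by (simp add: algebra_simps)
   qed
   have "(\<Sum>k=1..<w. box_factor ((2 + \<zeta>) * ln (real w)) (resid_corr w k) - 1)
    \<le> (\<Sum>k=1..<w. (if k \<in> small then C * real w powr (1 - 3 * \<eta>) else 0) + ((A w - 1) + A w * (2 * h w) * sqrt (real w / real k)))"
    by (intro sum_mono termwise)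
   also have "\<dots> = real (card small) * (C * real w powr (1 - 3 * \<eta>)) + real (w - 1) * (A w - 1)
     + A w * (2 * h w) * (\<Sum>k=1..<w. sqrt (real w / real k))"
   proof -
    have "{1..<w} \<inter> small = small" by (auto simp: small_def)
    then have "(\<Sum>k=1..<w. if k \<in> small then C * real w powr (1 - 3 * \<eta>) else 0) = real (card small) * (C * real w powr (1 - 3 * \<eta>))"
     by (simp add: sum.inter_restrict[symmetric])
    then show ?thesis by (simp add: sum.distrib sum_distrib_left)
   qed
   also have "\<dots> \<le> real w powr \<eta> * (C * real w powr (1 - 3 * \<eta>)) + real w * (A w - 1) + A w * (2 * h w) * (2 * real w)"
    using card_small C A h sum_sqrt_quotient_le[of w] by (intro add_mono mult_right_mono mult_left_mono) auto
   also have "\<dots> = (C * real w powr (- 2 * \<eta>) + (A w - 1) + 4 * A w * h w) * real w"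
   proof -
    have "real w powr \<eta> * real w powr (1 - 3 * \<eta>) = real w powr (- 2 * \<eta>) * real w powr 1"
     by (simp only: powr_add[symmetric]) simp
    then show ?thesis using w0 by (simp add: algebra_simps)
   qed
   finally show ?case using w0 by (simp add: divide_le_eq)
  qed
  have "(\<lambda>w. C * real w powr (- 2 * \<eta>)) \<longlonglongrightarrow> 0"
   using \<eta>(1) by (intro tendsto_mult_right_zero) real_asymp
  then have "(\<lambda>w. C * real w powr (- 2 * \<eta>) + (A w - 1) + 4 * A w * h w) \<longlonglongrightarrow> 0 + (1 - 1) + 4 * 1 * 0"
   by (intro tendsto_intros A1 h0)
  then show "(\<lambda>w. C * real w powr (- 2 * \<eta>) + (A w - 1) + 4 * A w * h w) \<longlonglongrightarrow> 0" by simp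
 qed auto
 then show ?thesis using \<zeta> by blast
qed

section \<open>The scales of the problem\<close>

text \<open>In the asymptotic estimates below, \<open>b\<close> is the slope \<open>\<beta>\<close> of the boundary, and \<open>\<rho>\<close> in comments is \<open>rho r b\<close>.\<close>

abbreviation lg :: "real \<Rightarrow> real" where "lg b \<equiv> ln (1 / b)"

text \<open>The lag at which the reference covariance \<open>rho r b\<close> is taken.\<close>

definition lag0 :: "real \<Rightarrow> nat" where "lag0 b = nat \<lfloor>1 / b\<rfloor>"

text \<open>The length of the window in the upper bound. It is short enough for the boundary \<open>b * i\<close> to rise by only
 \<open>o(sqrt (rho r b))\<close> along the window, and of the order of the number of indices that contribute to the maximum.\<close>

definition wlen :: "real \<Rightarrow> nat" where "wlen b = nat \<lceil>1 / (b * sqrt (lg b))\<rceil>"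

text \<open>Exceedances beyond this index are negligible. It is larger than \<open>1 / b\<close> only by a logarithmic factor,
 so \<open>r\<close> hardly changes up to twice the index.\<close>

definition tlen :: "real \<Rightarrow> nat" where "tlen b = nat \<lceil>2 * lg b / b\<rceil>"

definition amp :: "real \<Rightarrow> real" where "amp b = a_fun (b / sqrt (1 - rho r b))"

text \<open>One bound for every deviation of a relevant covariance from \<open>rho r b\<close>: the drop of \<open>r\<close> from the shortest
 to the longest scale in use, plus the errors of centring at window means on both scales.\<close>

definition slack :: "real \<Rightarrow> real" where
 "slack b = (r (wlen b) - r (2 * tlen b)) + 2 * excess (wlen b) + 2 * excess (tlen b)"

lemma rho_eq: "rho r b = r (lag0 b)"
 by (simp add: rho_def lag0_def)

lemma rho_pos: "rho r b > 0"
 by (simp add: rho_eq r_pos)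

lemma lg_at_top: "filterlim lg at_top (at_right 0)"
 by real_asymp

lemma lg_ge: "\<forall>\<^sub>F b in at_right 0. c \<le> lg b"
 using lg_at_top by (simp add: filterlim_at_top)

lemma beta_pos: "\<forall>\<^sub>F b::real in at_right 0. 0 < b \<and> b < 1"
 using eventually_at_right_real[of 0 1] by simp

lemma scale_bounds:
 "\<forall>\<^sub>F b in at_right 0. 0 < wlen b \<and> wlen b \<le> lag0 b \<and> lag0 b \<le> tlen b \<and>
   1 / (b * sqrt (lg b)) \<le> real (wlen b) \<and> real (wlen b) \<le> 1 / (b * sqrt (lg b)) + 1 \<and>
   real (lag0 b) \<le> 1 / b \<and>
   2 * lg b / b \<le> real (tlen b) \<and> real (tlen b) \<le> 2 * lg b / b + 1"
proof -
 have "\<forall>\<^sub>F b in at_right 0. 1 / (b * sqrt (lg b)) + 2 \<le> 1 / b" by real_asymp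
 then show ?thesis using beta_pos lg_ge[of 1]
 proof eventually_elim
  case (elim b)
  have pos: "1 / (b * sqrt (lg b)) > 0" "2 * lg b / b > 0" using elim by auto
  have W: "1 / (b * sqrt (lg b)) \<le> real (wlen b)" "real (wlen b) \<le> 1 / (b * sqrt (lg b)) + 1"
   unfolding wlen_def using pos by linarith+
  have L: "real (lag0 b) \<le> 1 / b" "1 / b - 1 \<le> real (lag0 b)"
   unfolding lag0_def using elim divide_pos_pos[of 1 b] by linarith+
  have K: "2 * lg b / b \<le> real (tlen b)" "real (tlen b) \<le> 2 * lg b / b + 1"
   unfolding tlen_def using pos by linarith+
  have "1 / b \<le> 2 * lg b / b" using elim by (intro divide_right_mono) auto
  then have "real (wlen b) \<le> real (lag0 b)" "real (lag0 b) \<le> real (tlen b)" "0 < real (wlen b)"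
   using W L K elim pos by linarith+
  then show ?case using W L K by simp
 qed
qed

lemma wlen_at_top: "filterlim wlen at_top (at_right 0)"
proof -
 have "filterlim (\<lambda>b. real (wlen b)) at_top (at_right 0)"
 proof (rule filterlim_at_top_mono)
  show "filterlim (\<lambda>b. 1 / (b * sqrt (lg b))) at_top (at_right 0)" by real_asymp
  show "\<forall>\<^sub>F b in at_right 0. 1 / (b * sqrt (lg b)) \<le> real (wlen b)"
   using scale_bounds by eventually_elim simp
 qed
 then show ?thesis by (simp add: filterlim_sequentially_iff_filterlim_real)
qed

lemma lag0_at_top: "filterlim lag0 at_top (at_right 0)"
 by (rule filterlim_at_top_mono[OF wlen_at_top]) (use scale_bounds in eventually_elim, simp)

lemma tlen_at_top: "filterlim tlen at_top (at_right 0)"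
 by (rule filterlim_at_top_mono[OF lag0_at_top]) (use scale_bounds in eventually_elim, simp)

lemma rho_tendsto: "(rho r \<longlongrightarrow> 0) (at_right 0)"
 unfolding rho_eq[abs_def] using filterlim_compose[OF r_lim lag0_at_top] .

lemma rho_lg: "filterlim (\<lambda>b. rho r b * lg b) at_top (at_right 0)"
proof (rule filterlim_at_top_mono[OF filterlim_compose[OF r_ln_lim lag0_at_top]])
 show "\<forall>\<^sub>F b in at_right 0. r (lag0 b) * ln (real (lag0 b)) \<le> rho r b * lg b"
  using scale_bounds
 proof eventually_elim
  case (elim b)
  then have "ln (real (lag0 b)) \<le> lg b" by (intro ln_mono) auto
  then show ?case unfolding rho_eq using r_pos[of "lag0 b"] by simp
 qed
qed

lemma sqrt_rho_lg: "filterlim (\<lambda>b. sqrt (rho r b) * sqrt (lg b)) at_top (at_right 0)"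
 using filterlim_compose[OF sqrt_at_top rho_lg] by (simp add: real_sqrt_mult)

lemma ln_wlen: "((\<lambda>b. ln (real (wlen b)) / lg b) \<longlongrightarrow> 1) (at_right 0)"
proof (rule tendsto_sandwich)
 show "((\<lambda>b. ln (1 / (b * sqrt (lg b))) / lg b) \<longlongrightarrow> 1) (at_right 0)" by real_asymp
 show "((\<lambda>b. ln (1 / (b * sqrt (lg b)) + 1) / lg b) \<longlongrightarrow> 1) (at_right 0)" by real_asymp
 show "\<forall>\<^sub>F b in at_right 0. ln (1 / (b * sqrt (lg b))) / lg b \<le> ln (real (wlen b)) / lg b"
  using scale_bounds lg_ge[of 1] beta_pos by eventually_elim (intro divide_right_mono ln_mono, auto)
 show "\<forall>\<^sub>F b in at_right 0. ln (real (wlen b)) / lg b \<le> ln (1 / (b * sqrt (lg b)) + 1) / lg b"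
  using scale_bounds lg_ge[of 1] beta_pos by eventually_elim (intro divide_right_mono ln_mono, auto)
qed

lemma lg_le_2_ln_wlen: "\<forall>\<^sub>F b in at_right 0. lg b \<le> 2 * ln (real (wlen b))"
proof -
 have "\<forall>\<^sub>F b in at_right 0. 1 / 2 < ln (real (wlen b)) / lg b"
  by (rule order_tendstoD(1)[OF ln_wlen]) simp
 then show ?thesis using lg_ge[of 1] by eventually_elim (simp add: field_simps)
qed

text \<open>The two scales differ by a power of \<open>ln (1 / b)\<close>, so the quotient on the right is of order
 \<open>ln (ln (1 / b)) / ln (1 / b)\<close>.\<close>

lemma r_scales_diff_le:
 "\<forall>\<^sub>F b in at_right 0. r (wlen b) - r (2 * tlen b) \<le>
   rho r b * ((ln (4 * lg b / b + 2) - ln (1 / (b * sqrt (lg b)))) / ln (1 / (b * sqrt (lg b))))"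
proof -
 have "\<forall>\<^sub>F b in at_right 0. N0 \<le> wlen b" using wlen_at_top by (simp add: filterlim_at_top)
 moreover have "\<forall>\<^sub>F b::real in at_right 0. 0 < ln (1 / (b * sqrt (ln (1 / b))))" by real_asymp
 ultimately show ?thesis using scale_bounds beta_pos lg_ge[of 1]
 proof eventually_elim
  case (elim b)
  have lW: "ln (1 / (b * sqrt (lg b))) \<le> ln (real (wlen b))" using elim by (intro ln_mono) auto
  have lK: "ln (real (2 * tlen b)) \<le> ln (4 * lg b / b + 2)" using elim by (intro ln_mono) (auto simp: algebra_simps)
  have lWK: "ln (real (wlen b)) \<le> ln (real (2 * tlen b))" using elim by (intro ln_mono) auto
  have "r (wlen b) - r (2 * tlen b) \<le> r (2 * tlen b) * ((ln (real (2 * tlen b)) - ln (real (wlen b))) / ln (real (wlen b)))"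
   using elim by (intro r_diff_le) auto
  also have "\<dots> \<le> rho r b * ((ln (4 * lg b / b + 2) - ln (1 / (b * sqrt (lg b)))) / ln (1 / (b * sqrt (lg b))))"
  proof (rule mult_mono)
   show "r (2 * tlen b) \<le> rho r b" unfolding rho_eq using elim by (intro r_dec) auto
   show "(ln (real (2 * tlen b)) - ln (real (wlen b))) / ln (real (wlen b)) \<le>
    (ln (4 * lg b / b + 2) - ln (1 / (b * sqrt (lg b)))) / ln (1 / (b * sqrt (lg b)))"
    using lW lK lWK elim(2) by (intro frac_le) linarith+
   show "0 \<le> (ln (real (2 * tlen b)) - ln (real (wlen b))) / ln (real (wlen b))"
    using lW lWK elim(2) by (intro divide_nonneg_nonneg) linarith+
  qed (use rho_pos in \<open>auto intro: less_imp_le\<close>)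
  finally show ?case .
 qed
qed

lemma slack_nonneg: "\<forall>\<^sub>F b in at_right 0. 0 \<le> slack b"
 using scale_bounds
proof eventually_elim
 case (elim b)
 then have "r (2 * tlen b) \<le> r (wlen b)" by (intro r_dec) auto
 then show ?case unfolding slack_def using excess_nonneg[of "wlen b"] excess_nonneg[of "tlen b"] by linarith
qed

lemma excess_lg: 
 assumes "filterlim N at_top (at_right 0)" "\<forall>\<^sub>F b in at_right 0. lg b \<le> 2 * ln (real (N b))"
 shows "((\<lambda>b. excess (N b) * lg b) \<longlongrightarrow> 0) (at_right 0)"
proof (rule tendsto_sandwich[where f="\<lambda>_. 0"])
 show "((\<lambda>b. 2 * (excess (N b) * ln (real (N b)))) \<longlongrightarrow> 0) (at_right 0)"
  using tendsto_mult_right_zero[OF filterlim_compose[OF excess_ln_tendsto_0 assms(1)]] .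
 show "\<forall>\<^sub>F b in at_right 0. excess (N b) * lg b \<le> 2 * (excess (N b) * ln (real (N b)))"
  using assms(2)
 proof eventually_elim
  case (elim b)
  show ?case using mult_left_mono[OF elim excess_nonneg[of "N b"]] by (simp add: mult_ac)
 qed
 show "\<forall>\<^sub>F b in at_right 0. 0 \<le> excess (N b) * lg b"
  using lg_ge[of 0] by eventually_elim (use excess_nonneg in simp)
qed auto

text \<open>A variance error \<open>slack\<close> moves the maximum by about \<open>sqrt (lg b) * slack\<close>, which must be small against the
 fluctuation \<open>sqrt \<rho>\<close> of the common part. The drop of \<open>r\<close> contributes \<open>sqrt \<rho>\<close> times
 \<open>ln (lg b) / sqrt (lg b)\<close>, the centring errors contribute \<open>o(1) / sqrt (\<rho> * lg b)\<close>.\<close>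

lemma slack_negligible: "((\<lambda>b. sqrt (lg b) * slack b / sqrt (rho r b)) \<longlongrightarrow> 0) (at_right 0)"
proof (rule tendsto_sandwich[where f="\<lambda>_. 0"])
 let ?q = "\<lambda>b::real. (ln (4 * ln (1 / b) / b + 2) - ln (1 / (b * sqrt (ln (1 / b))))) / ln (1 / (b * sqrt (ln (1 / b))))"
 have q: "((\<lambda>b. sqrt (lg b) * ?q b) \<longlongrightarrow> 0) (at_right 0)" by real_asymp
 have eW: "((\<lambda>b. excess (wlen b) * lg b) \<longlongrightarrow> 0) (at_right 0)"
  by (intro excess_lg wlen_at_top lg_le_2_ln_wlen)
 have eK: "((\<lambda>b. excess (tlen b) * lg b) \<longlongrightarrow> 0) (at_right 0)"
 proof (intro excess_lg tlen_at_top)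
  show "\<forall>\<^sub>F b in at_right 0. lg b \<le> 2 * ln (real (tlen b))"
   using lg_le_2_ln_wlen scale_bounds
  proof eventually_elim
   case (elim b)
   then have "ln (real (wlen b)) \<le> ln (real (tlen b))" by (intro ln_mono) auto
   then show ?case using elim by linarith
  qed
 qed
 have inv: "((\<lambda>b. inverse (sqrt (rho r b) * sqrt (lg b))) \<longlongrightarrow> 0) (at_right 0)"
  by (rule tendsto_inverse_0_at_top[OF sqrt_rho_lg])
 have sr: "((\<lambda>b. sqrt (rho r b)) \<longlongrightarrow> 0) (at_right 0)"
  using tendsto_real_sqrt[OF rho_tendsto] by simp
 let ?b = "\<lambda>b. sqrt (rho r b) * (sqrt (lg b) * ?q b) + (2 * (excess (wlen b) * lg b) + 2 * (excess (tlen b) * lg b)) * inverse (sqrt (rho r b) * sqrt (lg b))"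
 have "(?b \<longlongrightarrow> 0 * 0 + (2 * 0 + 2 * 0) * 0) (at_right 0)"
  by (intro tendsto_intros sr q eW eK inv)
 then show "(?b \<longlongrightarrow> 0) (at_right 0)" by simp
 show "\<forall>\<^sub>F b in at_right 0. sqrt (lg b) * slack b / sqrt (rho r b) \<le> ?b b"
  using r_scales_diff_le lg_ge[of 1]
 proof eventually_elim
  case (elim b)
  define q where "q = ?q b"
  define s where "s = sqrt (rho r b)"
  define m where "m = sqrt (lg b)"
  have s: "s > 0" "s * s = rho r b" using rho_pos[of b] by (auto simp: s_def)
  have m: "m > 0" "m * m = lg b" using elim by (auto simp: m_def)
  have "slack b \<le> s * s * q + 2 * excess (wlen b) + 2 * excess (tlen b)"
   using elim(1) unfolding slack_def q_def s(2) by linarith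
  then have "m * slack b / s \<le> m * (s * s * q + 2 * excess (wlen b) + 2 * excess (tlen b)) / s"
   using m s by (intro divide_right_mono mult_left_mono) auto
  also have "\<dots> = s * (m * q) + (2 * (excess (wlen b) * (m * m)) + 2 * (excess (tlen b) * (m * m))) * inverse (s * m)"
   using m(1) s(1) by (simp add: field_simps)
  finally have fin: "m * slack b / s \<le> s * (m * q) + (2 * (excess (wlen b) * (m * m)) + 2 * (excess (tlen b) * (m * m))) * inverse (s * m)" .
  show ?case using fin unfolding m(2) unfolding s_def m_def q_def .
 qed
 show "\<forall>\<^sub>F b in at_right 0. 0 \<le> sqrt (lg b) * slack b / sqrt (rho r b)"
  using slack_nonneg lg_ge[of 0] by eventually_elim (use rho_pos in \<open>auto intro!: divide_nonneg_nonneg simp: less_imp_le\<close>)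
qed auto

lemma slack_rho: "((\<lambda>b. slack b / rho r b) \<longlongrightarrow> 0) (at_right 0)"
proof -
 have inv: "((\<lambda>b. inverse (sqrt (rho r b) * sqrt (lg b))) \<longlongrightarrow> 0) (at_right 0)"
  by (rule tendsto_inverse_0_at_top[OF sqrt_rho_lg])
 have "((\<lambda>b. sqrt (lg b) * slack b / sqrt (rho r b) * inverse (sqrt (rho r b) * sqrt (lg b))) \<longlongrightarrow> 0) (at_right 0)"
  using tendsto_mult_zero[OF slack_negligible inv] .
 moreover have "\<forall>\<^sub>F b in at_right 0. sqrt (lg b) * slack b / sqrt (rho r b) * inverse (sqrt (rho r b) * sqrt (lg b)) = slack b / rho r b"
  using lg_ge[of 1]
 proof eventually_elim
  case (elim b)
  have "sqrt (lg b) > 0" "sqrt (rho r b) > 0" using elim rho_pos[of b] by auto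
  then have "sqrt (lg b) * slack b / sqrt (rho r b) * inverse (sqrt (rho r b) * sqrt (lg b)) = slack b / (sqrt (rho r b) * sqrt (rho r b))"
   by (simp add: field_simps)
  then show ?case using rho_pos[of b] by simp
 qed
 ultimately show ?thesis by (rule Lim_transform_eventually)
qed

lemma slack_tendsto: "(slack \<longlongrightarrow> 0) (at_right 0)"
proof -
 have "((\<lambda>b. slack b / rho r b * rho r b) \<longlongrightarrow> 0) (at_right 0)"
  using tendsto_mult_zero[OF slack_rho rho_tendsto] .
 then show ?thesis using rho_pos by (simp add: less_imp_neq[THEN not_sym])
qed

section \<open>The centring amplitude\<close>

lemma one_minus_rho: "((\<lambda>b. sqrt (1 - rho r b)) \<longlongrightarrow> 1) (at_right 0)"
proof -
 have "((\<lambda>b. sqrt (1 - rho r b)) \<longlongrightarrow> sqrt (1 - 0)) (at_right 0)"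
  by (intro tendsto_intros rho_tendsto)
 then show ?thesis by simp
qed

definition log_scale :: "real \<Rightarrow> real" where "log_scale b = ln (1 / (b / sqrt (1 - rho r b)))"

lemma log_scale_eq: "\<forall>\<^sub>F b in at_right 0. log_scale b = lg b + ln (sqrt (1 - rho r b))"
proof -
 have "\<forall>\<^sub>F b in at_right 0. sqrt (1 - rho r b) > 1 / 2"
  by (rule order_tendstoD(1)[OF one_minus_rho]) simp
 then show ?thesis using beta_pos
 proof eventually_elim
  case (elim b)
  then have "0 < sqrt (1 - rho r b)" by linarith
  then have "rho r b < 1" by simp
  then have "ln (1 / b * sqrt (1 - rho r b)) = lg b + ln (sqrt (1 - rho r b))"
   using elim by (intro ln_mult_pos) auto
  then show ?case by (simp add: log_scale_def)
 qed
qed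

lemma log_scale_lg: "((\<lambda>b. log_scale b / lg b) \<longlongrightarrow> 1) (at_right 0)"
proof -
 have "((\<lambda>b. 1 + ln (sqrt (1 - rho r b)) / lg b) \<longlongrightarrow> 1 + 0) (at_right 0)"
  using tendsto_ln[OF one_minus_rho] by (intro tendsto_intros real_tendsto_divide_at_top[OF _ lg_at_top]) auto
 moreover have "\<forall>\<^sub>F b in at_right 0. 1 + ln (sqrt (1 - rho r b)) / lg b = log_scale b / lg b"
  using log_scale_eq lg_ge[of 1] by eventually_elim (simp add: field_simps)
 ultimately show ?thesis using Lim_transform_eventually by force
qed

lemma log_scale_at_top: "filterlim log_scale at_top (at_right 0)"
proof -
 have "filterlim (\<lambda>b. log_scale b / lg b * lg b) at_top (at_right 0)"
  by (rule filterlim_tendsto_pos_mult_at_top[OF log_scale_lg _ lg_at_top]) simp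
 moreover have "\<forall>\<^sub>F b in at_right 0. log_scale b / lg b * lg b = log_scale b"
  using lg_ge[of 1] by eventually_elim simp
 ultimately show ?thesis by (simp add: filterlim_cong)
qed

lemma amp_sq:
 "\<forall>\<^sub>F b in at_right 0. 0 \<le> amp b \<and>
   (amp b)\<^sup>2 = 2 * (log_scale b - ln (2 * log_scale b) + ln ((2 * pi) powr (- 1 / 2)))"
proof -
 have "filterlim (\<lambda>y::real. y - ln (2 * y) + ln ((2 * pi) powr (- 1 / 2))) at_top at_top"
  by real_asymp
 then have "filterlim (\<lambda>b. log_scale b - ln (2 * log_scale b) + ln ((2 * pi) powr (- 1 / 2))) at_top (at_right 0)"
  by (rule filterlim_compose[OF _ log_scale_at_top])
 then have "\<forall>\<^sub>F b in at_right 0. 0 \<le> log_scale b - ln (2 * log_scale b) + ln ((2 * pi) powr (- 1 / 2))"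
  unfolding filterlim_at_top by (rule spec)
 then show ?thesis by eventually_elim (simp add: amp_def a_fun_def log_scale_def)
qed

lemma amp_sq_lg: "((\<lambda>b. (amp b)\<^sup>2 / lg b) \<longlongrightarrow> 2) (at_right 0)"
proof -
 have "((\<lambda>y::real. 2 * (y - ln (2 * y) + ln ((2 * pi) powr (- 1 / 2))) / y) \<longlongrightarrow> 2) at_top"
  by real_asymp
 then have "((\<lambda>b. 2 * (log_scale b - ln (2 * log_scale b) + ln ((2 * pi) powr (- 1 / 2))) / log_scale b) \<longlongrightarrow> 2) (at_right 0)"
  by (rule filterlim_compose[OF _ log_scale_at_top])
 then have "((\<lambda>b. 2 * (log_scale b - ln (2 * log_scale b) + ln ((2 * pi) powr (- 1 / 2))) / log_scale b * (log_scale b / lg b)) \<longlongrightarrow> 2 * 1) (at_right 0)"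
  by (intro tendsto_mult log_scale_lg)
 moreover have "\<forall>\<^sub>F b in at_right 0. log_scale b \<ge> 1" using log_scale_at_top by (simp add: filterlim_at_top)
 then have "\<forall>\<^sub>F b in at_right 0. 2 * (log_scale b - ln (2 * log_scale b) + ln ((2 * pi) powr (- 1 / 2))) / log_scale b * (log_scale b / lg b) = (amp b)\<^sup>2 / lg b"
  using amp_sq by eventually_elim simp
 ultimately show ?thesis using Lim_transform_eventually by force
qed

lemma amp_bounds: "\<forall>\<^sub>F b in at_right 0. sqrt (lg b) \<le> amp b \<and> amp b \<le> 2 * sqrt (lg b)"
proof -
 have "\<forall>\<^sub>F b in at_right 0. 1 < (amp b)\<^sup>2 / lg b" "\<forall>\<^sub>F b in at_right 0. (amp b)\<^sup>2 / lg b < 4"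
  by (rule order_tendstoD[OF amp_sq_lg]; simp)+
 then show ?thesis using lg_ge[of 1] amp_sq[unfolded eventually_conj_iff, THEN conjunct1]
 proof eventually_elim
  case (elim b)
  then have "lg b \<le> (amp b)\<^sup>2" "(amp b)\<^sup>2 \<le> 4 * lg b" by (auto simp: field_simps)
  then have "sqrt (lg b) \<le> sqrt ((amp b)\<^sup>2)" "sqrt ((amp b)\<^sup>2) \<le> sqrt (4 * lg b)" by (auto intro: real_sqrt_le_mono simp del: real_sqrt_abs real_sqrt_pow2_iff)
  then show ?case using elim by (simp add: real_sqrt_mult)
 qed
qed

text \<open>By the choice of \<open>a_fun\<close> the left-hand exponential is asymptotic to \<open>2 * sqrt (2 * pi) * b * lg b\<close>;
 1 and 20 are crude bounds for the constant.\<close>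

lemma exp_amp: "\<forall>\<^sub>F b in at_right 0. b * lg b \<le> exp (- ((amp b)\<^sup>2) / 2) \<and> exp (- ((amp b)\<^sup>2) / 2) \<le> 20 * (b * lg b)"
proof -
 define c where "c = sqrt (2 * pi)"
 have c: "c > 0" "1 < 2 * c" "2 * c < 10"
 proof -
  have "sqrt (2 * pi) < sqrt (3^2)" by (rule real_sqrt_less_mono) (use pi_less_4 in simp)
  moreover have "1 < sqrt (2 * pi)" by (rule real_less_rsqrt) (use pi_ge_two in simp)
  moreover have "sqrt (3^2) = (3::real)" by simp
  ultimately show "c > 0" "1 < 2 * c" "2 * c < 10" unfolding c_def by linarith+
 qed
 have "((\<lambda>b. 2 * c * (log_scale b / lg b) / sqrt (1 - rho r b)) \<longlongrightarrow> 2 * c * 1 / 1) (at_right 0)"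
  by (intro tendsto_intros log_scale_lg one_minus_rho) auto
 then have lim: "((\<lambda>b. 2 * c * (log_scale b / lg b) / sqrt (1 - rho r b)) \<longlongrightarrow> 2 * c) (at_right 0)" by simp
 have "\<forall>\<^sub>F b in at_right 0. log_scale b \<ge> 1" using log_scale_at_top by (simp add: filterlim_at_top)
 moreover have "\<forall>\<^sub>F b in at_right 0. sqrt (1 - rho r b) > 1 / 2"
  by (rule order_tendstoD(1)[OF one_minus_rho]) simp
 ultimately show ?thesis
  using amp_sq order_tendstoD(1)[OF lim c(2)] order_tendstoD(2)[OF lim c(3)] lg_ge[of 1] beta_pos
 proof eventually_elim
  case (elim b)
  define s where "s = sqrt (1 - rho r b)"
  have s: "s > 0" unfolding s_def using elim by linarith
  have "- ((amp b)\<^sup>2) / 2 = - log_scale b + ln (2 * log_scale b) - ln ((2 * pi) powr (- 1 / 2))"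
   using elim by simp
  also have "ln ((2 * pi) powr (- 1 / 2)) = - ln c"
   by (simp add: c_def ln_powr ln_sqrt)
  finally have "exp (- ((amp b)\<^sup>2) / 2) = exp (- log_scale b) * exp (ln (2 * log_scale b)) * exp (ln c)"
   by (simp add: exp_add[symmetric])
  also have "exp (- log_scale b) = b / s"
   using elim s by (simp add: log_scale_def s_def[symmetric] exp_minus)
  also have "b / s * exp (ln (2 * log_scale b)) * exp (ln c) = (2 * c * (log_scale b / lg b) / s) * (b * lg b)"
   using elim c s by simp
  finally have eq: "exp (- ((amp b)\<^sup>2) / 2) = (2 * c * (log_scale b / lg b) / s) * (b * lg b)" .
  have pos: "0 \<le> b * lg b" using elim by simp
  have lo: "1 \<le> 2 * c * (log_scale b / lg b) / s" and hi: "2 * c * (log_scale b / lg b) / s \<le> 20"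
   using elim by (auto simp: s_def)
  show ?case unfolding eq using mult_right_mono[OF lo pos] mult_right_mono[OF hi pos] by simp
 qed
qed

text \<open>The form of \<open>slack_negligible\<close> in which a variance error is compared with a shift of the level by a multiple of
 \<open>sqrt \<rho>\<close>.\<close>

lemma amp_slack_le:
 assumes "\<epsilon> > 0"
 shows "\<forall>\<^sub>F b in at_right 0. slack b * amp b \<le> \<epsilon> * sqrt (rho r b)"
proof -
 have "\<forall>\<^sub>F b in at_right 0. sqrt (lg b) * slack b / sqrt (rho r b) < \<epsilon> / 2"
  using assms by (intro order_tendstoD(2)[OF slack_negligible]) auto
 then show ?thesis using amp_bounds slack_nonneg
 proof eventually_elim
  case (elim b)
  have sr: "sqrt (rho r b) > 0" using rho_pos[of b] by simp
  have "slack b * amp b \<le> slack b * (2 * sqrt (lg b))" using elim by (intro mult_left_mono) auto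
  also have "\<dots> = 2 * (sqrt (lg b) * slack b)" by simp
  also have "\<dots> \<le> 2 * (\<epsilon> / 2 * sqrt (rho r b))"
   using elim(1) sr by (intro mult_left_mono) (auto simp: divide_less_eq)
  finally show ?case by simp
 qed
qed

text \<open>The height of the boundary at the index \<open>u_fun r b 0\<close>.\<close>

definition centre :: "real \<Rightarrow> real" where "centre b = sqrt (1 - rho r b) * amp b"

lemma u_fun_eq: "u_fun r b x = (centre b + sqrt (rho r b) * x) / b"
 by (simp add: u_fun_def centre_def amp_def)

lemma u_fun_mult: "0 < b \<Longrightarrow> b * u_fun r b x = centre b + sqrt (rho r b) * x"
 by (simp add: u_fun_eq)

lemma eventual_bounds:
 "\<forall>\<^sub>F b in at_right 0. 1 / 2 \<le> sqrt (1 - rho r b) \<and> rho r b < 1 \<and> 0 < b \<and> b < 1 \<and> 1 \<le> lg b \<and>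
  sqrt (lg b) \<le> amp b \<and> amp b \<le> 2 * sqrt (lg b) \<and> 0 \<le> slack b \<and>
  b * lg b \<le> exp (- ((amp b)\<^sup>2) / 2) \<and> exp (- ((amp b)\<^sup>2) / 2) \<le> 20 * (b * lg b)"
proof -
 have "\<forall>\<^sub>F b in at_right 0. 1 / 2 < sqrt (1 - rho r b)"
  by (rule order_tendstoD(1)[OF one_minus_rho]) simp
 moreover have "\<forall>\<^sub>F b in at_right 0. rho r b < 1"
  by (rule order_tendstoD(2)[OF rho_tendsto]) simp
 ultimately show ?thesis using beta_pos lg_ge[of 1] amp_bounds slack_nonneg exp_amp
  by eventually_elim auto
qed

lemma u_fun_nonneg: "\<forall>\<^sub>F b in at_right 0. 0 \<le> u_fun r b x"
 using eventual_bounds lg_ge[of "(2 * \<bar>x\<bar>)\<^sup>2"]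
proof eventually_elim
 case (elim b)
 have "2 * \<bar>x\<bar> \<le> sqrt (lg b)" using elim by (intro real_le_rsqrt)
 moreover have "1 / 2 * sqrt (lg b) \<le> centre b" unfolding centre_def using elim by (intro mult_mono) auto
 moreover have "\<bar>sqrt (rho r b) * x\<bar> \<le> 1 * \<bar>x\<bar>" unfolding abs_mult using elim rho_pos[of b] by (intro mult_right_mono) auto
 ultimately have "0 \<le> centre b + sqrt (rho r b) * x" by argo
 then show ?case unfolding u_fun_eq using elim by (intro divide_nonneg_nonneg) auto
qed

lemma Phi_scaled_tendsto:
 assumes "\<forall>\<^sub>F b in at_right 0. \<bar>\<sigma>2 b - rho r b\<bar> \<le> slack b"
 shows "((\<lambda>b. Phi (sqrt (rho r b) * c / sqrt (\<sigma>2 b))) \<longlongrightarrow> Phi c) (at_right 0)"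
proof -
 have "((\<lambda>b. \<sigma>2 b / rho r b - 1) \<longlongrightarrow> 0) (at_right 0)"
 proof (rule Lim_null_comparison[OF _ slack_rho])
  show "\<forall>\<^sub>F b in at_right 0. norm (\<sigma>2 b / rho r b - 1) \<le> slack b / rho r b"
   using assms
  proof eventually_elim
   case (elim b)
   have "\<sigma>2 b / rho r b - 1 = (\<sigma>2 b - rho r b) / rho r b" using rho_pos[of b] by (simp add: field_simps)
   then show ?case using elim rho_pos[of b] by (simp add: abs_divide divide_right_mono)
  qed
 qed
 then have "((\<lambda>b. \<sigma>2 b / rho r b) \<longlongrightarrow> 1) (at_right 0)" using Lim_null[of _ 1] by blast
 then have "((\<lambda>b. c / sqrt (\<sigma>2 b / rho r b)) \<longlongrightarrow> c / sqrt 1) (at_right 0)"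
  by (intro tendsto_intros) auto
 then have "((\<lambda>b. sqrt (rho r b) * c / sqrt (\<sigma>2 b)) \<longlongrightarrow> c) (at_right 0)"
  by (simp add: real_sqrt_divide mult.commute)
 then show ?thesis by (rule isCont_tendsto_compose[OF isCont_Phi])
qed

text \<open>This is the value of the union bound for residuals of variance at most \<open>V\<close> above the boundary with initial height
 \<open>T\<close> and slope \<open>b\<close>, counted on both sides of the axis. At height \<open>centre b\<close> and variance
 \<open>1 - rho r b\<close> it would be bounded; raising the boundary by \<open>\<epsilon> * sqrt \<rho>\<close> multiplies it by
 \<open>exp (- c * \<epsilon> * sqrt (\<rho> * lg b))\<close> for some \<open>c > 0\<close>.\<close>

lemma near_sum_tendsto:
 assumes \<epsilon>: "\<epsilon> > 0"
 defines "T \<equiv> \<lambda>b. centre b + \<epsilon> * sqrt (rho r b)" and "V \<equiv> \<lambda>b. 1 - rho r b + 2 * slack b"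
 shows "((\<lambda>b. 2 * (sqrt (V b) / T b * exp (- ((T b)\<^sup>2) / (2 * V b))) * (1 + 1 / (T b * b / V b))) \<longlongrightarrow> 0) (at_right 0)"
  and "\<forall>\<^sub>F b in at_right 0. 0 < V b \<and> 0 < T b"
proof -
 have V1: "(V \<longlongrightarrow> 1) (at_right 0)"
 proof -
  have "(V \<longlongrightarrow> 1 - 0 + 2 * 0) (at_right 0)"
   unfolding V_def by (intro tendsto_intros rho_tendsto slack_tendsto)
  then show ?thesis by simp
 qed
 have V: "\<forall>\<^sub>F b in at_right 0. 0 < V b \<and> V b < 2"
  using order_tendstoD(1)[OF V1, of 0] order_tendstoD(2)[OF V1, of 2] by (simp add: eventually_conj)
 have Tlow: "\<forall>\<^sub>F b in at_right 0. sqrt (lg b) / 2 \<le> T b"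
  using eventual_bounds
 proof eventually_elim
  case (elim b)
  have "1 / 2 * sqrt (lg b) \<le> sqrt (1 - rho r b) * amp b" using elim by (intro mult_mono) auto
  moreover have "0 \<le> \<epsilon> * sqrt (rho r b)" using \<epsilon> rho_pos[of b] by simp
  ultimately show ?case by (simp add: T_def centre_def)
 qed
 show "\<forall>\<^sub>F b in at_right 0. 0 < V b \<and> 0 < T b"
  using V Tlow lg_ge[of 1]
 proof eventually_elim
  case (elim b)
  then have "0 < sqrt (lg b)" by simp
  then show ?case using elim by linarith
 qed
 let ?b = "\<lambda>b. 160 * (exp (- (\<epsilon> / 8) * (sqrt (rho r b) * sqrt (lg b))) * (b * sqrt (lg b) + 4))"
 show "((\<lambda>b. 2 * (sqrt (V b) / T b * exp (- ((T b)\<^sup>2) / (2 * V b))) * (1 + 1 / (T b * b / V b))) \<longlongrightarrow> 0) (at_right 0)"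
 proof (rule tendsto_sandwich[where f="\<lambda>_. 0"])
  show "\<forall>\<^sub>F b in at_right 0. 0 \<le> 2 * (sqrt (V b) / T b * exp (- ((T b)\<^sup>2) / (2 * V b))) * (1 + 1 / (T b * b / V b))"
   using V Tlow eventual_bounds
  proof eventually_elim
   case (elim b)
   have "0 \<le> sqrt (lg b)" using elim by auto
   then have "0 \<le> T b" using elim by linarith
   then show ?case using elim by (intro mult_nonneg_nonneg add_nonneg_nonneg divide_nonneg_nonneg) auto
  qed
  show "\<forall>\<^sub>F b in at_right 0. 2 * (sqrt (V b) / T b * exp (- ((T b)\<^sup>2) / (2 * V b))) * (1 + 1 / (T b * b / V b)) \<le> ?b b"
   using V Tlow eventual_bounds amp_slack_le[of "\<epsilon> / 4", simplified, OF \<epsilon>]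
  proof eventually_elim
   case (elim b)
   define s where "s = sqrt (1 - rho r b)"
   define q where "q = sqrt (rho r b)"
   define a where "a = amp b"
   define m where "m = sqrt (lg b)"
   define D where "D = slack b"
   have s: "1 / 2 \<le> s" "s * s = 1 - rho r b" using elim by (auto simp: s_def)
   have q: "q > 0" using rho_pos[of b] by (simp add: q_def)
   have m: "m \<ge> 1" "m * m = lg b" using elim by (auto simp: m_def)
   have a: "m \<le> a" "a \<le> 2 * m" using elim by (auto simp: a_def m_def)
   have Da: "D * a \<le> \<epsilon> / 4 * q" using elim by (simp add: D_def a_def q_def)
   have T: "T b = s * a + \<epsilon> * q" by (simp add: T_def centre_def s_def a_def q_def)
   have Tm: "m / 2 \<le> T b" using elim by (simp add: m_def)
   have Tpos: "T b > 0" using Tm m by linarith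
   have Vs: "V b = s * s + 2 * D" by (simp add: V_def s D_def)
   \<comment> \<open>The shift \<open>\<epsilon> * q\<close> of the threshold beats the variance error \<open>D\<close>, because \<open>D * a\<close> is small against \<open>q\<close>.\<close>
   have "(\<epsilon> / 2) * (q * m) \<le> (\<epsilon> / 2) * (q * a)" using a q \<epsilon> by (intro mult_left_mono) auto
   also have "\<dots> = 2 * \<epsilon> * q * (1 / 2) * a - 2 * a * (\<epsilon> / 4 * q)" by (simp add: field_simps)
   also have "\<dots> \<le> 2 * \<epsilon> * q * s * a - 2 * a * (D * a)"
    using s q \<epsilon> Da a m by (intro diff_mono mult_left_mono mult_right_mono) auto
   also have "\<dots> \<le> (T b)\<^sup>2 - V b * a\<^sup>2"
    using q \<epsilon> unfolding T Vs by (simp add: power2_eq_square algebra_simps)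
   finally have gap: "(\<epsilon> / 2) * (q * m) \<le> (T b)\<^sup>2 - V b * a\<^sup>2" .
   have "\<epsilon> / 8 * (q * m) = (\<epsilon> / 2) * (q * m) / (2 * 2)" by simp
   also have "\<dots> \<le> (\<epsilon> / 2) * (q * m) / (2 * V b)"
    using elim q m \<epsilon> by (intro divide_left_mono) auto
   also have "\<dots> \<le> ((T b)\<^sup>2 - V b * a\<^sup>2) / (2 * V b)"
    using gap elim by (intro divide_right_mono) auto
   also have "\<dots> = (T b)\<^sup>2 / (2 * V b) - a\<^sup>2 / 2"
    using elim by (simp add: diff_divide_distrib)
   finally have "- ((T b)\<^sup>2) / (2 * V b) \<le> - (a\<^sup>2) / 2 + - (\<epsilon> / 8) * (q * m)" by simp
   then have "exp (- ((T b)\<^sup>2) / (2 * V b)) \<le> exp (- (a\<^sup>2) / 2) * exp (- (\<epsilon> / 8) * (q * m))"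
    by (simp only: exp_add[symmetric] exp_le_cancel_iff)
   also have "\<dots> \<le> 20 * (b * (m * m)) * exp (- (\<epsilon> / 8) * (q * m))"
    using elim unfolding m a_def by (intro mult_right_mono) auto
   finally have e: "exp (- ((T b)\<^sup>2) / (2 * V b)) \<le> 20 * (b * (m * m)) * exp (- (\<epsilon> / 8) * (q * m))" .
   have "sqrt (V b) \<le> sqrt (2\<^sup>2)" using elim by (intro real_sqrt_le_mono) simp
   then have sV: "sqrt (V b) \<le> 2" by simp
   have c1: "sqrt (V b) / T b \<le> 2 / (m / 2)"
    using sV Tm m elim by (intro frac_le) auto
   have c2: "1 / (T b * b / V b) \<le> 1 / (m / 2 * b / 2)"
    using elim Tm m by (intro divide_left_mono frac_le mult_right_mono mult_pos_pos divide_pos_pos) auto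
   have "2 * (sqrt (V b) / T b * exp (- ((T b)\<^sup>2) / (2 * V b))) * (1 + 1 / (T b * b / V b))
    \<le> 2 * (2 / (m / 2) * (20 * (b * (m * m)) * exp (- (\<epsilon> / 8) * (q * m)))) * (1 + 1 / (m / 2 * b / 2))"
    using c1 c2 e elim Tpos m
    by (intro mult_mono add_left_mono) (auto intro!: divide_nonneg_nonneg mult_nonneg_nonneg add_nonneg_nonneg)
   also have "\<dots> = 160 * (exp (- (\<epsilon> / 8) * (q * m)) * (b * m + 4))"
    using m elim by (simp add: field_simps)
   finally show ?case by (simp only: q_def m_def)
  qed
  have "filterlim (\<lambda>b. (\<epsilon> / 8) * (sqrt (rho r b) * sqrt (lg b))) at_top (at_right 0)"
   using \<epsilon> by (intro filterlim_tendsto_pos_mult_at_top[OF tendsto_const _ sqrt_rho_lg]) simp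
  then have "((\<lambda>b. exp (- ((\<epsilon> / 8) * (sqrt (rho r b) * sqrt (lg b))))) \<longlongrightarrow> 0) (at_right 0)"
   by (intro filterlim_compose[OF exp_at_bot] filterlim_compose[OF filterlim_uminus_at_bot_at_top])
  moreover have "((\<lambda>b::real. b * sqrt (ln (1 / b)) + 4) \<longlongrightarrow> 4) (at_right 0)" by real_asymp
  ultimately have "((\<lambda>b. 160 * (exp (- ((\<epsilon> / 8) * (sqrt (rho r b) * sqrt (lg b)))) * (b * sqrt (lg b) + 4))) \<longlongrightarrow> 160 * (0 * 4)) (at_right 0)"
   by (intro tendsto_intros)
  then show "(?b \<longlongrightarrow> 0) (at_right 0)" by simp
 qed auto
qed

section \<open>The level of the second-moment argument\<close>

text \<open>The residuals normalised by the lower bound of their standard deviation are compared with this level, which is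
 slightly below the typical maximum.\<close>

definition level :: "real \<Rightarrow> real \<Rightarrow> real" where
 "level \<epsilon> b = (centre b - \<epsilon> / 2 * sqrt (rho r b)) / sqrt (resid_var (wlen b))"

lemma resid_var_wlen: "\<forall>\<^sub>F b in at_right 0. 1 / 4 \<le> resid_var (wlen b) \<and> resid_var (wlen b) \<le> 1 \<and>
  1 - rho r b - slack b \<le> resid_var (wlen b)"
proof -
 have "\<forall>\<^sub>F b in at_right 0. 1 / 4 < resid_var (wlen b)"
  by (rule order_tendstoD(1)[OF filterlim_compose[OF resid_var_tendsto wlen_at_top]]) simp
 then show ?thesis using scale_bounds
 proof eventually_elim
  case (elim b)
  have "r (2 * tlen b) \<le> rho r b" unfolding rho_eq using elim by (intro r_dec) auto
  then show ?case
   using elim r_pos[of "wlen b"] excess_nonneg[of "wlen b"] excess_nonneg[of "tlen b"]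
   unfolding resid_var_def slack_def by linarith
 qed
qed

lemma resid_corr_1_less: "\<forall>\<^sub>F b in at_right 0. resid_corr (wlen b) 1 < 1"
 by (rule eventually_compose_filterlim[OF order_tendstoD(2)[OF resid_corr_1_tendsto r1] wlen_at_top])

lemma level_ge_1:
 assumes "\<epsilon> > 0"
 shows "\<forall>\<^sub>F b in at_right 0. 1 \<le> level \<epsilon> b \<and> 0 \<le> centre b - \<epsilon> / 2 * sqrt (rho r b)"
 using eventual_bounds lg_ge[of "(2 * (1 + \<epsilon> / 2))\<^sup>2"] resid_var_wlen
proof eventually_elim
 case (elim b)
 have "2 * (1 + \<epsilon> / 2) \<le> sqrt (lg b)" using elim by (intro real_le_rsqrt)
 moreover have "1 / 2 * sqrt (lg b) \<le> centre b" unfolding centre_def using elim by (intro mult_mono) auto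
 moreover have "\<epsilon> / 2 * sqrt (rho r b) \<le> \<epsilon> / 2 * 1" using assms elim by (intro mult_left_mono) auto
 ultimately have T: "1 \<le> centre b - \<epsilon> / 2 * sqrt (rho r b)" by argo
 have "0 < resid_var (wlen b)" using elim by linarith
 then have "0 < sqrt (resid_var (wlen b))" "sqrt (resid_var (wlen b)) \<le> 1" using elim by auto
 then have "1 \<le> level \<epsilon> b" unfolding level_def using T by (simp only: le_divide_eq_1_pos)
 then show ?case using T by linarith
qed

lemma level_le: 
 assumes "\<epsilon> > 0"
 shows "\<forall>\<^sub>F b in at_right 0. level \<epsilon> b \<le> centre b / sqrt (resid_var (wlen b))"
 using resid_var_wlen
proof eventually_elim
 case (elim b)
 have "0 \<le> \<epsilon> / 2 * sqrt (rho r b)" using assms rho_pos[of b] by simp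
 then show ?case unfolding level_def using elim by (intro divide_right_mono) auto
qed

text \<open>Both \<open>(level \<epsilon> b)\<^sup>2\<close> and \<open>2 * ln (wlen b)\<close> are asymptotic to \<open>2 * lg b\<close>.\<close>

lemma level_sq_le:
 assumes \<epsilon>: "\<epsilon> > 0" and \<zeta>: "\<zeta> > 0"
 shows "\<forall>\<^sub>F b in at_right 0. (level \<epsilon> b + 1)\<^sup>2 \<le> (2 + \<zeta>) * ln (real (wlen b))"
proof -
 have v: "((\<lambda>b. sqrt (resid_var (wlen b))) \<longlongrightarrow> 1) (at_right 0)"
  using tendsto_real_sqrt[OF filterlim_compose[OF resid_var_tendsto wlen_at_top]] by simp
 have a: "((\<lambda>b. sqrt ((amp b)\<^sup>2 / lg b)) \<longlongrightarrow> sqrt 2) (at_right 0)"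
  by (rule tendsto_real_sqrt[OF amp_sq_lg])
 have l: "((\<lambda>b::real. 1 / sqrt (ln (1 / b))) \<longlongrightarrow> 0) (at_right 0)" by real_asymp
 have "((\<lambda>b. (sqrt (1 - rho r b) * sqrt ((amp b)\<^sup>2 / lg b) / sqrt (resid_var (wlen b)) + 1 / sqrt (lg b))\<^sup>2)
  \<longlongrightarrow> (1 * sqrt 2 / 1 + 0)\<^sup>2) (at_right 0)"
  by (intro tendsto_intros one_minus_rho a v l) auto
 then have "\<forall>\<^sub>F b in at_right 0. (sqrt (1 - rho r b) * sqrt ((amp b)\<^sup>2 / lg b) / sqrt (resid_var (wlen b)) + 1 / sqrt (lg b))\<^sup>2 < 2 + \<zeta> / 2"
  by (rule order_tendstoD(2)) (use \<zeta> in simp)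
 moreover have "((\<lambda>b. (2 + \<zeta>) * (ln (real (wlen b)) / lg b)) \<longlongrightarrow> (2 + \<zeta>) * 1) (at_right 0)"
  by (intro tendsto_intros ln_wlen)
 then have "\<forall>\<^sub>F b in at_right 0. 2 + \<zeta> / 2 < (2 + \<zeta>) * (ln (real (wlen b)) / lg b)"
  by (rule order_tendstoD(1)) (use \<zeta> in simp)
 ultimately show ?thesis using eventual_bounds level_le[OF \<epsilon>] level_ge_1[OF \<epsilon>] resid_var_wlen
 proof eventually_elim
  case (elim b)
  define m where "m = sqrt (lg b)"
  have m: "m > 0" "m * m = lg b" using elim by (auto simp: m_def)
  have am: "sqrt ((amp b)\<^sup>2 / lg b) = amp b / m"
   using elim m by (simp add: real_sqrt_divide m_def)
  have le: "(sqrt (1 - rho r b) * (amp b / m) / sqrt (resid_var (wlen b)) + 1 / m)\<^sup>2 \<le> (2 + \<zeta>) * (ln (real (wlen b)) / lg b)"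
   using elim(1,2) unfolding am m_def[symmetric] by linarith
  have "(level \<epsilon> b + 1)\<^sup>2 \<le> (centre b / sqrt (resid_var (wlen b)) + 1)\<^sup>2"
   using elim by (intro power_mono) auto
  also have "centre b / sqrt (resid_var (wlen b)) + 1 = (sqrt (1 - rho r b) * (amp b / m) / sqrt (resid_var (wlen b)) + 1 / m) * m"
   using m by (simp add: centre_def distrib_right)
  also have "\<dots>\<^sup>2 = (sqrt (1 - rho r b) * (amp b / m) / sqrt (resid_var (wlen b)) + 1 / m)\<^sup>2 * lg b"
   unfolding power_mult_distrib using m by (simp add: power2_eq_square)
  also have "\<dots> \<le> ((2 + \<zeta>) * (ln (real (wlen b)) / lg b)) * lg b"
   using elim le by (intro mult_right_mono) auto
  also have "\<dots> = (2 + \<zeta>) * ln (real (wlen b))" using elim by simp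
  finally show ?case .
 qed
qed

text \<open>At the amplitude \<open>amp b\<close> the expected number of exceedances in the window is bounded away from 0, and
 lowering the level by the order of \<open>sqrt \<rho>\<close> multiplies this lower bound by \<open>exp (\<epsilon> / 16 * sqrt (\<rho> * lg b))\<close>.\<close>

lemma expected_count_at_top:
 assumes \<epsilon>: "\<epsilon> > 0"
 shows "filterlim (\<lambda>b. real (wlen b) * measure std_normal_distribution {level \<epsilon> b<..level \<epsilon> b + 1}) at_top (at_right 0)"
proof (rule filterlim_at_top_mono)
 define c where "c = exp (- 3 / 2) / sqrt (2 * pi)"
 have c: "c > 0" by (simp add: c_def)
 have "filterlim (\<lambda>b. (\<epsilon> / 16) * (sqrt (rho r b) * sqrt (lg b))) at_top (at_right 0)"
  using \<epsilon> by (intro filterlim_tendsto_pos_mult_at_top[OF tendsto_const _ sqrt_rho_lg]) simp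
 then show "filterlim (\<lambda>b. c / 4 * exp ((\<epsilon> / 16) * (sqrt (rho r b) * sqrt (lg b)))) at_top (at_right 0)"
  using c by (intro filterlim_tendsto_pos_mult_at_top[OF tendsto_const _ filterlim_compose[OF exp_at_top]]) auto
 show "\<forall>\<^sub>F b in at_right 0. c / 4 * exp ((\<epsilon> / 16) * (sqrt (rho r b) * sqrt (lg b)))
   \<le> real (wlen b) * measure std_normal_distribution {level \<epsilon> b<..level \<epsilon> b + 1}"
  using eventual_bounds level_le[OF \<epsilon>] level_ge_1[OF \<epsilon>] resid_var_wlen amp_slack_le[of "\<epsilon> / 8", simplified, OF \<epsilon>] scale_bounds
 proof eventually_elim
  case (elim b)
  define s where "s = sqrt (1 - rho r b)"
  define q where "q = sqrt (rho r b)"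
  define a where "a = amp b"
  define m where "m = sqrt (lg b)"
  define D where "D = slack b"
  define v where "v = resid_var (wlen b)"
  define t where "t = level \<epsilon> b"
  define T where "T = centre b - \<epsilon> / 2 * q"
  have s: "1 / 2 \<le> s" "s * s = 1 - rho r b" "s \<le> 1" using elim rho_pos[of b] by (auto simp: s_def)
  have q: "q > 0" using rho_pos[of b] by (simp add: q_def)
  have m: "m \<ge> 1" "m * m = lg b" using elim by (auto simp: m_def)
  have a: "m \<le> a" "a \<le> 2 * m" using elim by (auto simp: a_def m_def)
  have Da: "D * a \<le> \<epsilon> / 8 * q" using elim by (simp add: D_def a_def q_def)
  have v: "1 / 4 \<le> v" "v \<le> 1" "s * s - D \<le> v" using elim by (auto simp: v_def D_def s)
  have cs: "centre b = s * a" by (simp add: centre_def s_def a_def)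
  have T: "0 \<le> T" using elim by (simp add: T_def q_def)
  have TB: "T \<le> s * a" using q \<epsilon> by (simp add: T_def cs)
  have t: "1 \<le> t" "t = T / sqrt v" using elim by (auto simp: t_def level_def T_def q_def v_def)
  have sv: "1 / 2 \<le> sqrt v" using v by (intro real_le_rsqrt) (simp add: power2_eq_square)
  have t4: "t \<le> 4 * m"
  proof -
   have "t \<le> (s * a) / sqrt v" unfolding t using TB v by (intro divide_right_mono) auto
   also have "\<dots> \<le> (1 * (2 * m)) / (1 / 2)" using s a m sv by (intro frac_le mult_mono) auto
   finally show ?thesis by simp
  qed
  \<comment> \<open>Lowering the level by \<open>\<epsilon> / 2 * q\<close> gains more than the loss \<open>D * a\<^sup>2\<close> in the variance.\<close>
  have "\<epsilon> / 8 * (q * m) \<le> \<epsilon> / 8 * (q * a)" using a q \<epsilon> by (intro mult_left_mono) auto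
  also have "\<dots> = \<epsilon> / 2 * q * ((1 / 2) * a) - a * (\<epsilon> / 8 * q)" by (simp add: field_simps)
  also have "\<dots> \<le> \<epsilon> / 2 * q * (s * a) - a * (D * a)"
   using s q \<epsilon> Da a m by (intro diff_mono mult_left_mono mult_right_mono) auto
  also have "\<dots> = (s * s - D) * a\<^sup>2 - (s * a) * T" by (simp add: T_def cs power2_eq_square algebra_simps)
  also have "\<dots> \<le> v * a\<^sup>2 - T * T" using v TB T by (intro diff_mono mult_right_mono) auto
  also have "\<dots> = v * (a\<^sup>2 - t\<^sup>2)" using v t(2) by (simp add: power_divide power2_eq_square right_diff_distrib)
  finally have gap: "\<epsilon> / 8 * (q * m) \<le> v * (a\<^sup>2 - t\<^sup>2)" .
  have "0 < \<epsilon> / 8 * (q * m)" using \<epsilon> q m by simp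
  then have "0 < v * (a\<^sup>2 - t\<^sup>2)" using gap by linarith
  then have "0 < a\<^sup>2 - t\<^sup>2" using v by (simp add: zero_less_mult_iff)
  then have "v * (a\<^sup>2 - t\<^sup>2) \<le> 1 * (a\<^sup>2 - t\<^sup>2)" using v by (intro mult_right_mono) auto
  then have "- (a\<^sup>2) / 2 + \<epsilon> / 16 * (q * m) \<le> - (t\<^sup>2) / 2" using gap by simp
  then have "exp (- (a\<^sup>2) / 2) * exp (\<epsilon> / 16 * (q * m)) \<le> exp (- (t\<^sup>2) / 2)"
   by (simp only: exp_add[symmetric] exp_le_cancel_iff)
  moreover have "b * (m * m) * exp (\<epsilon> / 16 * (q * m)) \<le> exp (- (a\<^sup>2) / 2) * exp (\<epsilon> / 16 * (q * m))"
   using elim unfolding m a_def by (intro mult_right_mono) auto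
  ultimately have e: "b * (m * m) * exp (\<epsilon> / 16 * (q * m)) \<le> exp (- (t\<^sup>2) / 2)" by linarith
  have b0: "b > 0" using elim by simp
  have "c / 4 * exp (\<epsilon> / 16 * (q * m)) = 1 / (b * m) * (b * (m * m) * exp (\<epsilon> / 16 * (q * m)) * c / (4 * m))"
   using m(1) b0 by (simp add: field_simps)
  also have "\<dots> \<le> real (wlen b) * (exp (- (t\<^sup>2) / 2) * c / t)"
   using e c t t4 m elim by (intro mult_mono frac_le mult_right_mono) (auto simp: m_def)
  also have "exp (- (t\<^sup>2) / 2) * c / t = exp (- (t\<^sup>2) / 2) * exp (- 3 / 2) / (sqrt (2 * pi) * t)"
   by (simp add: c_def)
  also have "real (wlen b) * \<dots> \<le> real (wlen b) * measure std_normal_distribution {t<..t + 1}"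
   by (intro mult_left_mono std_normal_interval_ge t) auto
  finally show ?case by (simp only: q_def m_def t_def)
 qed
qed

lemma second_moment_bound_tendsto:
 assumes \<epsilon>: "\<epsilon> > 0"
 shows "((\<lambda>b. 1 / (real (wlen b) * measure std_normal_distribution {level \<epsilon> b<..level \<epsilon> b + 1}) +
  2 * ((\<Sum>k=1..<wlen b. box_factor ((level \<epsilon> b + 1)\<^sup>2) (resid_corr (wlen b) k) - 1) / real (wlen b))) \<longlongrightarrow> 0) (at_right 0)"
proof -
 obtain \<zeta> where \<zeta>: "\<zeta> > 0" and lim: "(\<lambda>w. (\<Sum>k=1..<w. box_factor ((2 + \<zeta>) * ln (real w)) (resid_corr w k) - 1) / real w) \<longlonglongrightarrow> 0"
  using box_factor_average by blast
 have corr: "\<forall>\<^sub>F b in at_right 0. \<forall>k\<in>{1..<wlen b}. 0 \<le> resid_corr (wlen b) k \<and> resid_corr (wlen b) k < 1"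
 proof -
  show ?thesis using resid_corr_1_less resid_var_wlen
  proof eventually_elim
   case (elim b)
   show ?case
    using resid_corr_range[of "wlen b"] elim by force
  qed
 qed
 have "((\<lambda>b. (\<Sum>k=1..<wlen b. box_factor ((level \<epsilon> b + 1)\<^sup>2) (resid_corr (wlen b) k) - 1) / real (wlen b)) \<longlongrightarrow> 0) (at_right 0)"
 proof (rule tendsto_sandwich[where f="\<lambda>_. 0"])
  show "((\<lambda>b. (\<Sum>k=1..<wlen b. box_factor ((2 + \<zeta>) * ln (real (wlen b))) (resid_corr (wlen b) k) - 1) / real (wlen b)) \<longlongrightarrow> 0) (at_right 0)"
   using filterlim_compose[OF lim wlen_at_top] .
  show "\<forall>\<^sub>F b in at_right 0. 0 \<le> (\<Sum>k=1..<wlen b. box_factor ((level \<epsilon> b + 1)\<^sup>2) (resid_corr (wlen b) k) - 1) / real (wlen b)"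
   using corr
  proof eventually_elim
   case (elim b)
   have "1 \<le> box_factor ((level \<epsilon> b + 1)\<^sup>2) (resid_corr (wlen b) k)" if "k \<in> {1..<wlen b}" for k
    using elim[rule_format, OF that] by (intro box_factor_ge_1) auto
   then show ?case by (intro divide_nonneg_nonneg sum_nonneg) auto
  qed
  show "\<forall>\<^sub>F b in at_right 0. (\<Sum>k=1..<wlen b. box_factor ((level \<epsilon> b + 1)\<^sup>2) (resid_corr (wlen b) k) - 1) / real (wlen b)
   \<le> (\<Sum>k=1..<wlen b. box_factor ((2 + \<zeta>) * ln (real (wlen b))) (resid_corr (wlen b) k) - 1) / real (wlen b)"
   using corr level_sq_le[OF \<epsilon> \<zeta>]
  proof eventually_elim
   case (elim b)
   then show ?case by (intro divide_right_mono sum_mono diff_right_mono box_factor_mono) auto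
  qed
 qed auto
 moreover have "((\<lambda>b. 1 / (real (wlen b) * measure std_normal_distribution {level \<epsilon> b<..level \<epsilon> b + 1})) \<longlongrightarrow> 0) (at_right 0)"
  using tendsto_inverse_0_at_top[OF expected_count_at_top[OF \<epsilon>]] by (simp add: inverse_eq_divide)
 ultimately have "((\<lambda>b. 1 / (real (wlen b) * measure std_normal_distribution {level \<epsilon> b<..level \<epsilon> b + 1}) +
  2 * ((\<Sum>k=1..<wlen b. box_factor ((level \<epsilon> b + 1)\<^sup>2) (resid_corr (wlen b) k) - 1) / real (wlen b))) \<longlongrightarrow> 0 + 2 * 0) (at_right 0)"
  by (intro tendsto_intros)
 then show ?thesis by simp
qed

lemma window_short:
 assumes "\<epsilon> > 0"
 shows "\<forall>\<^sub>F b in at_right 0. b * real (wlen b) \<le> \<epsilon> * sqrt (rho r b)"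
proof -
 have "\<forall>\<^sub>F b in at_right 0. 2 / \<epsilon> \<le> sqrt (rho r b) * sqrt (lg b)"
  using sqrt_rho_lg unfolding filterlim_at_top by (rule spec)
 moreover have "\<forall>\<^sub>F b::real in at_right 0. b * sqrt (ln (1 / b)) \<le> 1" by real_asymp
 ultimately show ?thesis using scale_bounds eventual_bounds
 proof eventually_elim
  case (elim b)
  have m: "0 < sqrt (lg b)" using elim by simp
  have "b * real (wlen b) \<le> b * (1 / (b * sqrt (lg b)) + 1)" using elim by (intro mult_left_mono) auto
  also have "\<dots> = (1 + b * sqrt (lg b)) / sqrt (lg b)" using elim m by (simp add: field_simps)
  also have "\<dots> \<le> 2 / sqrt (lg b)" using elim m by (intro divide_right_mono) auto
  also have "\<dots> \<le> \<epsilon> * sqrt (rho r b)"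
   using elim(1) m assms by (simp add: divide_le_eq mult_ac)
  finally show ?case .
 qed
qed

end

section \<open>Gaussian sequences centred at window means\<close>

text \<open>Only first and second moments and the normality of linear combinations are kept from stationarity, so that
 the reflected sequence is another instance.\<close>

locale gauss_seq = prob_space M + slow_cov r N0
 for M :: "'a measure" and r N0 +
 fixes X :: "int \<Rightarrow> 'a \<Rightarrow> real"
 assumes X_meas[measurable]: "\<And>i. X i \<in> borel_measurable M"
  and gauss: "gaussian_process M X"
  and X_mean: "\<And>i. expectation (X i) = 0"
  and X_sq_int: "\<And>i. integrable M (\<lambda>\<omega>. X i \<omega> * X i \<omega>)"
  and X_cov: "\<And>i j. expectation (\<lambda>\<omega>. X i \<omega> * X j \<omega>) = r (nat \<bar>i - j\<bar>)"

context gauss_seq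
begin

definition gauss_span :: "('a \<Rightarrow> real) set" where
 "gauss_span = {Y. \<exists>J c. finite J \<and> Y = (\<lambda>\<omega>. \<Sum>i\<in>J. c i * X i \<omega>)}"

lemma X_in_span: "X i \<in> gauss_span"
 unfolding gauss_span_def by (auto intro!: exI[of _ "{i}"] exI[of _ "\<lambda>_. 1"])

lemma cmult_in_span: "Y \<in> gauss_span \<Longrightarrow> (\<lambda>\<omega>. a * Y \<omega>) \<in> gauss_span"
 unfolding gauss_span_def
proof safe
 fix J :: "int set" and c :: "int \<Rightarrow> real" assume "finite J"
 then show "\<exists>J' c'. finite J' \<and> (\<lambda>\<omega>. a * (\<Sum>i\<in>J. c i * X i \<omega>)) = (\<lambda>\<omega>. \<Sum>i\<in>J'. c' i * X i \<omega>)"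
  by (intro exI[of _ J] exI[of _ "\<lambda>i. a * c i"]) (simp add: sum_distrib_left mult.assoc)
qed

lemma add_in_span: "Y \<in> gauss_span \<Longrightarrow> Z \<in> gauss_span \<Longrightarrow> (\<lambda>\<omega>. Y \<omega> + Z \<omega>) \<in> gauss_span"
 unfolding gauss_span_def
proof safe
 fix J J' :: "int set" and c c' :: "int \<Rightarrow> real" assume J: "finite J" "finite J'"
 have "(\<lambda>\<omega>. (\<Sum>i\<in>J. c i * X i \<omega>) + (\<Sum>i\<in>J'. c' i * X i \<omega>)) =
  (\<lambda>\<omega>. \<Sum>i\<in>J \<union> J'. ((if i \<in> J then c i else 0) + (if i \<in> J' then c' i else 0)) * X i \<omega>)"
 proof
  fix \<omega>
  have "(\<Sum>i\<in>J. c i * X i \<omega>) = (\<Sum>i\<in>J \<union> J'. (if i \<in> J then c i else 0) * X i \<omega>)"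
   using J by (intro sum.mono_neutral_cong_left) auto
  moreover have "(\<Sum>i\<in>J'. c' i * X i \<omega>) = (\<Sum>i\<in>J \<union> J'. (if i \<in> J' then c' i else 0) * X i \<omega>)"
   using J by (intro sum.mono_neutral_cong_left) auto
  ultimately show "(\<Sum>i\<in>J. c i * X i \<omega>) + (\<Sum>i\<in>J'. c' i * X i \<omega>) =
   (\<Sum>i\<in>J \<union> J'. ((if i \<in> J then c i else 0) + (if i \<in> J' then c' i else 0)) * X i \<omega>)"
   by (simp add: sum.distrib distrib_right)
 qed
 then show "\<exists>J'' c''. finite J'' \<and> (\<lambda>\<omega>. (\<Sum>i\<in>J. c i * X i \<omega>) + (\<Sum>i\<in>J'. c' i * X i \<omega>)) =
   (\<lambda>\<omega>. \<Sum>i\<in>J''. c'' i * X i \<omega>)"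
  using J by (intro exI[of _ "J \<union> J'"] exI) auto
qed

lemma diff_in_span: "Y \<in> gauss_span \<Longrightarrow> Z \<in> gauss_span \<Longrightarrow> (\<lambda>\<omega>. Y \<omega> - Z \<omega>) \<in> gauss_span"
 using add_in_span[of Y "\<lambda>\<omega>. -1 * Z \<omega>"] cmult_in_span[of Z "-1"] by simp

lemma span_meas: "Y \<in> gauss_span \<Longrightarrow> Y \<in> borel_measurable M"
 unfolding gauss_span_def by auto

lemma XX_int: "integrable M (\<lambda>\<omega>. X i \<omega> * X j \<omega>)"
proof (rule Bochner_Integration.integrable_bound[OF Bochner_Integration.integrable_add[OF X_sq_int[of i] X_sq_int[of j]]])
 show "AE \<omega> in M. norm (X i \<omega> * X j \<omega>) \<le> norm (X i \<omega> * X i \<omega> + X j \<omega> * X j \<omega>)"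
 proof (rule AE_I2)
  fix \<omega>
  have "2 * (\<bar>X i \<omega>\<bar> * \<bar>X j \<omega>\<bar>) \<le> \<bar>X i \<omega>\<bar>\<^sup>2 + \<bar>X j \<omega>\<bar>\<^sup>2"
   using sum_squares_bound[of "\<bar>X i \<omega>\<bar>" "\<bar>X j \<omega>\<bar>"] by simp
  then have "\<bar>X i \<omega>\<bar> * \<bar>X j \<omega>\<bar> \<le> X i \<omega> * X i \<omega> + X j \<omega> * X j \<omega>"
   using mult_nonneg_nonneg[OF abs_ge_zero abs_ge_zero, of "X i \<omega>" "X j \<omega>"]
   unfolding power2_abs power2_eq_square[of "X _ \<omega>"] by linarith
  then show "norm (X i \<omega> * X j \<omega>) \<le> norm (X i \<omega> * X i \<omega> + X j \<omega> * X j \<omega>)"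
   by (simp add: abs_mult)
 qed
qed measurable

lemma span_prod_int: "Y \<in> gauss_span \<Longrightarrow> Z \<in> gauss_span \<Longrightarrow> integrable M (\<lambda>\<omega>. Y \<omega> * Z \<omega>)"
 unfolding gauss_span_def
proof safe
 fix J J' :: "int set" and c c' :: "int \<Rightarrow> real" assume J: "finite J" "finite J'"
 have "(\<lambda>\<omega>. (\<Sum>i\<in>J. c i * X i \<omega>) * (\<Sum>i\<in>J'. c' i * X i \<omega>)) =
  (\<lambda>\<omega>. \<Sum>i\<in>J. \<Sum>j\<in>J'. (c i * c' j) * (X i \<omega> * X j \<omega>))"
  unfolding sum_product by (intro ext sum.cong refl) (simp add: mult_ac)
 then show "integrable M (\<lambda>\<omega>. (\<Sum>i\<in>J. c i * X i \<omega>) * (\<Sum>i\<in>J'. c' i * X i \<omega>))"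
  by (simp only:) (intro Bochner_Integration.integrable_sum integrable_mult_right XX_int)
qed

lemma span_int: "Y \<in> gauss_span \<Longrightarrow> integrable M Y"
 using square_integrable_imp_integrable[OF span_meas] span_prod_int[of Y Y] by (simp add: power2_eq_square)

lemma span_mean: "Y \<in> gauss_span \<Longrightarrow> expectation Y = 0"
 unfolding gauss_span_def using span_int[OF X_in_span]
 by (auto simp: X_mean intro!: sum.neutral)

definition cov :: "('a \<Rightarrow> real) \<Rightarrow> ('a \<Rightarrow> real) \<Rightarrow> real" where
 "cov Y Z = expectation (\<lambda>\<omega>. Y \<omega> * Z \<omega>)"

lemma cov_commute: "cov Y Z = cov Z Y"
 by (simp add: cov_def mult.commute)

lemma cov_add_left: "Y \<in> gauss_span \<Longrightarrow> Y' \<in> gauss_span \<Longrightarrow> Z \<in> gauss_span \<Longrightarrow> cov (\<lambda>\<omega>. Y \<omega> + Y' \<omega>) Z = cov Y Z + cov Y' Z"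
 by (simp add: cov_def distrib_right span_prod_int)

lemma cov_diff_left: "Y \<in> gauss_span \<Longrightarrow> Y' \<in> gauss_span \<Longrightarrow> Z \<in> gauss_span \<Longrightarrow> cov (\<lambda>\<omega>. Y \<omega> - Y' \<omega>) Z = cov Y Z - cov Y' Z"
 by (simp add: cov_def left_diff_distrib span_prod_int)

lemma cov_cmult_left: "cov (\<lambda>\<omega>. a * Y \<omega>) Z = a * cov Y Z"
 by (simp add: cov_def mult.assoc)

lemma cov_add_right: "Y \<in> gauss_span \<Longrightarrow> Z \<in> gauss_span \<Longrightarrow> Z' \<in> gauss_span \<Longrightarrow> cov Y (\<lambda>\<omega>. Z \<omega> + Z' \<omega>) = cov Y Z + cov Y Z'"
 by (simp add: cov_def distrib_left span_prod_int)

lemma cov_diff_right: "Y \<in> gauss_span \<Longrightarrow> Z \<in> gauss_span \<Longrightarrow> Z' \<in> gauss_span \<Longrightarrow> cov Y (\<lambda>\<omega>. Z \<omega> - Z' \<omega>) = cov Y Z - cov Y Z'"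
 by (simp add: cov_def right_diff_distrib span_prod_int)

lemma cov_cmult_right: "cov Y (\<lambda>\<omega>. a * Z \<omega>) = a * cov Y Z"
 by (simp add: cov_def mult.left_commute)

lemma cov_self_nonneg: "cov Y Y \<ge> 0"
 by (simp add: cov_def)

lemma span_normal:
 assumes Y: "Y \<in> gauss_span" and pos: "cov Y Y > 0"
 shows "distributed M lborel (\<lambda>\<omega>. Y \<omega> / sqrt (cov Y Y)) std_normal_density"
proof -
 have "normal_rv M Y"
  using gauss Y unfolding gaussian_process_def gauss_span_def by auto
 then obtain \<mu> \<sigma> where "(\<sigma> > 0 \<and> distributed M lborel Y (normal_density \<mu> \<sigma>)) \<or> (AE \<omega> in M. Y \<omega> = \<mu>)"
  unfolding normal_rv_def by blast
 then show ?thesis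
 proof
  assume *: "\<sigma> > 0 \<and> distributed M lborel Y (normal_density \<mu> \<sigma>)"
  then have \<mu>: "\<mu> = 0" using normal_distributed_expectation[of \<sigma> Y \<mu>] span_mean[OF Y] by simp
  have "variance Y = \<sigma>\<^sup>2" using * by (intro normal_distributed_variance) auto
  then have "cov Y Y = \<sigma>\<^sup>2" using span_mean[OF Y] by (simp add: cov_def power2_eq_square)
  then have "sqrt (cov Y Y) = \<sigma>" using * by simp
  then show ?thesis using * normal_standard_normal_convert[of \<sigma> Y \<mu>] \<mu> by simp
 next
  assume AE: "AE \<omega> in M. Y \<omega> = \<mu>"
  have "expectation Y = expectation (\<lambda>_. \<mu>)"
   using AE span_meas[OF Y] by (intro integral_cong_AE) auto
  then have "\<mu> = 0" using span_mean[OF Y] by (simp add: prob_space)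
  then have "cov Y Y = expectation (\<lambda>_. 0)"
   unfolding cov_def using AE span_meas[OF Y] by (intro integral_cong_AE) auto
  then show ?thesis using pos by simp
 qed
qed

lemma span_degenerate:
 assumes "Y \<in> gauss_span" "cov Y Y = 0"
 shows "AE \<omega> in M. Y \<omega> = 0"
proof -
 have "AE \<omega> in M. Y \<omega> * Y \<omega> = 0"
  using assms integral_nonneg_eq_0_iff_AE[OF span_prod_int[OF assms(1) assms(1)]] by (simp add: cov_def)
 then show ?thesis by eventually_elim simp
qed

lemma span_prob:
 assumes Y: "Y \<in> gauss_span" and pos: "cov Y Y > 0" and A[measurable]: "A \<in> sets borel"
 shows "prob {\<omega>\<in>space M. Y \<omega> / sqrt (cov Y Y) \<in> A} = measure std_normal_distribution A"
proof -
 interpret N: prob_space std_normal_distribution by (rule prob_space_std_normal)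
 note d = span_normal[OF Y pos]
 have "distr M lborel (\<lambda>\<omega>. Y \<omega> / sqrt (cov Y Y)) = std_normal_distribution"
  using d by (simp add: distributed_def)
 then have "measure std_normal_distribution A = measure (distr M lborel (\<lambda>\<omega>. Y \<omega> / sqrt (cov Y Y))) A" by simp
 also have "\<dots> = prob ((\<lambda>\<omega>. Y \<omega> / sqrt (cov Y Y)) -` A \<inter> space M)"
  using span_meas[OF Y] by (intro measure_distr) auto
 also have "(\<lambda>\<omega>. Y \<omega> / sqrt (cov Y Y)) -` A \<inter> space M = {\<omega>\<in>space M. Y \<omega> / sqrt (cov Y Y) \<in> A}" by auto
 finally show ?thesis by simp
qed

lemma span_char:
 assumes Y: "Y \<in> gauss_span"
 shows "(CLINT \<omega>|M. iexp (Y \<omega>)) = of_real (exp (- cov Y Y / 2))"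
proof (cases "cov Y Y = 0")
 case True
 have "(CLINT \<omega>|M. iexp (Y \<omega>)) = (CLINT \<omega>|M. 1)"
  using span_degenerate[OF Y True] span_meas[OF Y] by (intro integral_cong_AE) auto
 then show ?thesis using True by (simp add: prob_space)
next
 case False
 then have pos: "cov Y Y > 0" using cov_self_nonneg[of Y] by simp
 define s where "s = sqrt (cov Y Y)"
 have s: "s > 0" "s\<^sup>2 = cov Y Y" using pos by (auto simp: s_def)
 note d = span_normal[OF Y pos, folded s_def]
 have [measurable]: "Y \<in> borel_measurable M" by (rule span_meas[OF Y])
 have law: "distr M lborel (\<lambda>\<omega>. Y \<omega> / s) = std_normal_distribution"
  using d by (simp add: distributed_def)
 have "char std_normal_distribution s = (CLINT x|distr M lborel (\<lambda>\<omega>. Y \<omega> / s). iexp (s * x))"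
  unfolding law char_def ..
 also have "\<dots> = (CLINT \<omega>|M. iexp (s * (Y \<omega> / s)))"
  by (subst integral_distr) auto
 also have "\<dots> = (CLINT \<omega>|M. iexp (Y \<omega>))" using s by simp
 finally show ?thesis using s by (simp add: char_std_normal_distribution)
qed

lemma span_tail:
 assumes Y: "Y \<in> gauss_span" and V: "cov Y Y \<le> V" "V > 0" and T: "T > 0"
 shows "prob {\<omega>\<in>space M. Y \<omega> > T} \<le> sqrt V / T * exp (- (T\<^sup>2) / (2 * V))"
proof (cases "cov Y Y = 0")
 case True
 have "AE \<omega> in M. \<not> Y \<omega> > T" using span_degenerate[OF Y True] by eventually_elim (use T in auto)
 moreover have "{\<omega>\<in>space M. Y \<omega> > T} \<in> events" using span_meas[OF Y] by measurable
 ultimately have "prob {\<omega>\<in>space M. Y \<omega> > T} = 0"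
  by (subst prob_eq_0) auto
 then show ?thesis using T V by simp
next
 case False
 then have pos: "cov Y Y > 0" using cov_self_nonneg[of Y] by simp
 define s where "s = sqrt (cov Y Y)"
 have s: "s > 0" "s\<^sup>2 = cov Y Y" "s \<le> sqrt V" using pos V by (auto simp: s_def)
 have "prob {\<omega>\<in>space M. Y \<omega> > T} = prob {\<omega>\<in>space M. Y \<omega> / s \<in> {T / s<..}}"
  using s by (intro arg_cong[where f=prob]) (auto simp: divide_less_cancel)
 also have "\<dots> = measure std_normal_distribution {T / s<..}"
  unfolding s_def by (rule span_prob[OF Y pos]) simp
 also have "\<dots> \<le> exp (- ((T / s)\<^sup>2) / 2) / (T / s)"
  using s T by (intro std_normal_upper_tail_le) auto
 also have "\<dots> = s / T * exp (- (T\<^sup>2 / (2 * cov Y Y)))" using s by (simp add: power_divide)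
 also have "\<dots> \<le> sqrt V / T * exp (- (T\<^sup>2 / (2 * V)))"
  using s T V pos by (intro mult_mono divide_right_mono) (auto intro!: divide_left_mono)
 finally show ?thesis by simp
qed

lemma span_box:
 assumes Y: "Y \<in> gauss_span" "cov Y Y = 1" and Z: "Z \<in> gauss_span" "cov Z Z = 1"
  and g: "\<bar>cov Y Z\<bar> \<le> g" "g < 1" and t: "0 \<le> t"
 shows "prob {\<omega>\<in>space M. Y \<omega> \<in> {t<..T} \<and> Z \<omega> \<in> {t<..T}}
  \<le> (measure std_normal_distribution {t<..T})\<^sup>2 * box_factor (T\<^sup>2) g"
proof (rule bivariate_normal_box_le[OF span_meas[OF Y(1)] span_meas[OF Z(1)] _ g t])
 fix a b
 have "(CLINT \<omega>|M. iexp (a * Y \<omega> + b * Z \<omega>)) = of_real (exp (- cov (\<lambda>\<omega>. a * Y \<omega> + b * Z \<omega>) (\<lambda>\<omega>. a * Y \<omega> + b * Z \<omega>) / 2))"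
  by (intro span_char add_in_span cmult_in_span Y Z)
 also have "cov (\<lambda>\<omega>. a * Y \<omega> + b * Z \<omega>) (\<lambda>\<omega>. a * Y \<omega> + b * Z \<omega>) = a\<^sup>2 + 2 * cov Y Z * a * b + b\<^sup>2"
  using Y Z by (simp add: cov_add_left cov_add_right cov_cmult_left cov_cmult_right add_in_span cmult_in_span
    cov_commute[of Z Y] power2_eq_square algebra_simps)
 finally show "(CLINT \<omega>|M. iexp (a * Y \<omega> + b * Z \<omega>)) = of_real (exp (- (a\<^sup>2 + 2 * cov Y Z * a * b + b\<^sup>2) / 2))" .
qed

definition window_mean :: "int \<Rightarrow> nat \<Rightarrow> 'a \<Rightarrow> real" where
 "window_mean p w \<omega> = (\<Sum>i\<in>{p..<p + int w}. (1 / real w) * X i \<omega>)"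

lemma window_mean_in_span: "window_mean p w \<in> gauss_span"
 unfolding gauss_span_def window_mean_def by (auto intro!: exI[of _ "{p..<p + int w}"] exI[of _ "\<lambda>_. 1 / real w"])

lemma cov_X_X: "cov (X i) (X j) = r (nat \<bar>i - j\<bar>)"
 by (simp add: cov_def X_cov)

lemma cov_window_mean:
 assumes Y: "Y \<in> gauss_span"
 shows "cov Y (window_mean p w) = (\<Sum>i\<in>{p..<p + int w}. cov Y (X i)) / real w"
proof -
 have "cov Y (window_mean p w) = (LINT \<omega>|M. (\<Sum>i\<in>{p..<p + int w}. (1 / real w) * (Y \<omega> * X i \<omega>)))"
  unfolding cov_def window_mean_def by (simp add: sum_distrib_left mult_ac)
 also have "\<dots> = (\<Sum>i\<in>{p..<p + int w}. (1 / real w) * cov Y (X i))"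
  unfolding cov_def using span_prod_int[OF Y X_in_span]
  by (subst Bochner_Integration.integral_sum) auto
 finally show ?thesis by (simp add: sum_divide_distrib)
qed

lemma cov_X_window_ge:
 assumes "0 < w" "\<And>i. i \<in> {p..<p + int w} \<Longrightarrow> nat \<bar>j - i\<bar> \<le> n"
 shows "r n \<le> cov (X j) (window_mean p w)"
 unfolding cov_window_mean[OF X_in_span] cov_X_X
 using assms by (intro average_window[where b=1]) (auto intro: r_dec r_le_1)

text \<open>The lag 0 and both lags \<open>k\<close> on either side of \<open>j\<close> contribute at most their terms in \<open>excess\<close>.\<close>

lemma cov_X_window_le:
 assumes j: "j \<in> {p..<p + int w}"
 shows "cov (X j) (window_mean p w) \<le> r w + excess w"
proof -
 have w: "w > 0" using j by auto
 have "(\<Sum>i\<in>{p..<p + int w}. cov (X j) (X i)) = (\<Sum>i\<in>{p..<p + int w}. r (nat \<bar>j - i\<bar>) - r w) + real w * r w"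
  by (simp add: cov_X_X sum_subtractf)
 also have "(\<Sum>i\<in>{p..<p + int w}. r (nat \<bar>j - i\<bar>) - r w) = (r 0 - r w) + (\<Sum>i\<in>{p..<p + int w} - {j}. r (nat \<bar>j - i\<bar>) - r w)"
  using j by (subst sum.remove[of _ j]) auto
 also have "\<dots> \<le> 2 * (r 0 - r w) + 2 * (\<Sum>k=1..<w. r k - r w)"
  using sum_window_le[OF j, of "\<lambda>k. r k - r w"] r_dec[of _ w] r_dec[of 0 w] by fastforce
 also have "\<dots> = 2 * (\<Sum>k<w. r k - r w)"
 proof -
  have "{..<w} = insert 0 {1..<w}" using w by auto
  then show ?thesis by simp
 qed
 finally have "(\<Sum>i\<in>{p..<p + int w}. cov (X j) (X i)) \<le> real w * (r w + excess w)"
  using w by (simp add: excess_def distrib_left)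
 then show ?thesis
  unfolding cov_window_mean[OF X_in_span] using w by (simp add: divide_le_eq mult.commute)
qed

lemma window_var_bounds:
 assumes "0 < w"
 shows "r w \<le> cov (window_mean p w) (window_mean p w)" "cov (window_mean p w) (window_mean p w) \<le> r w + excess w"
proof -
 have eq: "cov (window_mean p w) (window_mean p w) = (\<Sum>i\<in>{p..<p + int w}. cov (X i) (window_mean p w)) / real w"
  using cov_window_mean[OF window_mean_in_span, of p w p w] by (simp add: cov_commute)
 have b: "r w \<le> cov (X i) (window_mean p w)" "cov (X i) (window_mean p w) \<le> r w + excess w" if "i \<in> {p..<p + int w}" for i
  using that assms by (auto intro!: cov_X_window_ge cov_X_window_le)
 show "r w \<le> cov (window_mean p w) (window_mean p w)" "cov (window_mean p w) (window_mean p w) \<le> r w + excess w"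
  unfolding eq by (rule average_window(1)[OF assms b] average_window(2)[OF assms b]; assumption)+
qed

definition resid :: "int \<Rightarrow> nat \<Rightarrow> int \<Rightarrow> 'a \<Rightarrow> real" where
 "resid p w j \<omega> = X j \<omega> - window_mean p w \<omega>"

lemma resid_eq: "resid p w j = (\<lambda>\<omega>. X j \<omega> - window_mean p w \<omega>)"
 by (rule ext) (simp add: resid_def)

lemma resid_in_span: "resid p w j \<in> gauss_span"
 using diff_in_span[OF X_in_span window_mean_in_span] by (simp add: resid_eq)

lemma resid_window_mean_measurable[measurable]:
 "resid p w j \<in> borel_measurable M" "window_mean p w \<in> borel_measurable M"
 by (rule span_meas[OF resid_in_span] span_meas[OF window_mean_in_span])+

lemma cov_resid:
 "cov (resid p w i) (resid p w j) = r (nat \<bar>i - j\<bar>) - cov (X i) (window_mean p w)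
   - cov (X j) (window_mean p w) + cov (window_mean p w) (window_mean p w)"
proof -
 let ?S = "window_mean p w"
 have "cov (resid p w i) (resid p w j) = cov (X i) (resid p w j) - cov ?S (resid p w j)"
  unfolding resid_eq[of p w i] by (rule cov_diff_left[OF X_in_span window_mean_in_span resid_in_span])
 also have "cov (X i) (resid p w j) = cov (X i) (X j) - cov (X i) ?S"
  unfolding resid_eq by (rule cov_diff_right[OF X_in_span X_in_span window_mean_in_span])
 also have "cov ?S (resid p w j) = cov ?S (X j) - cov ?S ?S"
  unfolding resid_eq by (rule cov_diff_right[OF window_mean_in_span X_in_span window_mean_in_span])
 finally show ?thesis
  unfolding cov_X_X cov_commute[of ?S "X j"] by linarith
qed

text \<open>Covariances with the window mean, and the variance of the mean, all lie between \<open>r w\<close> and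
 \<open>r w + excess w\<close>. Centring therefore removes \<open>r w\<close> from all covariances up to twice the excess.\<close>

lemma cov_resid_bounds:
 assumes i: "i \<in> {p..<p + int w}" and j: "j \<in> {p..<p + int w}"
 shows "\<bar>cov (resid p w i) (resid p w j)\<bar> \<le> r (nat \<bar>i - j\<bar>) - r w + 2 * excess w"
  and "resid_var w \<le> cov (resid p w j) (resid p w j)"
proof -
 have w: "w > 0" using i by auto
 have b: "r w \<le> cov (X i) (window_mean p w)" "cov (X i) (window_mean p w) \<le> r w + excess w" if "i \<in> {p..<p + int w}" for i
  using that w by (auto intro!: cov_X_window_ge cov_X_window_le)
 have d: "r w \<le> r (nat \<bar>i - j\<bar>)" using i j by (intro r_dec) auto
 show "\<bar>cov (resid p w i) (resid p w j)\<bar> \<le> r (nat \<bar>i - j\<bar>) - r w + 2 * excess w"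
  unfolding cov_resid using b[OF i] b[OF j] window_var_bounds[OF w, of p] excess_nonneg[of w] d by linarith
 show "resid_var w \<le> cov (resid p w j) (resid p w j)"
  unfolding cov_resid resid_var_def using b[OF j] window_var_bounds[OF w, of p] r0 by simp
qed

text \<open>The second-moment method for the events that a normalised residual lies in \<open>{t<..t + 1}\<close>. Taking the same interval
 for each variable makes their probabilities equal although the residual variances vary with the index.\<close>

lemma prob_window_below_le:
 assumes w: "w > 0" and v: "resid_var w > 0" and c1: "resid_corr w 1 < 1" and t: "t > 0"
  and T: "T \<le> t * sqrt (resid_var w)"
 shows "prob {\<omega>\<in>space M. \<forall>j\<in>{p..<p + int w}. resid p w j \<omega> \<le> T} \<le>
  1 / (real w * measure std_normal_distribution {t<..t + 1}) +
  2 * ((\<Sum>k=1..<w. box_factor ((t + 1)\<^sup>2) (resid_corr w k) - 1) / real w)"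
proof -
 let ?N = std_normal_distribution
 define P where "P = measure ?N {t<..t + 1}"
 define J where "J = {p..<p + int w}"
 define Z where "Z j \<omega> = (1 / sqrt (cov (resid p w j) (resid p w j))) * resid p w j \<omega>" for j \<omega>
 define A where "A j = {\<omega>\<in>space M. Z j \<omega> \<in> {t<..t + 1}}" for j
 have vj: "resid_var w \<le> cov (resid p w j) (resid p w j)" if "j \<in> J" for j
  using cov_resid_bounds(2)[of j p w j] that by (simp add: J_def)
 have ZH: "Z j \<in> gauss_span" for j unfolding Z_def[abs_def] by (intro cmult_in_span resid_in_span)
 have cZ: "cov (Z i) (Z j) = cov (resid p w i) (resid p w j) / (sqrt (cov (resid p w i) (resid p w i)) * sqrt (cov (resid p w j) (resid p w j)))" for i j
  unfolding Z_def[abs_def] cov_cmult_left cov_cmult_right by simp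
 have varZ: "cov (Z j) (Z j) = 1" if "j \<in> J" for j
  using vj[OF that] v by (simp add: cZ)
 have [measurable]: "Z j \<in> borel_measurable M" for j using span_meas[OF ZH] .
 have corr: "0 \<le> resid_corr w k" "resid_corr w k < 1" if "k \<in> {1..<w}" for k
  using resid_corr_range[OF v that] c1 by linarith+
 have P0: "P > 0"
 proof -
  interpret N: prob_space ?N by (rule prob_space_std_normal)
  have "emeasure ?N {t<..t+1} \<noteq> 0"
  proof
   assume "emeasure ?N {t<..t+1} = 0"
   then have "AE x in lborel. \<not> (x \<in> {t<..t+1})"
    by (simp add: emeasure_density nn_integral_0_iff_AE) (auto elim!: eventually_mono simp: std_normal_density_def split: split_indicator_asm)
   then have "emeasure lborel {t<..t+1} = 0"
    by (subst (asm) AE_iff_measurable[where N="{t<..t+1}"]) auto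
   then show False by simp
  qed
  then show ?thesis unfolding P_def by (simp add: N.emeasure_eq_measure zero_less_measure_iff)
 qed
 have "prob {\<omega>\<in>space M. \<forall>j\<in>J. resid p w j \<omega> \<le> T} \<le> prob {\<omega>\<in>space M. \<forall>j\<in>J. \<omega> \<notin> A j}"
 proof (rule finite_measure_mono)
  show "{\<omega>\<in>space M. \<forall>j\<in>J. \<omega> \<notin> A j} \<in> events" unfolding A_def J_def by measurable
  show "{\<omega>\<in>space M. \<forall>j\<in>J. resid p w j \<omega> \<le> T} \<subseteq> {\<omega>\<in>space M. \<forall>j\<in>J. \<omega> \<notin> A j}"
  proof safe
   fix \<omega> j assume j: "j \<in> J" and le: "\<forall>j\<in>J. resid p w j \<omega> \<le> T" and "\<omega> \<in> A j"
   then have "t < resid p w j \<omega> / sqrt (cov (resid p w j) (resid p w j))" by (auto simp: A_def Z_def)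
   moreover have s: "sqrt (cov (resid p w j) (resid p w j)) > 0" using vj[OF j] v by simp
   ultimately have "t * sqrt (cov (resid p w j) (resid p w j)) < resid p w j \<omega>" by (simp add: less_divide_eq)
   moreover have "t * sqrt (resid_var w) \<le> t * sqrt (cov (resid p w j) (resid p w j))"
    using vj[OF j] t by simp
   ultimately show False using T le j by fastforce
  qed
 qed
 also have "\<dots> \<le> 1 / (real (card J) * P) + (\<Sum>i\<in>J. \<Sum>j\<in>J - {i}. box_factor ((t + 1)\<^sup>2) (resid_corr w (nat \<bar>i - j\<bar>)) - 1) / (real (card J))\<^sup>2"
 proof (rule prob_no_event_le)
  show "prob (A j) = P" if "j \<in> J" for j
   using span_prob[OF ZH, of j "{t<..t + 1}"] varZ[OF that] by (simp add: A_def P_def)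
  fix i j assume ij: "i \<in> J" "j \<in> J" "i \<noteq> j"
  have k: "nat \<bar>i - j\<bar> \<in> {1..<w}" using ij by (auto simp: J_def)
  have "\<bar>cov (Z i) (Z j)\<bar> \<le> resid_corr w (nat \<bar>i - j\<bar>)"
  proof -
   have "resid_var w = sqrt (resid_var w) * sqrt (resid_var w)" using v by simp
   also have "\<dots> \<le> sqrt (cov (resid p w i) (resid p w i)) * sqrt (cov (resid p w j) (resid p w j))"
    using vj ij v cov_self_nonneg by (intro mult_mono) auto
   finally have den: "resid_var w \<le> sqrt (cov (resid p w i) (resid p w i)) * sqrt (cov (resid p w j) (resid p w j))" .
   have num: "\<bar>cov (resid p w i) (resid p w j)\<bar> \<le> r (nat \<bar>i - j\<bar>) - r w + 2 * excess w"
    using ij by (intro cov_resid_bounds(1)) (auto simp: J_def)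
   show ?thesis
    unfolding cZ resid_corr_def abs_divide using num den v
    by (intro frac_le) auto
  qed
  then have "prob {\<omega>\<in>space M. Z i \<omega> \<in> {t<..t + 1} \<and> Z j \<omega> \<in> {t<..t + 1}} \<le> P\<^sup>2 * box_factor ((t + 1)\<^sup>2) (resid_corr w (nat \<bar>i - j\<bar>))"
   unfolding P_def using corr[OF k] t ij varZ by (intro span_box ZH) auto
  then show "prob (A i \<inter> A j) \<le> P\<^sup>2 * box_factor ((t + 1)\<^sup>2) (resid_corr w (nat \<bar>i - j\<bar>))"
   by (simp add: A_def Int_def conj_ac cong: conj_cong)
 qed (use w P0 in \<open>auto simp: J_def A_def\<close>)
 also have "(\<Sum>i\<in>J. \<Sum>j\<in>J - {i}. box_factor ((t + 1)\<^sup>2) (resid_corr w (nat \<bar>i - j\<bar>)) - 1)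
   \<le> (\<Sum>i\<in>J. 2 * (\<Sum>k=1..<w. box_factor ((t + 1)\<^sup>2) (resid_corr w k) - 1))"
  unfolding J_def
 proof (intro sum_mono sum_window_le)
  fix k assume "k \<in> {1..<w}"
  then show "0 \<le> box_factor ((t + 1)\<^sup>2) (resid_corr w k) - 1"
   using box_factor_ge_1[of "resid_corr w k" "(t + 1)\<^sup>2"] corr by simp
 qed auto
 finally show ?thesis
  using w by (simp add: J_def P_def divide_right_mono power2_eq_square)
qed

lemma window_mean_prob:
 assumes w: "0 < w"
 shows "prob {\<omega>\<in>space M. window_mean p w \<omega> \<le> s} = Phi (s / sqrt (cov (window_mean p w) (window_mean p w)))"
proof -
 have pos: "cov (window_mean p w) (window_mean p w) > 0"
  using window_var_bounds(1)[OF w, of p] r_pos[of w] by linarith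
 have "{\<omega>\<in>space M. window_mean p w \<omega> \<le> s} =
  {\<omega>\<in>space M. window_mean p w \<omega> / sqrt (cov (window_mean p w) (window_mean p w)) \<in> {..s / sqrt (cov (window_mean p w) (window_mean p w))}}"
  using pos by (auto simp: divide_le_cancel)
 then show ?thesis
  using span_prob[OF window_mean_in_span pos, of "{..s / sqrt (cov (window_mean p w) (window_mean p w))}"]
  by (simp add: Phi_def cdf_def)
qed

lemma window_mean_var_rho:
 assumes "\<forall>\<^sub>F b in at_right 0. N b = wlen b \<or> N b = tlen b"
 shows "\<forall>\<^sub>F b in at_right 0. \<bar>cov (window_mean (p b) (N b)) (window_mean (p b) (N b)) - rho r b\<bar> \<le> slack b"
 using assms scale_bounds
proof eventually_elim
 case (elim b)
 have N: "0 < N b" using elim by auto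
 have "r (2 * tlen b) \<le> r (tlen b)" "r (tlen b) \<le> rho r b" "rho r b \<le> r (wlen b)"
  unfolding rho_eq using elim by (auto intro!: r_dec)
 note b = this window_var_bounds[OF N, of "p b"] excess_nonneg[of "wlen b"] excess_nonneg[of "tlen b"]
 from elim(1) show ?case
 proof
  assume "N b = wlen b"
  then show ?thesis using b unfolding slack_def by simp
 next
  assume "N b = tlen b"
  then show ?thesis using b unfolding slack_def by simp
 qed
qed

text \<open>Reflection turns the first entrance into the last exit, so that the upper bound has to be proved for one end only.\<close>

lemma reflected: "gauss_seq M r N0 (\<lambda>i. X (- i))"
proof (intro gauss_seq.intro gauss_seq_axioms.intro)
 show "gaussian_process M (\<lambda>i. X (- i))"
  unfolding gaussian_process_def
 proof (intro allI impI)
  fix J :: "int set" and c :: "int \<Rightarrow> real" assume "finite J"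
  have "(\<Sum>i\<in>J. c i * X (- i) \<omega>) = (\<Sum>i\<in>uminus ` J. c (- i) * X i \<omega>)" for \<omega>
   by (subst sum.reindex) auto
  moreover have "normal_rv M (\<lambda>\<omega>. \<Sum>i\<in>uminus ` J. c (- i) * X i \<omega>)"
   by (rule gauss[unfolded gaussian_process_def, rule_format, OF finite_imageI[OF \<open>finite J\<close>]])
  ultimately show "normal_rv M (\<lambda>\<omega>. \<Sum>i\<in>J. c i * X (- i) \<omega>)" by simp
 qed
 show "expectation (\<lambda>\<omega>. X (- i) \<omega> * X (- j) \<omega>) = r (nat \<bar>i - j\<bar>)" for i j
 proof -
  have "\<bar>- i - - j\<bar> = \<bar>i - j\<bar>" by simp
  then show ?thesis using X_cov[of "- i" "- j"] by (simp only:)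
 qed
qed (rule prob_space_axioms slow_cov_axioms X_mean X_sq_int X_meas)+

section \<open>Exceedance probabilities\<close>

text \<open>Outside this event the exceedances of \<open>b * \<bar>j\<bar>\<close> are confined to a finite set of indices.\<close>

definition far :: "real \<Rightarrow> 'a set" where
 "far b = {\<omega>\<in>space M. \<exists>j. int (tlen b) < \<bar>j\<bar> \<and> X j \<omega> > b * of_int \<bar>j\<bar>}"

lemma far_event: "far b \<in> events"
 unfolding far_def by measurable

text \<open>From height \<open>2 * lg b\<close> on, a Gaussian tail is below \<open>exp (- lg b * b * \<bar>j\<bar>)\<close>, which can be summed geometrically.\<close>

lemma prob_far: "((\<lambda>b. prob (far b)) \<longlongrightarrow> 0) (at_right 0)"
proof (rule tendsto_sandwich[where f="\<lambda>_. 0"])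
 show "((\<lambda>b. 2 * exp (- 2 * (lg b)\<^sup>2) * (1 + 1 / (lg b * b))) \<longlongrightarrow> 0) (at_right 0)" by real_asymp
 show "\<forall>\<^sub>F b in at_right 0. prob (far b) \<le> 2 * exp (- 2 * (lg b)\<^sup>2) * (1 + 1 / (lg b * b))"
  using eventual_bounds scale_bounds
 proof eventually_elim
  case (elim b)
  define K where "K = int (tlen b)"
  have b: "0 < b" and l: "1 \<le> lg b" using elim by auto
  have K: "2 * lg b \<le> b * of_int K" using elim by (simp add: K_def divide_le_eq mult.commute)
  have single: "prob {\<omega>\<in>space M. X j \<omega> > b * of_int \<bar>j\<bar>} \<le> exp (- 2 * (lg b)\<^sup>2) * exp (- (lg b * b) * real i)"
   if j: "\<bar>j\<bar> = K + 1 + int i" for i j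
  proof -
   define T where "T = b * of_int \<bar>j\<bar>"
   have T: "2 * lg b + b * real i \<le> T"
    using K b unfolding T_def j by (simp add: algebra_simps)
   have T2: "2 * lg b \<le> T" using T b by (smt (verit) mult_nonneg_nonneg of_nat_0_le_iff)
   have T1: "1 \<le> T" using T2 l by linarith
   have "prob {\<omega>\<in>space M. X j \<omega> > T} \<le> sqrt 1 / T * exp (- (T\<^sup>2) / (2 * 1))"
    using T1 by (intro span_tail X_in_span) (auto simp: cov_X_X r0)
   also have "\<dots> \<le> 1 * exp (- (T\<^sup>2) / (2 * 1))" using T1 by (intro mult_right_mono) auto
   also have "\<dots> \<le> exp (- 2 * (lg b)\<^sup>2 + - (lg b * b) * real i)"
   proof -
    have "lg b * (2 * lg b + b * real i) \<le> T / 2 * T"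
    proof (rule mult_mono)
     show "0 \<le> 2 * lg b + b * real i" using l mult_nonneg_nonneg[of b "real i"] b of_nat_0_le_iff[of i] by linarith
    qed (use T T1 T2 in auto)
    then show ?thesis by (simp add: power2_eq_square algebra_simps)
   qed
   finally show ?thesis by (simp only: T_def exp_add)
  qed
  have "far b = (\<Union>j\<in>{j. K + 1 \<le> \<bar>j\<bar>}. {\<omega>\<in>space M. X j \<omega> > b * of_int \<bar>j\<bar>})"
   by (auto simp: far_def K_def add1_zle_eq)
  also have "prob \<dots> \<le> 2 * exp (- 2 * (lg b)\<^sup>2) * (1 + 1 / (lg b * b))"
  proof (rule prob_two_sided_union_le)
   show "0 < lg b * b" by (rule mult_pos_pos[OF less_le_trans[OF zero_less_one l] b])
  qed (use single in \<open>auto simp: K_def\<close>)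
  finally show ?case .
 qed
qed auto

text \<open>Outside this event the set of indices that defines \<open>Upsilon\<close> is nonempty.\<close>

definition dip :: "real \<Rightarrow> 'a set" where
 "dip b = {\<omega>\<in>space M. X (int (tlen b)) \<omega> \<le> - b * of_int (int (tlen b))}"

lemma prob_dip: "((\<lambda>b. prob (dip b)) \<longlongrightarrow> 0) (at_right 0)"
proof (rule tendsto_sandwich[where f="\<lambda>_. 0"])
 show "((\<lambda>b. exp (- ((lg b)\<^sup>2) / 2)) \<longlongrightarrow> 0) (at_right 0)" by real_asymp
 show "\<forall>\<^sub>F b in at_right 0. prob (dip b) \<le> exp (- ((lg b)\<^sup>2) / 2)"
  using eventual_bounds scale_bounds
 proof eventually_elim
  case (elim b)
  have K: "2 * lg b \<le> b * of_int (int (tlen b))" using elim by (simp add: divide_le_eq mult.commute)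
  have l: "1 \<le> lg b" using elim by simp
  have "prob (dip b) \<le> prob {\<omega>\<in>space M. -1 * X (int (tlen b)) \<omega> > lg b}"
   using K l unfolding dip_def by (intro finite_measure_mono) auto
  also have "\<dots> \<le> sqrt 1 / lg b * exp (- ((lg b)\<^sup>2) / (2 * 1))"
   using l by (intro span_tail cmult_in_span X_in_span) (auto simp only: cov_cmult_left cov_cmult_right cov_X_X, auto simp: r0)
  also have "\<dots> \<le> 1 * exp (- ((lg b)\<^sup>2) / (2 * 1))" using l by (intro mult_right_mono) auto
  finally show ?case by simp
 qed
qed auto

text \<open>The residual at an index between \<open>u_fun r b z\<close> and the truncation point exceeds the boundary reduced by the largest
 value that the mean takes on the event \<open>S \<le> sqrt \<rho> * (z - \<epsilon>)\<close>.\<close>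

definition near :: "real \<Rightarrow> real \<Rightarrow> real \<Rightarrow> 'a set" where
 "near \<epsilon> z b = {\<omega>\<in>space M. \<exists>j. u_fun r b z < of_int \<bar>j\<bar> \<and> \<bar>j\<bar> \<le> int (tlen b) \<and>
   resid 0 (tlen b) j \<omega> > b * of_int \<bar>j\<bar> - sqrt (rho r b) * (z - \<epsilon>)}"

lemma near_event: "near \<epsilon> z b \<in> events"
 unfolding near_def by measurable

text \<open>All lags between the window and \<open>j\<close> are at most twice the truncation point, which bounds the covariance of \<open>X j\<close>
 with the mean from below by \<open>r (2 * tlen b)\<close>.\<close>

lemma resid_var_central_le:
 "\<forall>\<^sub>F b in at_right 0. \<forall>j. \<bar>j\<bar> \<le> int (tlen b) \<longrightarrow>
   cov (resid 0 (tlen b) j) (resid 0 (tlen b) j) \<le> 1 - rho r b + 2 * slack b"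
 using scale_bounds
proof eventually_elim
 case (elim b)
 have K: "0 < tlen b" using elim by simp
 have "r (tlen b) \<le> r (wlen b)" "rho r b \<le> r (wlen b)"
  unfolding rho_eq using elim by (auto intro!: r_dec)
 moreover have "r (2 * tlen b) \<le> cov (X j) (window_mean 0 (tlen b))" if "\<bar>j\<bar> \<le> int (tlen b)" for j
  using that by (intro cov_X_window_ge[OF K]) auto
 ultimately show ?case
  using window_var_bounds[OF K, of 0] excess_nonneg[of "wlen b"] excess_nonneg[of "tlen b"] r0
  unfolding slack_def cov_resid by fastforce
qed

lemma prob_near:
 assumes \<epsilon>: "\<epsilon> > 0"
 shows "((\<lambda>b. prob (near \<epsilon> z b)) \<longlongrightarrow> 0) (at_right 0)"
proof (rule tendsto_sandwich[where f="\<lambda>_. 0"])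
 define T where "T b = centre b + \<epsilon> * sqrt (rho r b)" for b
 define V where "V b = 1 - rho r b + 2 * slack b" for b
 show "((\<lambda>b. 2 * (sqrt (V b) / T b * exp (- ((T b)\<^sup>2) / (2 * V b))) * (1 + 1 / (T b * b / V b))) \<longlongrightarrow> 0) (at_right 0)"
  unfolding T_def V_def by (rule near_sum_tendsto(1)[OF \<epsilon>])
 show "\<forall>\<^sub>F b in at_right 0. prob (near \<epsilon> z b) \<le> 2 * (sqrt (V b) / T b * exp (- ((T b)\<^sup>2) / (2 * V b))) * (1 + 1 / (T b * b / V b))"
  using near_sum_tendsto(2)[OF \<epsilon>, folded T_def V_def] resid_var_central_le[folded V_def] eventual_bounds u_fun_nonneg[of z]
 proof eventually_elim
  case (elim b)
  define C where "C = sqrt (V b) / T b * exp (- ((T b)\<^sup>2) / (2 * V b))"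
  define s where "s = sqrt (rho r b) * (z - \<epsilon>)"
  define u where "u = u_fun r b z"
  define p where "p = \<lfloor>u\<rfloor> + 1"
  have T0: "T b > 0" and V0: "V b > 0" and b: "b > 0" and u0: "0 \<le> u" using elim by (auto simp: u_def)
  have C0: "C \<ge> 0" using T0 V0 by (simp add: C_def)
  have us: "b * u - s = T b" using u_fun_mult[OF b, of z] by (simp add: u_def s_def T_def algebra_simps)
  have single: "prob {\<omega>\<in>space M. resid 0 (tlen b) j \<omega> > b * of_int \<bar>j\<bar> - s} \<le> C * exp (- (T b * b / V b) * real i)"
   if j: "\<bar>j\<bar> = p + int i" "\<bar>j\<bar> \<le> int (tlen b)" for i j
  proof -
   define t where "t = b * of_int \<bar>j\<bar> - s"
   have "u + real i \<le> of_int \<bar>j\<bar>" unfolding j(1) p_def by linarith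
   then have "b * (u + real i) \<le> b * of_int \<bar>j\<bar>" using b by (intro mult_left_mono) auto
   then have t: "T b + b * real i \<le> t" using us by (simp add: t_def distrib_left)
   have bi: "0 \<le> b * real i" using b by simp
   then have tT: "T b \<le> t" using t by linarith
   have t0: "0 < t" using tT T0 by linarith
   have "prob {\<omega>\<in>space M. resid 0 (tlen b) j \<omega> > t} \<le> sqrt (V b) / t * exp (- (t\<^sup>2) / (2 * V b))"
    using elim(2) j V0 t0 by (intro span_tail resid_in_span) auto
   also have "\<dots> \<le> sqrt (V b) / T b * exp (- ((T b)\<^sup>2) / (2 * V b) + - (T b * b / V b) * real i)"
   proof (rule mult_mono)
    show "sqrt (V b) / t \<le> sqrt (V b) / T b" using tT T0 V0 by (intro divide_left_mono) auto
    have "(T b + b * real i)\<^sup>2 \<le> t\<^sup>2" using t bi T0 by (intro power_mono) auto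
    moreover have "(T b + b * real i)\<^sup>2 = (T b)\<^sup>2 + 2 * (T b * b * real i) + (b * real i)\<^sup>2"
     by (simp add: power2_eq_square algebra_simps)
    ultimately have "(T b)\<^sup>2 + 2 * (T b * b * real i) \<le> t\<^sup>2"
     using zero_le_power2[of "b * real i"] by linarith
    then have "((T b)\<^sup>2 + 2 * (T b * b * real i)) / (2 * V b) \<le> t\<^sup>2 / (2 * V b)"
     using V0 by (intro divide_right_mono) auto
    then show "exp (- (t\<^sup>2) / (2 * V b)) \<le> exp (- ((T b)\<^sup>2) / (2 * V b) + - (T b * b / V b) * real i)"
     by (simp add: add_divide_distrib)
   qed (use T0 V0 in auto)
   also have "\<dots> = C * exp (- (T b * b / V b) * real i)" by (simp only: C_def exp_add mult.assoc)
   finally show ?thesis by (simp add: t_def)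
  qed
  define B where "B j = (if \<bar>j\<bar> \<le> int (tlen b) then {\<omega>\<in>space M. resid 0 (tlen b) j \<omega> > b * of_int \<bar>j\<bar> - s} else {})" for j
  have "p \<le> \<bar>j\<bar>" if "u < of_int \<bar>j\<bar>" for j using that unfolding p_def by linarith
  then have sub: "near \<epsilon> z b \<subseteq> (\<Union>j\<in>{j. p \<le> \<bar>j\<bar>}. B j)"
   by (auto simp: near_def B_def u_def s_def)
  have Bev: "B j \<in> events" for j
  proof -
   have "{\<omega>\<in>space M. resid 0 (tlen b) j \<omega> > b * of_int \<bar>j\<bar> - s} \<in> events" by measurable
   then show ?thesis by (simp add: B_def)
  qed
  have "prob (near \<epsilon> z b) \<le> prob (\<Union>j\<in>{j. p \<le> \<bar>j\<bar>}. B j)"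
   by (rule finite_measure_mono[OF sub]) (auto intro!: Bev sets.countable_UN')
  also have "\<dots> \<le> 2 * C * (1 + 1 / (T b * b / V b))"
  proof (rule prob_two_sided_union_le)
   show "0 \<le> p" using u0 by (simp add: p_def)
  next
   fix j i assume j: "\<bar>j\<bar> = p + int i"
   show "prob (B j) \<le> C * exp (- (T b * b / V b) * real i)"
   proof (cases "\<bar>j\<bar> \<le> int (tlen b)")
    case True
    then show ?thesis using single[OF j] by (simp add: B_def)
   next
    case False
    then show ?thesis using C0 by (simp add: B_def)
   qed
  qed (use Bev T0 V0 b C0 in auto)
  finally show ?case by (simp add: C_def)
 qed
qed auto

text \<open>Either the mean of the window is at most \<open>sqrt \<rho> * (y + \<epsilon>)\<close>, which has asymptotic probability \<open>Phi (y + \<epsilon>)\<close>,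
 or all residuals in the window stay low, which the second-moment bound makes unlikely.\<close>

lemma window_exceedance_upper:
 assumes \<epsilon>: "\<epsilon> > 0" and \<delta>: "\<delta> > 0"
 shows "\<forall>\<^sub>F b in at_right 0.
  prob {\<omega>\<in>space M. \<forall>j\<in>{\<lfloor>u_fun r b y\<rfloor> + 1..<\<lfloor>u_fun r b y\<rfloor> + 1 + int (wlen b)}. X j \<omega> \<le> b * of_int j}
   \<le> Phi (y + \<epsilon>) + \<delta>"
proof -
 define p where "p b = \<lfloor>u_fun r b y\<rfloor> + 1" for b
 define v where "v b = cov (window_mean (p b) (wlen b)) (window_mean (p b) (wlen b))" for b
 define B where "B b = 1 / (real (wlen b) * measure std_normal_distribution {level \<epsilon> b<..level \<epsilon> b + 1}) +
  2 * ((\<Sum>k=1..<wlen b. box_factor ((level \<epsilon> b + 1)\<^sup>2) (resid_corr (wlen b) k) - 1) / real (wlen b))" for b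
 have "((\<lambda>b. Phi (sqrt (rho r b) * (y + \<epsilon>) / sqrt (v b)) + B b) \<longlongrightarrow> Phi (y + \<epsilon>) + 0) (at_right 0)"
  unfolding v_def B_def
  by (intro tendsto_add Phi_scaled_tendsto window_mean_var_rho second_moment_bound_tendsto \<epsilon>) auto
 then have "\<forall>\<^sub>F b in at_right 0. Phi (sqrt (rho r b) * (y + \<epsilon>) / sqrt (v b)) + B b < Phi (y + \<epsilon>) + \<delta>"
  by (rule order_tendstoD(2)) (use \<delta> in simp)
 moreover note resid_corr_1_less
 moreover have "\<forall>\<^sub>F b in at_right 0. b * real (wlen b) \<le> \<epsilon> / 2 * sqrt (rho r b)"
  using \<epsilon> by (intro window_short) simp
 ultimately show ?thesis
  using scale_bounds eventual_bounds level_ge_1[OF \<epsilon>] resid_var_wlen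
 proof eventually_elim
  case (elim b)
  define J where "J = {p b..<p b + int (wlen b)}"
  define s where "s = sqrt (rho r b) * (y + \<epsilon>)"
  define T where "T = centre b - \<epsilon> / 2 * sqrt (rho r b)"
  have W: "0 < wlen b" using elim by simp
  \<comment> \<open>On \<open>window_mean > s\<close> the boundary for \<open>X j\<close> becomes a boundary below \<open>T\<close> for the residual.\<close>
  have thr: "b * of_int j - s \<le> T" if "j \<in> J" for j
  proof -
   have "of_int j \<le> u_fun r b y + real (wlen b)"
   proof -
    have "j \<le> \<lfloor>u_fun r b y\<rfloor> + int (wlen b)" using that by (auto simp: J_def p_def)
    then show ?thesis by linarith
   qed
   then have "b * of_int j \<le> b * (u_fun r b y + real (wlen b))"
    using elim by (intro mult_left_mono) auto
   also have "\<dots> = centre b + sqrt (rho r b) * y + b * real (wlen b)"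
    using elim by (simp add: distrib_left u_fun_mult)
   also have "\<dots> \<le> centre b + sqrt (rho r b) * y + \<epsilon> / 2 * sqrt (rho r b)" using elim by simp
   finally show ?thesis by (simp add: s_def T_def algebra_simps)
  qed
  have "prob {\<omega>\<in>space M. \<forall>j\<in>J. X j \<omega> \<le> b * of_int j} \<le>
   prob ({\<omega>\<in>space M. window_mean (p b) (wlen b) \<omega> \<le> s} \<union> {\<omega>\<in>space M. \<forall>j\<in>J. resid (p b) (wlen b) j \<omega> \<le> T})"
  proof (rule finite_measure_mono)
   show "{\<omega>\<in>space M. window_mean (p b) (wlen b) \<omega> \<le> s} \<union> {\<omega>\<in>space M. \<forall>j\<in>J. resid (p b) (wlen b) j \<omega> \<le> T} \<in> events"
    unfolding J_def by measurable
   show "{\<omega>\<in>space M. \<forall>j\<in>J. X j \<omega> \<le> b * of_int j} \<subseteq>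
    {\<omega>\<in>space M. window_mean (p b) (wlen b) \<omega> \<le> s} \<union> {\<omega>\<in>space M. \<forall>j\<in>J. resid (p b) (wlen b) j \<omega> \<le> T}"
    using thr by (auto simp: resid_def) (smt (verit))
  qed
  also have "\<dots> \<le> prob {\<omega>\<in>space M. window_mean (p b) (wlen b) \<omega> \<le> s} + prob {\<omega>\<in>space M. \<forall>j\<in>J. resid (p b) (wlen b) j \<omega> \<le> T}"
   unfolding J_def by (intro measure_Un_le) measurable
  also have "\<dots> \<le> Phi (s / sqrt (v b)) + B b"
  proof (rule add_mono)
   show "prob {\<omega>\<in>space M. window_mean (p b) (wlen b) \<omega> \<le> s} \<le> Phi (s / sqrt (v b))"
    by (simp add: window_mean_prob[OF W] v_def)
   have v0: "0 < resid_var (wlen b)" using elim by linarith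
   show "prob {\<omega>\<in>space M. \<forall>j\<in>J. resid (p b) (wlen b) j \<omega> \<le> T} \<le> B b"
    unfolding J_def B_def
   proof (rule prob_window_below_le[OF W v0])
    show "T \<le> level \<epsilon> b * sqrt (resid_var (wlen b))" using v0 by (simp add: level_def T_def)
   qed (use elim in auto)
  qed
  finally show ?case using elim(1) unfolding s_def J_def p_def by linarith
 qed
qed

end

section \<open>First entrance and last exit of a path\<close>

lemma Least_int_bounded_below:
 fixes P :: "int \<Rightarrow> bool"
 assumes "P j" "\<And>i. P i \<Longrightarrow> m \<le> i"
 shows "P (LEAST i. P i)" "(LEAST i. P i) \<le> j"
proof -
 define S where "S = {i. P i \<and> i \<le> j}"
 have fin: "finite S" by (rule finite_subset[of _ "{m..j}"]) (auto simp: S_def assms(2))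
 have ne: "S \<noteq> {}" using assms(1) by (auto simp: S_def)
 have "(LEAST i. P i) = Min S"
 proof (rule Least_equality)
  show "P (Min S)" using Min_in[OF fin ne] by (simp add: S_def)
  fix y assume "P y"
  then show "Min S \<le> y"
   using Min_le[OF fin, of y] Min_le[OF fin, of j] assms(1) by (cases "y \<le> j") (auto simp: S_def)
 qed
 then show "P (LEAST i. P i)" "(LEAST i. P i) \<le> j" using Min_in[OF fin ne] by (auto simp: S_def)
qed

lemma Greatest_int_bounded_above:
 fixes P :: "int \<Rightarrow> bool"
 assumes "P j" "\<And>i. P i \<Longrightarrow> i \<le> m"
 shows "P (GREATEST i. P i)" "j \<le> (GREATEST i. P i)"
proof -
 define l where "l = (LEAST i. P (- i))"
 have l: "P (- l)" "l \<le> - j"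
  unfolding l_def using Least_int_bounded_below[of "\<lambda>i. P (- i)" "- j" "- m"] assms by force+
 have "(GREATEST i. P i) = - l"
 proof (rule Greatest_equality)
  show "P (- l)" by (rule l(1))
  fix i assume "P i"
  then have "l \<le> - i"
   unfolding l_def using Least_int_bounded_below(2)[of "\<lambda>i. P (- i)" "- i" "- m"] assms(2) by force
  then show "i \<le> - l" by simp
 qed
 then show "P (GREATEST i. P i)" "j \<le> (GREATEST i. P i)" using l by auto
qed

text \<open>The bound beyond \<open>K\<close> makes the set of exceedances finite, so that its maximum exists.\<close>

lemma tau_le_imp_below:
 assumes "real_of_int (tau b x) \<le> u" and fin: "\<And>i. K < i \<Longrightarrow> x i \<le> b * of_int i"
  and j: "0 \<le> j" "u < real_of_int j"
 shows "x j \<le> b * of_int j"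
proof (rule ccontr)
 assume n: "\<not> x j \<le> b * of_int j"
 then have "\<exists>i\<ge>0. x i > b * of_int i" using j(1) by (auto simp: not_le)
 then have "tau b x = (GREATEST i. 0 \<le> i \<and> x i > b * of_int i)"
  unfolding tau_def by (rule if_P)
 moreover have "j \<le> (GREATEST i. 0 \<le> i \<and> x i > b * of_int i)"
  by (rule Greatest_int_bounded_above(2)[where m=K]) (use n j(1) fin in \<open>force simp: not_le[symmetric]\<close>)+
 ultimately show False using assms(1) j(2) by linarith
qed

lemma tau_leI:
 assumes "0 \<le> u" and below: "\<And>j. u < real_of_int j \<Longrightarrow> x j \<le> b * of_int j"
 shows "real_of_int (tau b x) \<le> u"
proof (cases "\<exists>i\<ge>0. x i > b * of_int i")
 case True
 then obtain k where k: "0 \<le> k" "x k > b * of_int k" by blast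
 define g where "g = (GREATEST i. 0 \<le> i \<and> x i > b * of_int i)"
 have "0 \<le> g \<and> x g > b * of_int g"
  unfolding g_def
 proof (rule Greatest_int_bounded_above(1)[where P="\<lambda>i. 0 \<le> i \<and> x i > b * of_int i"])
  fix i assume "0 \<le> i \<and> x i > b * of_int i"
  then have "\<not> u < real_of_int i" using below[of i] by auto
  then show "i \<le> \<lfloor>u\<rfloor>" by linarith
 qed (use k in blast)
 then have "\<not> u < real_of_int g" using below[of g] by auto
 moreover have "tau b x = g" unfolding tau_def g_def using True by simp
 ultimately show ?thesis by simp
next
 case False
 then have "tau b x = 0" unfolding tau_def by (rule if_not_P)
 then show ?thesis using assms(1) by simp
qed

lemma Upsilon_ge_imp_below:
 assumes "- u \<le> real_of_int (Upsilon b x)" and fin: "\<And>i. K < i \<Longrightarrow> x (- i) \<le> b * of_int i"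
  and j: "u < real_of_int j"
 shows "x (- j) \<le> b * of_int j"
proof (rule ccontr)
 assume n: "\<not> x (- j) \<le> b * of_int j"
 have "(LEAST i. x i > - b * of_int i) \<le> - j"
 proof (rule Least_int_bounded_below(2))
  show "x (- j) > - b * of_int (- j)" using n by simp
  fix i assume "x i > - b * of_int i"
  then show "- K \<le> i" using fin[of "- i"] by (cases "K < - i") auto
 qed
 then show False using assms(1) j by (simp add: Upsilon_def)
qed

text \<open>The index \<open>k\<close> shows that the set that defines \<open>Upsilon\<close> is nonempty, so that its minimum exists.\<close>

lemma Upsilon_geI:
 assumes below: "\<And>j. u < real_of_int j \<Longrightarrow> x (- j) \<le> b * of_int j" and "x k > - b * of_int k"
 shows "- u \<le> real_of_int (Upsilon b x)"
proof -
 have "x (LEAST i. x i > - b * of_int i) > - b * of_int (LEAST i. x i > - b * of_int i)"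
 proof (rule Least_int_bounded_below(1)[where P="\<lambda>i. x i > - b * of_int i"])
  fix i assume "x i > - b * of_int i"
  then have "\<not> u < real_of_int (- i)" using below[of "- i"] by auto
  then show "- \<lfloor>u\<rfloor> \<le> i" by linarith
 qed fact
 then have "\<not> u < real_of_int (- Upsilon b x)" unfolding Upsilon_def
  using below[of "- (LEAST i. x i > - b * of_int i)"] by auto
 then show ?thesis by simp
qed

lemma measurable_Upsilon_tau:
 fixes X :: "int \<Rightarrow> 'a \<Rightarrow> real"
 assumes [measurable]: "\<And>i. X i \<in> borel_measurable M"
 shows "(\<lambda>\<omega>. Upsilon b (\<lambda>i. X i \<omega>)) \<in> measurable M (count_space UNIV)"
  and "(\<lambda>\<omega>. tau b (\<lambda>i. X i \<omega>)) \<in> measurable M (count_space UNIV)"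
proof -
 show "(\<lambda>\<omega>. Upsilon b (\<lambda>i. X i \<omega>)) \<in> measurable M (count_space UNIV)"
  unfolding Upsilon_def Least_def
  by (rule measurable_THE[where I=UNIV]) (measurable, auto intro: order.antisym)
 have g: "(\<lambda>\<omega>. GREATEST i. 0 \<le> i \<and> X i \<omega> > b * of_int i) \<in> measurable M (count_space UNIV)"
  unfolding Greatest_def
  by (rule measurable_THE[where I=UNIV]) (measurable, auto intro: order.antisym)
 show "(\<lambda>\<omega>. tau b (\<lambda>i. X i \<omega>)) \<in> measurable M (count_space UNIV)"
  unfolding tau_def using g by measurable
qed

section \<open>The limit\<close>

context gauss_seq
begin

definition target :: "real \<Rightarrow> real \<Rightarrow> real \<Rightarrow> 'a set" where
 "target x y b = {\<omega>\<in>space M. real_of_int (Upsilon b (\<lambda>i. X i \<omega>)) \<ge> - u_fun r b x \<and>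
   real_of_int (tau b (\<lambda>i. X i \<omega>)) \<le> u_fun r b y}"

lemma target_event: "target x y b \<in> events"
proof -
 note [measurable] = measurable_Upsilon_tau[of X M, OF X_meas]
 show ?thesis unfolding target_def by measurable
qed

lemma target_le_tau:
 assumes "\<epsilon> > 0" "\<delta> > 0"
 shows "\<forall>\<^sub>F b in at_right 0. prob (target x y b) \<le> Phi (y + \<epsilon>) + 2 * \<delta>"
 using window_exceedance_upper[OF assms, of y] order_tendstoD(2)[OF prob_far assms(2)] u_fun_nonneg[of y]
proof eventually_elim
 case (elim b)
 let ?A = "{\<omega>\<in>space M. \<forall>j\<in>{\<lfloor>u_fun r b y\<rfloor> + 1..<\<lfloor>u_fun r b y\<rfloor> + 1 + int (wlen b)}. X j \<omega> \<le> b * of_int j}"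
 have A: "?A \<in> events" by measurable
 have "target x y b \<subseteq> ?A \<union> far b"
 proof
  fix \<omega> assume \<omega>: "\<omega> \<in> target x y b"
  show "\<omega> \<in> ?A \<union> far b"
  proof (cases "\<omega> \<in> far b")
   case False
   have sp: "\<omega> \<in> space M" using \<omega> by (simp add: target_def)
   have fin: "X i \<omega> \<le> b * of_int i" if "int (tlen b) < i" for i
    using False that sp by (auto simp: far_def not_less dest!: spec[of _ i])
   have "X j \<omega> \<le> b * of_int j" if "j \<in> {\<lfloor>u_fun r b y\<rfloor> + 1..<\<lfloor>u_fun r b y\<rfloor> + 1 + int (wlen b)}" for j
   proof (rule tau_le_imp_below[where u="u_fun r b y" and x="\<lambda>i. X i \<omega>", OF _ fin])
    show "real_of_int (tau b (\<lambda>i. X i \<omega>)) \<le> u_fun r b y" using \<omega> by (simp add: target_def)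
    show "u_fun r b y < real_of_int j" using that by (simp add: floor_less_iff[symmetric])
    then show "0 \<le> j" using elim(3) by linarith
   qed
   then show ?thesis using sp by blast
  qed simp
 qed
 then have "prob (target x y b) \<le> prob (?A \<union> far b)"
  using A far_event by (intro finite_measure_mono) auto
 also have "\<dots> \<le> prob ?A + prob (far b)"
  using A far_event by (intro measure_Un_le)
 finally show ?case using elim by linarith
qed

lemma target_le_Upsilon:
 assumes "\<epsilon> > 0" "\<delta> > 0"
 shows "\<forall>\<^sub>F b in at_right 0. prob (target x y b) \<le> Phi (x + \<epsilon>) + 2 * \<delta>"
 using gauss_seq.window_exceedance_upper[OF reflected assms, of x] order_tendstoD(2)[OF prob_far assms(2)] u_fun_nonneg[of x]
proof eventually_elim
 case (elim b)
 let ?A = "{\<omega>\<in>space M. \<forall>j\<in>{\<lfloor>u_fun r b x\<rfloor> + 1..<\<lfloor>u_fun r b x\<rfloor> + 1 + int (wlen b)}. X (- j) \<omega> \<le> b * of_int j}"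
 have A: "?A \<in> events" by measurable
 have "target x y b \<subseteq> ?A \<union> far b"
 proof
  fix \<omega> assume \<omega>: "\<omega> \<in> target x y b"
  show "\<omega> \<in> ?A \<union> far b"
  proof (cases "\<omega> \<in> far b")
   case False
   have sp: "\<omega> \<in> space M" using \<omega> by (simp add: target_def)
   have fin: "X (- i) \<omega> \<le> b * of_int i" if "int (tlen b) < i" for i
    using False that sp by (auto simp: far_def not_less dest!: spec[of _ "- i"])
   have "X (- j) \<omega> \<le> b * of_int j" if "j \<in> {\<lfloor>u_fun r b x\<rfloor> + 1..<\<lfloor>u_fun r b x\<rfloor> + 1 + int (wlen b)}" for j
   proof (rule Upsilon_ge_imp_below[where u="u_fun r b x" and x="\<lambda>i. X i \<omega>", OF _ fin])
    show "- u_fun r b x \<le> real_of_int (Upsilon b (\<lambda>i. X i \<omega>))" using \<omega> by (simp add: target_def)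
    show "u_fun r b x < real_of_int j" using that by (simp add: floor_less_iff[symmetric])
   qed
   then show ?thesis using sp by blast
  qed simp
 qed
 then have "prob (target x y b) \<le> prob (?A \<union> far b)"
  using A far_event by (intro finite_measure_mono) auto
 also have "\<dots> \<le> prob ?A + prob (far b)"
  using A far_event by (intro measure_Un_le)
 finally show ?case using elim by linarith
qed

text \<open>If the central mean is small and none of the three exceptional events occurs, the path stays below the boundary at
 all indices beyond \<open>u_fun r b z\<close> on both sides. One mean serves both sides, hence the minimum.\<close>

lemma target_ge:
 assumes "\<epsilon> > 0" "\<delta> > 0"
 shows "\<forall>\<^sub>F b in at_right 0. Phi (min x y - \<epsilon>) - \<delta> \<le> prob (target x y b)"
proof -
 define z where "z = min x y"
 define v where "v b = cov (window_mean 0 (tlen b)) (window_mean 0 (tlen b))" for b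
 have "((\<lambda>b. Phi (sqrt (rho r b) * (z - \<epsilon>) / sqrt (v b)) - prob (near \<epsilon> z b) - prob (far b) - prob (dip b))
   \<longlongrightarrow> Phi (z - \<epsilon>) - 0 - 0 - 0) (at_right 0)"
  unfolding v_def by (intro tendsto_diff Phi_scaled_tendsto window_mean_var_rho prob_near prob_far prob_dip assms) auto
 then have "\<forall>\<^sub>F b in at_right 0. Phi (z - \<epsilon>) - \<delta> <
   Phi (sqrt (rho r b) * (z - \<epsilon>) / sqrt (v b)) - prob (near \<epsilon> z b) - prob (far b) - prob (dip b)"
  by (rule order_tendstoD(1)) (use assms in simp)
 then show ?thesis using eventual_bounds scale_bounds u_fun_nonneg[of z]
 proof eventually_elim
  case (elim b)
  define s where "s = sqrt (rho r b) * (z - \<epsilon>)"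
  have K: "0 < tlen b" and b: "0 < b" using elim by auto
  let ?S = "{\<omega>\<in>space M. window_mean 0 (tlen b) \<omega> \<le> s}"
  have u_mono: "u_fun r b z \<le> u_fun r b x" "u_fun r b z \<le> u_fun r b y"
   unfolding u_fun_eq z_def using b rho_pos[of b] by (auto intro!: divide_right_mono mult_left_mono)
  have dip_ev: "dip b \<in> events" unfolding dip_def by measurable
  have "?S \<subseteq> ((target x y b \<union> near \<epsilon> z b) \<union> far b) \<union> dip b"
  proof
   fix \<omega> assume "\<omega> \<in> ?S"
   then have sp: "\<omega> \<in> space M" and S: "window_mean 0 (tlen b) \<omega> \<le> s" by auto
   show "\<omega> \<in> ((target x y b \<union> near \<epsilon> z b) \<union> far b) \<union> dip b"
   proof (cases "\<omega> \<in> near \<epsilon> z b \<or> \<omega> \<in> far b \<or> \<omega> \<in> dip b")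
    case False
    have below: "X j \<omega> \<le> b * of_int \<bar>j\<bar>" if j: "u_fun r b z < of_int \<bar>j\<bar>" for j
    proof (cases "\<bar>j\<bar> \<le> int (tlen b)")
     case True
     then have "resid 0 (tlen b) j \<omega> \<le> b * of_int \<bar>j\<bar> - s"
      using False j sp by (auto simp: near_def s_def not_less)
     then show ?thesis using S by (simp add: resid_def)
    next
     case False
     then show ?thesis using \<open>\<not> (\<omega> \<in> near \<epsilon> z b \<or> _)\<close> sp by (auto simp: far_def not_less not_le dest!: spec[of _ j])
    qed
    have "real_of_int (tau b (\<lambda>i. X i \<omega>)) \<le> u_fun r b y"
    proof (rule tau_leI)
     show u0: "0 \<le> u_fun r b y" using elim u_mono by linarith
     fix j assume "u_fun r b y < real_of_int j"
     moreover from this have "\<bar>j\<bar> = j" using u0 by linarith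
     ultimately show "X j \<omega> \<le> b * of_int j" using below[of j] u_mono by simp
    qed
    moreover have "- u_fun r b x \<le> real_of_int (Upsilon b (\<lambda>i. X i \<omega>))"
    proof (rule Upsilon_geI)
     show "X (int (tlen b)) \<omega> > - b * of_int (int (tlen b))"
      using False sp by (auto simp: dip_def not_le)
     fix j assume j: "u_fun r b x < real_of_int j"
     then have "\<bar>j\<bar> = j" using elim u_mono by linarith
     then show "X (- j) \<omega> \<le> b * of_int j" using below[of "- j"] u_mono j by simp
    qed
    ultimately show ?thesis using sp by (simp add: target_def)
   qed auto
  qed
  then have "prob ?S \<le> prob (((target x y b \<union> near \<epsilon> z b) \<union> far b) \<union> dip b)"
   using target_event near_event far_event dip_ev by (intro finite_measure_mono) auto
  also have "\<dots> \<le> prob ((target x y b \<union> near \<epsilon> z b) \<union> far b) + prob (dip b)"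
   using target_event near_event far_event dip_ev by (intro measure_Un_le) auto
  also have "prob ((target x y b \<union> near \<epsilon> z b) \<union> far b) \<le> prob (target x y b \<union> near \<epsilon> z b) + prob (far b)"
   using target_event near_event far_event by (intro measure_Un_le) auto
  also have "prob (target x y b \<union> near \<epsilon> z b) \<le> prob (target x y b) + prob (near \<epsilon> z b)"
   using target_event near_event by (intro measure_Un_le) auto
  finally have "prob ?S \<le> prob (target x y b) + prob (near \<epsilon> z b) + prob (far b) + prob (dip b)" by simp
  moreover have "prob ?S = Phi (s / sqrt (v b))" unfolding v_def by (rule window_mean_prob[OF K])
  ultimately show ?case using elim(1) unfolding s_def z_def[symmetric] by linarith
 qed
qed

lemma target_tendsto: "((\<lambda>b. prob (target x y b)) \<longlongrightarrow> Phi (min x y)) (at_right 0)"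
proof (rule tendstoI)
 fix e :: real assume e: "e > 0"
 have "\<exists>d>0. \<forall>t. dist t (min x y) < d \<longrightarrow> dist (Phi t) (Phi (min x y)) < e / 4"
  using isCont_Phi[of "min x y"] e unfolding continuous_at_eps_delta by (metis divide_pos_pos zero_less_numeral)
 then obtain d where d: "d > 0" "\<And>t. dist t (min x y) < d \<Longrightarrow> dist (Phi t) (Phi (min x y)) < e / 4" by blast
 define \<epsilon> where "\<epsilon> = d / 2"
 have \<epsilon>: "\<epsilon> > 0" using d by (simp add: \<epsilon>_def)
 have lo: "Phi (min x y) - e / 4 < Phi (min x y - \<epsilon>)"
 proof -
  have "dist (min x y - \<epsilon>) (min x y) < d" using d(1) by (simp add: dist_real_def \<epsilon>_def)
  from d(2)[OF this] show ?thesis unfolding dist_real_def by linarith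
 qed
 have up: "Phi (min x y + \<epsilon>) < Phi (min x y) + e / 4"
 proof -
  have "dist (min x y + \<epsilon>) (min x y) < d" using d(1) by (simp add: dist_real_def \<epsilon>_def)
  from d(2)[OF this] show ?thesis unfolding dist_real_def by linarith
 qed
 have e4: "e / 4 > 0" using e by simp
 show "\<forall>\<^sub>F b in at_right 0. dist (prob (target x y b)) (Phi (min x y)) < e"
  using target_ge[OF \<epsilon> e4, of x y] target_le_tau[OF \<epsilon> e4, of x y] target_le_Upsilon[OF \<epsilon> e4, of x y]
 proof eventually_elim
  case (elim b)
  have "prob (target x y b) \<le> Phi (min x y + \<epsilon>) + 2 * (e / 4)" using elim by (simp add: min_def)
  then show ?case using elim(1) lo up e by (simp add: dist_real_def abs_less_iff)
 qed
qed

end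

lemma stationary_product_moment:
 fixes X :: "int \<Rightarrow> 'a \<Rightarrow> real"
 assumes "stationary M X"
 shows "(LINT \<omega>|M. X (a + k) \<omega> * X (b + k) \<omega>) = (LINT \<omega>|M. X a \<omega> * X b \<omega>)"
proof -
 have X: "X i \<in> borel_measurable M" for i
  by (rule assms[unfolded stationary_def, THEN conjunct1, THEN spec])
 let ?P = "PiM UNIV (\<lambda>_::int. borel :: real measure)"
 have m: "(\<lambda>\<omega> i. X (i + l) \<omega>) \<in> measurable M ?P" for l
  by (rule measurable_PiM_single') (simp_all add: X)
 have m0: "(\<lambda>\<omega> i. X i \<omega>) \<in> measurable M ?P"
  by (rule measurable_PiM_single') (simp_all add: X)
 have f: "(\<lambda>x. x a * x b) \<in> borel_measurable ?P"
  by (intro borel_measurable_times measurable_component_singleton UNIV_I)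
 have "(LINT \<omega>|M. X (a + k) \<omega> * X (b + k) \<omega>) = (LINT x|distr M ?P (\<lambda>\<omega> i. X (i + k) \<omega>). x a * x b)"
  using integral_distr[OF m f, of k] by simp
 also have "\<dots> = (LINT x|distr M ?P (\<lambda>\<omega> i. X i \<omega>). x a * x b)"
  using assms[unfolded stationary_def, THEN conjunct2, THEN spec, of k] by (rule arg_cong)
 also have "\<dots> = (LINT \<omega>|M. X a \<omega> * X b \<omega>)"
  using integral_distr[OF m0 f] by simp
 finally show ?thesis .
qed

theorem theorem2p3:
  fixes M :: "'a measure" and X :: "int \<Rightarrow> 'a \<Rightarrow> real" and r :: "nat \<Rightarrow> real" and x y :: real
  assumes "prob_space M"
    and "standard_stationary_gaussian M X"
    and "\<And>n. r n = prob_space.expectation M (\<lambda>\<omega>. X 1 \<omega> * X (int n + 1) \<omega>)"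
    and "convex_seq r"
    and "r \<longlonglongrightarrow> 0"
    and "eventually (\<lambda>n. r n \<noteq> 0) sequentially"
    and "\<exists>N. monoseq (\<lambda>n. inverse (r (n + N) * ln (real (n + N))))"
    and "(\<lambda>n. inverse (r n * ln (real n))) \<longlonglongrightarrow> 0"
  shows "((\<lambda>\<beta>. measure M {\<omega> \<in> space M.
            real_of_int (Upsilon \<beta> (\<lambda>i. X i \<omega>)) \<ge> - u_fun r \<beta> x \<and>
            real_of_int (tau \<beta> (\<lambda>i. X i \<omega>)) \<le> u_fun r \<beta> y})
          \<longlongrightarrow> Phi (min x y)) (at_right 0)"
proof -
 interpret prob_space M by fact
 have gp: "gaussian_process M X" and st: "stationary M X"
  and nd: "\<And>i. distributed M lborel (X i) std_normal_density"
  using assms(2) by (auto simp: standard_stationary_gaussian_def)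
 have meas: "X i \<in> borel_measurable M" for i
  by (rule st[unfolded stationary_def, THEN conjunct1, THEN spec])
 have mean: "expectation (X i) = 0" for i by (rule standard_normal_distributed_expectation[OF nd])
 have sq: "integrable M (\<lambda>\<omega>. X i \<omega> * X i \<omega>)" for i
  using distributed_integrable[OF nd, of "\<lambda>x. x ^ 2" i] integrable_std_normal_moment[of 2]
  by (simp add: power2_eq_square normal_density_nonneg)
 have var: "expectation (\<lambda>\<omega>. X i \<omega> * X i \<omega>) = 1" for i
  using standard_normal_distributed_variance[OF nd, of i] mean[of i] by (simp add: power2_eq_square)
 have r0: "r 0 = 1" unfolding assms(3) using var[of 1] by simp
 have cov_le: "expectation (\<lambda>\<omega>. X i \<omega> * X j \<omega>) = r (nat \<bar>i - j\<bar>)" if "i \<le> j" for i j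
  using stationary_product_moment[OF st, of 1 "i - 1" "int (nat (j - i)) + 1"] that by (simp add: assms(3))
 have cov: "expectation (\<lambda>\<omega>. X i \<omega> * X j \<omega>) = r (nat \<bar>i - j\<bar>)" for i j
 proof (cases "i \<le> j")
  case False
  then have "expectation (\<lambda>\<omega>. X j \<omega> * X i \<omega>) = r (nat \<bar>j - i\<bar>)" by (intro cov_le) simp
  then show ?thesis by (simp add: mult.commute abs_minus_commute)
 qed (rule cov_le)
 obtain N0 where N0: "slow_cov r N0" using slow_cov_intro[OF r0 assms(4-8)] ..
 interpret slow_cov r N0 by (rule N0)
 interpret gauss_seq M r N0 X
  by unfold_locales (fact meas gp mean sq cov)+
 show ?thesis using target_tendsto[of x y] unfolding target_def .
qed

end
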